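(* Let $(A,S,P)$ be a $\mathbb P$-contraction on a Hilbert space $\mathcal H$. Then $\mathcal H=\mathcal H_u\oplus\mathcal H_c$ for closed subspaces $\mathcal H_u,\mathcal H_c$ reducing each of $A,S,P$, such that $(A|_{\mathcal H_u},S|_{\mathcal H_u},P|_{\mathcal H_u})$ is a $\mathbb P$-unitary and $(A|_{\mathcal H_c},S|_{\mathcal H_c},P|_{\mathcal H_c})$ is a completely non-unitary $\mathbb P$-contraction.
   Context: The pentablock is $\mathbb P=\{(a_{21},\operatorname{tr}A_0,\det A_0): A_0=[a_{ij}]\in M_2(\mathbb C),\ \|A_0\|<1\}\subset\mathbb C^3$ with closure $\overline{\mathbb P}$. A commuting triple $(A,S,P)$ of bounded operators is a $\mathbb P$-contraction if $\overline{\mathbb P}$ is a spectral set for it: its Taylor joint spectrum lies in $\overline{\mathbb P}$ and $\|f(A,S,P)\|\le\sup_{\overline{\mathbb P}}|f|$ for every rational function $f$ with no poles in $\overline{\mathbb P}$. With $b\Gamma=\{(z_1+z_2,z_1z_2):|z_1|=|z_2|=1\}$, the distinguished boundary of $\mathbb P$ is $b\mathbb P=\{(a,s,p):(s,p)\in b\Gamma,\ |a|^2+\frac14|s|^2=1\}$. A $\mathbb P$-unitary is a commuting triple of normal operators whose Taylor joint spectrum lies in $b\mathbb P$. A $\mathbb P$-contraction is completely non-unitary if there is no nonzero closed joint reducing subspace on which it restricts to a $\mathbb P$-unitary. *)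

theory Defs
  imports "HOL-Analysis.Analysis"
begin

class chilbert = banach +
  fixes scaleC :: "complex \<Rightarrow> 'a \<Rightarrow> 'a"
    and cinner :: "'a \<Rightarrow> 'a \<Rightarrow> complex"
  assumes scaleC_add_right: "scaleC c (x + y) = scaleC c x + scaleC c y"
    and scaleC_add_left: "scaleC (b + c) x = scaleC b x + scaleC c x"
    and scaleC_scaleC: "scaleC b (scaleC c x) = scaleC (b * c) x"
    and scaleC_one: "scaleC 1 x = x"
    and scaleC_of_real: "scaleC (complex_of_real r) x = scaleR r x"
    and cinner_commute: "cinner x y = cnj (cinner y x)"
    and cinner_add_left: "cinner (x + y) z = cinner x z + cinner y z"
    and cinner_scaleC_left: "cinner (scaleC c x) y = cnj c * cinner x y"
    and cinner_self_norm: "cinner x x = complex_of_real ((norm x)\<^sup>2)"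

definition csubspace :: "'a::chilbert set \<Rightarrow> bool" where
  "csubspace M \<longleftrightarrow> 0 \<in> M \<and> (\<forall>x\<in>M. \<forall>y\<in>M. x + y \<in> M) \<and> (\<forall>c. \<forall>x\<in>M. scaleC c x \<in> M)"

definition closed_csubspace :: "'a::chilbert set \<Rightarrow> bool" where
  "closed_csubspace M \<longleftrightarrow> csubspace M \<and> closed M"

definition orth_in :: "'a::chilbert set \<Rightarrow> 'a set \<Rightarrow> 'a set" where
  "orth_in M N = {x\<in>M. \<forall>y\<in>N. cinner y x = 0}"

definition bounded_clinear_on :: "'a::chilbert set \<Rightarrow> ('a \<Rightarrow> 'a) \<Rightarrow> bool" where
  "bounded_clinear_on M T \<longleftrightarrow> T ` M \<subseteq> M
     \<and> (\<forall>x\<in>M. \<forall>y\<in>M. T (x + y) = T x + T y)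
     \<and> (\<forall>c. \<forall>x\<in>M. T (scaleC c x) = scaleC c (T x))
     \<and> (\<exists>K. \<forall>x\<in>M. norm (T x) \<le> K * norm x)"

definition reduces_in :: "'a::chilbert set \<Rightarrow> 'a set \<Rightarrow> ('a \<Rightarrow> 'a) \<Rightarrow> bool" where
  "reduces_in M N T \<longleftrightarrow> N \<subseteq> M \<and> T ` N \<subseteq> N \<and> T ` (orth_in M N) \<subseteq> orth_in M N"

definition normal_on :: "'a::chilbert set \<Rightarrow> ('a \<Rightarrow> 'a) \<Rightarrow> bool" where
  "normal_on M T \<longleftrightarrow> bounded_clinear_on M T \<and>
     (\<exists>T'. T' ` M \<subseteq> M \<and> (\<forall>x\<in>M. \<forall>y\<in>M. cinner (T x) y = cinner x (T' y))
           \<and> (\<forall>x\<in>M. T (T' x) = T' (T x)))"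

definition commuting_on :: "'a::chilbert set \<Rightarrow> ('a \<Rightarrow> 'a) \<Rightarrow> ('a \<Rightarrow> 'a) \<Rightarrow> ('a \<Rightarrow> 'a) \<Rightarrow> bool" where
  "commuting_on M T1 T2 T3 \<longleftrightarrow>
     (\<forall>x\<in>M. T1 (T2 x) = T2 (T1 x) \<and> T1 (T3 x) = T3 (T1 x) \<and> T2 (T3 x) = T3 (T2 x))"

text \<open>Koszul complex of a commuting triple on M:
  0 -> M -> M^3 -> M^3 -> M -> 0 with
  d1 x = (T1 x, T2 x, T3 x),
  d2 (x1,x2,x3) = (T2 x3 - T3 x2, T3 x1 - T1 x3, T1 x2 - T2 x1),
  d3 (y1,y2,y3) = T1 y1 + T2 y2 + T3 y3.
  The triple is Taylor-regular iff this complex is exact.\<close>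
definition taylor_regular :: "'a::chilbert set \<Rightarrow> ('a \<Rightarrow> 'a) \<Rightarrow> ('a \<Rightarrow> 'a) \<Rightarrow> ('a \<Rightarrow> 'a) \<Rightarrow> bool" where
  "taylor_regular M T1 T2 T3 \<longleftrightarrow>
     (\<forall>x\<in>M. T1 x = 0 \<and> T2 x = 0 \<and> T3 x = 0 \<longrightarrow> x = 0)
   \<and> (\<forall>x1\<in>M. \<forall>x2\<in>M. \<forall>x3\<in>M.
        T2 x3 - T3 x2 = 0 \<and> T3 x1 - T1 x3 = 0 \<and> T1 x2 - T2 x1 = 0 \<longrightarrow>
        (\<exists>x\<in>M. x1 = T1 x \<and> x2 = T2 x \<and> x3 = T3 x))
   \<and> (\<forall>y1\<in>M. \<forall>y2\<in>M. \<forall>y3\<in>M. T1 y1 + T2 y2 + T3 y3 = 0 \<longrightarrow>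
        (\<exists>x1\<in>M. \<exists>x2\<in>M. \<exists>x3\<in>M.
           y1 = T2 x3 - T3 x2 \<and> y2 = T3 x1 - T1 x3 \<and> y3 = T1 x2 - T2 x1))
   \<and> (\<forall>w\<in>M. \<exists>y1\<in>M. \<exists>y2\<in>M. \<exists>y3\<in>M. w = T1 y1 + T2 y2 + T3 y3)"

definition taylor_spectrum ::
  "'a::chilbert set \<Rightarrow> ('a \<Rightarrow> 'a) \<Rightarrow> ('a \<Rightarrow> 'a) \<Rightarrow> ('a \<Rightarrow> 'a) \<Rightarrow> (complex \<times> complex \<times> complex) set" where
  "taylor_spectrum M T1 T2 T3 = {(z1, z2, z3).
     \<not> taylor_regular M (\<lambda>x. T1 x - scaleC z1 x) (\<lambda>x. T2 x - scaleC z2 x) (\<lambda>x. T3 x - scaleC z3 x)}"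

definition poly3 :: "(nat \<times> nat \<times> nat \<Rightarrow> complex) \<Rightarrow> bool" where
  "poly3 c \<longleftrightarrow> finite {k. c k \<noteq> 0}"

definition poly3_eval :: "(nat \<times> nat \<times> nat \<Rightarrow> complex) \<Rightarrow> complex \<times> complex \<times> complex \<Rightarrow> complex" where
  "poly3_eval c z = (\<Sum>k\<in>{k. c k \<noteq> 0}. case k of (i, j, l) \<Rightarrow>
      c k * fst z ^ i * fst (snd z) ^ j * snd (snd z) ^ l)"

definition poly3_op :: "(nat \<times> nat \<times> nat \<Rightarrow> complex) \<Rightarrow> ('a::chilbert \<Rightarrow> 'a) \<Rightarrow> ('a \<Rightarrow> 'a) \<Rightarrow> ('a \<Rightarrow> 'a) \<Rightarrow> 'a \<Rightarrow> 'a" where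
  "poly3_op c T1 T2 T3 x = (\<Sum>k\<in>{k. c k \<noteq> 0}. case k of (i, j, l) \<Rightarrow>
      scaleC (c k) ((T1 ^^ i) ((T2 ^^ j) ((T3 ^^ l) x))))"

definition pentablock :: "(complex \<times> complex \<times> complex) set" where
  "pentablock = {(A0 $ 2 $ 1, trace A0, det A0) | A0 :: complex^2^2.
                   onorm (\<lambda>v::complex^2. A0 *v v) < 1}"

definition bGamma :: "(complex \<times> complex) set" where
  "bGamma = {(z1 + z2, z1 * z2) | z1 z2. cmod z1 = 1 \<and> cmod z2 = 1}"

definition bPenta :: "(complex \<times> complex \<times> complex) set" where
  "bPenta = {(a, s, p). (s, p) \<in> bGamma \<and> (cmod a)\<^sup>2 + (cmod s)\<^sup>2 / 4 = 1}"

text \<open>closure(pentablock) is a spectral set for (A,S,P)|M: Taylor spectrum inside it, and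
for every rational function f = p/q with q zero-free on closure(pentablock),
f(A,S,P) = p(A,S,P) q(A,S,P)^{-1} satisfies the von Neumann type bound.\<close>
definition penta_contraction_on ::
  "'a::chilbert set \<Rightarrow> ('a \<Rightarrow> 'a) \<Rightarrow> ('a \<Rightarrow> 'a) \<Rightarrow> ('a \<Rightarrow> 'a) \<Rightarrow> bool" where
  "penta_contraction_on M A S P \<longleftrightarrow>
     bounded_clinear_on M A \<and> bounded_clinear_on M S \<and> bounded_clinear_on M P
   \<and> commuting_on M A S P
   \<and> taylor_spectrum M A S P \<subseteq> closure pentablock
   \<and> (\<forall>p q. poly3 p \<and> poly3 q \<and> (\<forall>z\<in>closure pentablock. poly3_eval q z \<noteq> 0) \<longrightarrow>
        bij_betw (poly3_op q A S P) M M
      \<and> (\<forall>y\<in>M. norm (poly3_op p A S P (the_inv_into M (poly3_op q A S P) y))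
             \<le> (SUP z\<in>closure pentablock. cmod (poly3_eval p z / poly3_eval q z)) * norm y))"

definition penta_unitary_on ::
  "'a::chilbert set \<Rightarrow> ('a \<Rightarrow> 'a) \<Rightarrow> ('a \<Rightarrow> 'a) \<Rightarrow> ('a \<Rightarrow> 'a) \<Rightarrow> bool" where
  "penta_unitary_on M A S P \<longleftrightarrow>
     normal_on M A \<and> normal_on M S \<and> normal_on M P \<and> commuting_on M A S P
   \<and> taylor_spectrum M A S P \<subseteq> bPenta"

definition penta_cnu_on ::
  "'a::chilbert set \<Rightarrow> ('a \<Rightarrow> 'a) \<Rightarrow> ('a \<Rightarrow> 'a) \<Rightarrow> ('a \<Rightarrow> 'a) \<Rightarrow> bool" where
  "penta_cnu_on M A S P \<longleftrightarrow> penta_contraction_on M A S P \<and>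
     \<not> (\<exists>N. closed_csubspace N \<and> N \<noteq> {0} \<and>
            reduces_in M N A \<and> reduces_in M N S \<and> reduces_in M N P \<and>
            penta_unitary_on N A S P)"

end

theory Submission
  imports Defs
begin

text \<open>A commuting triple of normal operators has its Taylor spectrum in the distinguished boundary iff
  $P$ is unitary, $S = S^* P$ and $A^* A + S^* S / 4 = 1$: these are the equations of the boundary read as
  operator identities. Hence the largest subspace that is invariant under $A, S, P$ and their adjoints and
  on which these identities and $A A^* = A^* A$ hold is the largest reducing subspace on which the triple is
  a pentablock unitary, and its orthogonal complement carries the completely non-unitary part.

  If the identities hold, then the triple is doubly commuting, so every point of the Taylor spectrum is a
  limit of approximate joint eigenvalues and satisfies the equations. Conversely, if an identity $Q = 0$
  fails for a unitary triple, we cut the space into small joint spectral subspaces; $Q$ is not small on one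
  of them, which by compactness yields an approximate joint eigenvalue outside the boundary. The spectral
  subspaces come from the sign decomposition of $D^* D - r^2$ for the normal operators $D = T - \lambda$.\<close>

section \<open>Complex Hilbert spaces\<close>

text \<open>The Taylor spectrum is defined by exactness of a Koszul complex, whereas the boundary
  identities speak about single vectors. Approximate joint eigenvectors link the two, by a different
  argument in each direction. From the spectrum to vectors: if a doubly commuting triple is jointly
  bounded below, then \<open>T1' T1 + T2' T2 + T3' T3\<close> is invertible, and its inverse times
  the \<open>Ti'\<close> contract the complex; so a spectral point has approximate eigenvectors.
  From vectors to the spectrum: exactness at the last place makes the adjoints jointly bounded
  below, which approximate eigenvectors of the adjoints contradict, and normality turns those of the
  triple into those of the adjoints. A sign decomposition controls only the distance of the spectrum
  of \<open>T\<close> from one centre. Each operator is therefore cut about the three centres 0, 1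
  and i: they are not collinear, so thin annuli about them meet in a small set and \<open>T\<close>
  is nearly scalar on the resulting pieces.\<close>

lemma cinner_add_right: "cinner x (y + z) = cinner x y + cinner x (z::'a::chilbert)"
  by (metis cinner_add_left cinner_commute complex_cnj_add)

lemma cinner_scaleC_right: "cinner x (scaleC c y) = c * cinner x (y::'a::chilbert)"
  by (metis cinner_commute cinner_scaleC_left complex_cnj_cnj complex_cnj_mult)

lemma scaleC_zero_left [simp]: "scaleC 0 (x::'a::chilbert) = 0"
  using scaleC_of_real[of 0 x] by simp

lemma scaleC_zero_right [simp]: "scaleC c (0::'a::chilbert) = 0"
  using scaleC_add_right[of c 0 0] by simp

lemma scaleC_minus_one: "scaleC (- 1) (x::'a::chilbert) = - x"
  using scaleC_of_real[of "-1" x] by simp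

lemma scaleC_minus_left: "scaleC (- c) (x::'a::chilbert) = - scaleC c x"
  by (metis mult_minus1 scaleC_minus_one scaleC_scaleC)

lemma scaleC_minus_right: "scaleC c (- x) = - scaleC c (x::'a::chilbert)"
  by (metis add.right_inverse add_eq_0_iff scaleC_add_right scaleC_zero_right)

lemma scaleC_diff_left: "scaleC (b - c) (x::'a::chilbert) = scaleC b x - scaleC c x"
  by (metis diff_conv_add_uminus scaleC_add_left scaleC_minus_left)

lemma scaleC_diff_right: "scaleC c (x - y) = scaleC c x - scaleC c (y::'a::chilbert)"
  by (metis diff_conv_add_uminus scaleC_add_right scaleC_minus_right)

lemma scaleC_scaleR: "scaleC c (r *\<^sub>R x) = r *\<^sub>R scaleC c (x::'a::chilbert)"
  by (metis mult.commute scaleC_of_real scaleC_scaleC)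

lemma cinner_zero_left [simp]: "cinner 0 (x::'a::chilbert) = 0"
  using cinner_add_left[of 0 0 x] by simp

lemma cinner_zero_right [simp]: "cinner (x::'a::chilbert) 0 = 0"
  using cinner_add_right[of x 0 0] by simp

lemma cinner_minus_left [simp]: "cinner (- x) (y::'a::chilbert) = - cinner x y"
  using cinner_add_left[of x "- x" y] by (simp add: eq_neg_iff_add_eq_0 add.commute)

lemma cinner_minus_right [simp]: "cinner x (- y::'a::chilbert) = - cinner x y"
  using cinner_add_right[of x y "- y"] by (simp add: eq_neg_iff_add_eq_0 add.commute)

lemma cinner_diff_left: "cinner (x - y) (z::'a::chilbert) = cinner x z - cinner y z"
  by (metis cinner_add_left cinner_minus_left diff_conv_add_uminus)

lemma cinner_diff_right: "cinner x (y - z::'a::chilbert) = cinner x y - cinner x z"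
  by (metis cinner_add_right cinner_minus_right diff_conv_add_uminus)

lemma cinner_scaleR_left: "cinner (r *\<^sub>R x) (y::'a::chilbert) = r * cinner x y"
  by (metis cinner_scaleC_left complex_cnj_complex_of_real scaleC_of_real)

lemma cinner_scaleR_right: "cinner x (r *\<^sub>R y::'a::chilbert) = r * cinner x y"
  by (metis cinner_scaleC_right scaleC_of_real)

lemmas cinner_simps = cinner_add_left cinner_add_right cinner_diff_left cinner_diff_right
  cinner_scaleC_left cinner_scaleC_right cinner_scaleR_left cinner_scaleR_right

lemma cinner_orth_commute: "cinner x y = 0 \<longleftrightarrow> cinner y (x::'a::chilbert) = 0"
  by (metis cinner_commute complex_cnj_zero_iff)

lemma norm_sq_cinner: "(norm (x::'a::chilbert))\<^sup>2 = Re (cinner x x)"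
  by (simp add: cinner_self_norm)

lemma cinner_self_eq_zero [simp]: "cinner x x = 0 \<longleftrightarrow> x = (0::'a::chilbert)"
  by (simp add: cinner_self_norm)

lemma cinner_eqI: "(\<And>y. cinner y x = cinner y z) \<Longrightarrow> x = (z::'a::chilbert)"
  by (metis cinner_diff_right cinner_self_eq_zero eq_iff_diff_eq_0)

lemma norm_add_sq: "(norm (x + y::'a::chilbert))\<^sup>2 = (norm x)\<^sup>2 + 2 * Re (cinner x y) + (norm y)\<^sup>2"
  unfolding norm_sq_cinner using cinner_commute[of y x] by (simp add: cinner_simps)

lemma norm_diff_sq: "(norm (x - y::'a::chilbert))\<^sup>2 = (norm x)\<^sup>2 - 2 * Re (cinner x y) + (norm y)\<^sup>2"
  unfolding norm_sq_cinner using cinner_commute[of y x] by (simp add: cinner_simps)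

lemma norm_scaleC [simp]: "norm (scaleC c (x::'a::chilbert)) = cmod c * norm x"
proof -
  have "complex_of_real ((norm (scaleC c x))\<^sup>2) = complex_of_real ((cmod c)\<^sup>2 * (norm x)\<^sup>2)"
    unfolding cinner_self_norm[symmetric] of_real_mult complex_norm_square
    by (simp add: cinner_simps algebra_simps)
  then have "(norm (scaleC c x))\<^sup>2 = (cmod c * norm x)\<^sup>2"
    by (simp add: power_mult_distrib flip: of_real_power of_real_mult)
  then show ?thesis by (simp add: power2_eq_iff_nonneg)
qed

lemma cinner_cauchy_schwarz: "cmod (cinner x y) \<le> norm x * norm (y::'a::chilbert)"
proof (cases "x = 0")
  case False
  \<comment> \<open>\<open>scaleC c x\<close> is the orthogonal projection of \<open>y\<close> onto
    the line of \<open>x\<close>.\<close>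
  define c where "c = cinner x y / (norm x)\<^sup>2"
  have n: "norm x > 0" using False by simp
  have "0 \<le> (norm (y - scaleC c x))\<^sup>2" by simp
  also have "\<dots> = (norm y)\<^sup>2 - 2 * Re (c * cinner y x) + (cmod c * norm x)\<^sup>2"
    unfolding norm_diff_sq by (simp add: cinner_simps)
  also have "c * cinner y x = complex_of_real ((cmod (cinner x y))\<^sup>2 / (norm x)\<^sup>2)"
    unfolding c_def using cinner_commute[of y x] complex_norm_square[of "cinner x y"] by simp
  also have "(cmod c * norm x)\<^sup>2 = (cmod (cinner x y))\<^sup>2 / (norm x)\<^sup>2"
    unfolding c_def using n by (simp add: norm_divide power_divide power_mult_distrib field_simps norm_power)
  finally have "(cmod (cinner x y))\<^sup>2 / (norm x)\<^sup>2 \<le> (norm y)\<^sup>2" by simp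
  then have "(cmod (cinner x y))\<^sup>2 \<le> (norm x * norm y)\<^sup>2"
    using n by (simp add: field_simps)
  then show ?thesis by (simp add: power2_le_iff_abs_le)
qed simp

lemma Re_cinner_le: "Re (cinner x y) \<le> norm x * norm (y::'a::chilbert)"
  by (meson cinner_cauchy_schwarz complex_Re_le_cmod order_trans)

lemma bounded_linear_cinner_right: "bounded_linear (\<lambda>y. cinner x (y::'a::chilbert))"
  by (rule bounded_linear_intro[where K = "norm x"])
    (simp_all add: cinner_simps scaleR_conv_of_real cinner_cauchy_schwarz mult.commute[of "norm _" "norm x"])

lemma bounded_linear_cinner_left: "bounded_linear (\<lambda>x. cinner x (y::'a::chilbert))"
  by (rule bounded_linear_intro[where K = "norm y"])
    (simp_all add: cinner_simps scaleR_conv_of_real cinner_cauchy_schwarz)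

lemma bounded_linear_scaleC: "bounded_linear (scaleC c :: 'a::chilbert \<Rightarrow> 'a)"
  by (rule bounded_linear_intro[where K = "cmod c"])
    (simp_all add: scaleC_add_right scaleC_scaleR mult.commute)

lemma pythagoras: "cinner x y = 0 \<Longrightarrow> (norm (x + y::'a::chilbert))\<^sup>2 = (norm x)\<^sup>2 + (norm y)\<^sup>2"
  by (simp add: norm_add_sq)

section \<open>Closed subspaces and orthogonal projections\<close>

lemma csubspaceD:
  assumes "csubspace M"
  shows "0 \<in> M" "\<And>x y. x \<in> M \<Longrightarrow> y \<in> M \<Longrightarrow> x + y \<in> M" "\<And>c x. x \<in> M \<Longrightarrow> scaleC c x \<in> M"
    "\<And>x y. x \<in> M \<Longrightarrow> y \<in> M \<Longrightarrow> x - y \<in> M" "\<And>r x. x \<in> M \<Longrightarrow> r *\<^sub>R x \<in> M"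
    "\<And>x. x \<in> M \<Longrightarrow> - x \<in> M"
proof -
  show 1: "0 \<in> M" "\<And>x y. x \<in> M \<Longrightarrow> y \<in> M \<Longrightarrow> x + y \<in> M" "\<And>c x. x \<in> M \<Longrightarrow> scaleC c x \<in> M"
    using assms unfolding csubspace_def by blast+
  show 2: "\<And>x. x \<in> M \<Longrightarrow> - x \<in> M" using 1(3)[of _ "-1"] by (simp add: scaleC_minus_one)
  show "\<And>x y. x \<in> M \<Longrightarrow> y \<in> M \<Longrightarrow> x - y \<in> M" using 1(2) 2 by fastforce
  show "\<And>r x. x \<in> M \<Longrightarrow> r *\<^sub>R x \<in> M" using 1(3) by (metis scaleC_of_real)
qed

lemma closed_csubspace_Int:
  "closed_csubspace M \<Longrightarrow> closed_csubspace N \<Longrightarrow> closed_csubspace (M \<inter> N)"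
  by (auto simp: closed_csubspace_def csubspace_def)

lemma closed_csubspace_orth_in: "closed_csubspace (orth_in UNIV (M::'a::chilbert set))"
proof -
  have "orth_in UNIV M = (\<Inter>y\<in>M. {x. cinner y x = 0})" by (auto simp: orth_in_def)
  moreover have "closed {x. cinner y x = 0}" for y :: 'a
    by (intro closed_Collect_eq continuous_intros
        bounded_linear.continuous_on[OF bounded_linear_cinner_right])
  ultimately show ?thesis
    by (auto simp: closed_csubspace_def csubspace_def orth_in_def cinner_simps)
qed

text \<open>Subtracting from \<open>v\<close> its projection onto the line of \<open>m\<close> would
  strictly shorten \<open>v\<close> unless the two are orthogonal.\<close>

lemma min_norm_orthogonal:
  fixes v :: "'a::chilbert"
  assumes "csubspace M" "m \<in> M" and min: "\<And>u. u \<in> M \<Longrightarrow> norm v \<le> norm (v - u)"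
  shows "cinner m v = 0"
proof (rule ccontr)
  assume ne: "cinner m v \<noteq> 0"
  then have m: "norm m > 0" by auto
  define c where "c = cinner m v / (norm m)\<^sup>2"
  have "scaleC c m \<in> M" using assms csubspaceD by blast
  from min[OF this] have "(norm v)\<^sup>2 \<le> (norm (v - scaleC c m))\<^sup>2"
    by (simp add: power_mono)
  also have "\<dots> = (norm v)\<^sup>2 - 2 * Re (c * cinner v m) + (cmod c * norm m)\<^sup>2"
    unfolding norm_diff_sq by (simp add: cinner_simps)
  also have "c * cinner v m = complex_of_real ((cmod (cinner m v))\<^sup>2 / (norm m)\<^sup>2)"
    unfolding c_def using cinner_commute[of v m] complex_norm_square[of "cinner m v"] by simp
  also have "(cmod c * norm m)\<^sup>2 = (cmod (cinner m v))\<^sup>2 / (norm m)\<^sup>2"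
    unfolding c_def using m by (simp add: norm_divide power_divide power_mult_distrib field_simps norm_power)
  finally have "(cmod (cinner m v))\<^sup>2 / (norm m)\<^sup>2 \<le> 0" by simp
  moreover have "(cmod (cinner m v))\<^sup>2 / (norm m)\<^sup>2 > 0" using m ne by simp
  ultimately show False by simp
qed

text \<open>A minimizing sequence for the distance \<open>d\<close> from \<open>x\<close> to
  \<open>M\<close> is Cauchy by the parallelogram law, because midpoints of its members stay in
  \<open>M\<close> and are no closer to \<open>x\<close> than \<open>d\<close>. Its limit is a
  nearest point, and \<open>min_norm_orthogonal\<close> applies to the remainder.\<close>

lemma orthogonal_decomposition:
  fixes x :: "'a::chilbert"
  assumes M: "closed_csubspace M"
  shows "\<exists>u\<in>M. \<forall>m\<in>M. cinner m (x - u) = 0"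
proof -
  have sub: "csubspace M" and clo: "closed M" using M by (auto simp: closed_csubspace_def)
  define d where "d = Inf ((\<lambda>u. norm (x - u)) ` M)"
  have bdd: "bdd_below ((\<lambda>u. norm (x - u)) ` M)" by (rule bdd_belowI[of _ 0]) auto
  have ne: "(\<lambda>u. norm (x - u)) ` M \<noteq> {}" using csubspaceD(1)[OF sub] by auto
  have dle: "d \<le> norm (x - u)" if "u \<in> M" for u
    unfolding d_def using that bdd by (auto intro: cInf_lower)
  have d0: "0 \<le> d" unfolding d_def using ne by (auto intro!: cInf_greatest)
  have "\<exists>u\<in>M. norm (x - u) < d + 1 / real (Suc n)" for n
  proof -
    have "d < d + 1 / real (Suc n)" by simp
    from cInf_lessD[OF ne this[unfolded d_def]] show ?thesis unfolding d_def by auto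
  qed
  then obtain u where u: "\<And>n. u n \<in> M" "\<And>n. norm (x - u n) < d + 1 / real (Suc n)" by metis
  have est: "(norm (u m - u n))\<^sup>2 \<le> 2 * (norm (x - u m))\<^sup>2 + 2 * (norm (x - u n))\<^sup>2 - 4 * d\<^sup>2" for m n
  proof -
    have mid: "(1/2) *\<^sub>R (u m + u n) \<in> M"
      by (intro csubspaceD(5)[OF sub] csubspaceD(2)[OF sub] u(1))
    have "2 * d \<le> 2 * norm (x - (1/2) *\<^sub>R (u m + u n))" using dle[OF mid] by simp
    also have "\<dots> = norm ((x - u m) + (x - u n))"
      using norm_scaleR[of 2 "x - (1/2) *\<^sub>R (u m + u n)"] by (simp add: algebra_simps scaleR_2)
    finally have "(2 * d)\<^sup>2 \<le> (norm ((x - u m) + (x - u n)))\<^sup>2" using d0 by (intro power_mono) auto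
    moreover have "(norm ((x - u m) + (x - u n)))\<^sup>2 + (norm ((x - u n) - (x - u m)))\<^sup>2
       = 2 * (norm (x - u m))\<^sup>2 + 2 * (norm (x - u n))\<^sup>2"
    proof -
      have "Re (cinner (x - u n) (x - u m)) = Re (cinner (x - u m) (x - u n))"
        by (subst cinner_commute) simp
      then show ?thesis
        using norm_add_sq[of "x - u m" "x - u n"] norm_diff_sq[of "x - u n" "x - u m"] by simp
    qed
    ultimately show ?thesis by (simp add: power_mult_distrib)
  qed
  \<comment> \<open>With \<open>e = 1 / (k + 1)\<close> each squared distance is at most
    \<open>d^2 + (2 d + 1) e\<close>; inserted twice in \<open>est\<close>, this cancels
    \<open>4 d^2\<close> and leaves \<open>4 (2 d + 1) e\<close>.\<close>
  have bnd: "(norm (u m - u n))\<^sup>2 \<le> (8 * d + 4) * (1 / real (Suc k))" if "m \<ge> k" "n \<ge> k" for m n k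
  proof -
    have s: "(norm (x - u j))\<^sup>2 \<le> d\<^sup>2 + (2 * d + 1) * (1 / real (Suc k))" if "j \<ge> k" for j
    proof -
      define e where "e = 1 / real (Suc k)"
      have e: "0 < e" "e \<le> 1" unfolding e_def by auto
      have "norm (x - u j) \<le> d + 1 / real (Suc j)" using u(2)[of j] by simp
      also have "\<dots> \<le> d + e" unfolding e_def using that by (simp add: frac_le)
      finally have "(norm (x - u j))\<^sup>2 \<le> (d + e)\<^sup>2" by (intro power_mono) auto
      also have "\<dots> = d\<^sup>2 + (2 * d + e) * e" by (simp add: power2_eq_square algebra_simps)
      also have "\<dots> \<le> d\<^sup>2 + (2 * d + 1) * e" using e by (intro add_left_mono mult_right_mono) auto
      finally show ?thesis unfolding e_def .
    qed
    have "(8 * d + 4) * (1 / real (Suc k)) = 4 * ((2 * d + 1) * (1 / real (Suc k)))"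
      unfolding mult.assoc[symmetric] by simp
    then show ?thesis using est[of m n] s[OF that(1)] s[OF that(2)] by linarith
  qed
  have "Cauchy u"
  proof (rule metric_CauchyI)
    fix e :: real assume e: "0 < e"
    have "(\<lambda>k. (8 * d + 4) * (1 / real (Suc k))) \<longlonglongrightarrow> (8 * d + 4) * 0"
      by (intro tendsto_mult tendsto_const) (rule LIMSEQ_Suc[OF lim_1_over_n])
    then have "(\<lambda>k. (8 * d + 4) * (1 / real (Suc k))) \<longlonglongrightarrow> 0" by simp
    from order_tendstoD(2)[OF this, of "e\<^sup>2"] obtain k where k: "(8 * d + 4) * (1 / real (Suc k)) < e\<^sup>2"
      using e by (auto simp: eventually_sequentially)
    show "\<exists>k. \<forall>m\<ge>k. \<forall>n\<ge>k. dist (u m) (u n) < e"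
    proof (intro exI allI impI)
      fix m n assume "m \<ge> k" "n \<ge> k"
      then have "(norm (u m - u n))\<^sup>2 < e\<^sup>2" using bnd k by (meson le_less_trans)
      then show "dist (u m) (u n) < e" using e by (simp add: dist_norm power_less_imp_less_base)
    qed
  qed
  then obtain w where w: "u \<longlonglongrightarrow> w" using Cauchy_convergent convergent_def by blast
  have wM: "w \<in> M" using closed_sequentially[OF clo _ w] u by auto
  have "norm (x - w) \<le> d"
  proof (rule LIMSEQ_le)
    show "(\<lambda>n. norm (x - u n)) \<longlonglongrightarrow> norm (x - w)" using w by (intro tendsto_intros)
    have "(\<lambda>n. d + 1 / real (Suc n)) \<longlonglongrightarrow> d + 0"
      by (intro tendsto_add tendsto_const) (rule LIMSEQ_Suc[OF lim_1_over_n])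
    then show "(\<lambda>n. d + 1 / real (Suc n)) \<longlonglongrightarrow> d" by simp
    show "\<exists>N. \<forall>n\<ge>N. norm (x - u n) \<le> d + 1 / real (Suc n)" using u(2) less_imp_le by blast
  qed
  have "cinner m (x - w) = 0" if "m \<in> M" for m
  proof (rule min_norm_orthogonal[OF sub that])
    fix v assume "v \<in> M"
    then have "d \<le> norm (x - (w + v))" using dle wM sub csubspaceD by blast
    then show "norm (x - w) \<le> norm (x - w - v)"
      using \<open>norm (x - w) \<le> d\<close> by (simp add: algebra_simps)
  qed
  then show ?thesis using wM by blast
qed

definition proj :: "'a::chilbert set \<Rightarrow> 'a \<Rightarrow> 'a" where
  "proj M x = (SOME u. u \<in> M \<and> (\<forall>m\<in>M. cinner m (x - u) = 0))"

context
  fixes M :: "'a::chilbert set"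
  assumes M: "closed_csubspace M"
begin

lemma proj_in: "proj M x \<in> M" and proj_orth: "m \<in> M \<Longrightarrow> cinner m (x - proj M x) = 0"
proof -
  have "proj M x \<in> M \<and> (\<forall>m\<in>M. cinner m (x - proj M x) = 0)"
    unfolding proj_def by (rule someI_ex) (use orthogonal_decomposition[OF M, of x] in blast)
  then show "proj M x \<in> M" "m \<in> M \<Longrightarrow> cinner m (x - proj M x) = 0" by auto
qed

lemma diff_proj_in_orth: "x - proj M x \<in> orth_in UNIV M"
  by (simp add: orth_in_def proj_orth)

lemma proj_unique:
  assumes "u \<in> M" "v \<in> orth_in UNIV M"
  shows "proj M (u + v) = u"
proof -
  let ?w = "proj M (u + v) - u"
  have w: "?w \<in> M" using assms(1) M proj_in csubspaceD(4) closed_csubspace_def by blast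
  have "cinner ?w (u + v - proj M (u + v)) = 0" using proj_orth[OF w] .
  moreover have "cinner ?w v = 0" using assms(2) w by (simp add: orth_in_def)
  moreover have "?w = v - (u + v - proj M (u + v))" by simp
  ultimately have "cinner ?w ?w = 0" by (metis cinner_diff_right diff_zero)
  then show ?thesis by simp
qed

lemma proj_id: "u \<in> M \<Longrightarrow> proj M u = u"
  using proj_unique[of u 0] by (simp add: orth_in_def)

lemma orth_orth: "orth_in UNIV (orth_in UNIV M) = M"
proof
  show "M \<subseteq> orth_in UNIV (orth_in UNIV M)"
    by (auto simp: orth_in_def) (metis cinner_orth_commute)
  show "orth_in UNIV (orth_in UNIV M) \<subseteq> M"
  proof
    fix x assume x: "x \<in> orth_in UNIV (orth_in UNIV M)"
    have "cinner (x - proj M x) x = 0"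
      using x diff_proj_in_orth[of x] unfolding orth_in_def by blast
    moreover have "cinner (x - proj M x) (proj M x) = 0"
      using proj_orth[OF proj_in, of x x] by (metis cinner_orth_commute)
    ultimately have "cinner (x - proj M x) (x - proj M x) = 0" by (metis cinner_diff_right diff_zero)
    then have "x = proj M x" by simp
    then show "x \<in> M" using proj_in by metis
  qed
qed

end

section \<open>Bounded operators with adjoints\<close>

text \<open>The adjoint is carried along as a second map. Linearity of both maps and a bound for
  \<open>T'\<close> are consequences, derived below.\<close>

definition adjoint_pair :: "('a::chilbert \<Rightarrow> 'a) \<Rightarrow> ('a \<Rightarrow> 'a) \<Rightarrow> bool" where
  "adjoint_pair T T' \<longleftrightarrow> (\<forall>x y. cinner (T x) y = cinner x (T' y)) \<and> (\<exists>K. \<forall>x. norm (T x) \<le> K * norm x)"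

lemma adjoint_pairD: "adjoint_pair T T' \<Longrightarrow> cinner (T x) y = cinner x (T' y)"
  by (simp add: adjoint_pair_def)

text \<open>The bound of \<open>T\<close> passes to \<open>T'\<close> by cancelling one factor in
  \<open>|T' x|^2 = <T (T' x), x> <= K |T' x| |x|\<close>.\<close>

lemma adjoint_pair_bound:
  assumes "adjoint_pair T T'"
  obtains K where "K > 0" "\<And>x. norm (T x) \<le> K * norm x" "\<And>x. norm (T' x) \<le> K * norm x"
proof -
  from assms obtain K0 where K0: "\<And>x. norm (T x) \<le> K0 * norm x" unfolding adjoint_pair_def by blast
  define K where "K = max 1 K0"
  have K: "K > 0" "\<And>x. norm (T x) \<le> K * norm x"
  proof -
    fix x show "norm (T x) \<le> K * norm x"
      by (rule order_trans[OF K0]) (simp add: K_def mult_right_mono)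
  qed (simp add: K_def)
  have "norm (T' x) \<le> K * norm x" for x
  proof (cases "T' x = 0")
    case False
    have "complex_of_real ((norm (T' x))\<^sup>2) = cinner (T (T' x)) x"
      using assms by (simp add: adjoint_pairD cinner_self_norm)
    then have "(norm (T' x))\<^sup>2 = cmod (cinner (T (T' x)) x)"
      by (metis abs_power2 norm_of_real)
    also have "\<dots> \<le> norm (T (T' x)) * norm x" by (rule cinner_cauchy_schwarz)
    also have "\<dots> \<le> K * norm (T' x) * norm x" by (intro mult_right_mono K) auto
    finally have "norm (T' x) * norm (T' x) \<le> norm (T' x) * (K * norm x)"
      by (simp add: power2_eq_square mult_ac)
    then show ?thesis using False by (simp add: mult_le_cancel_left)
  qed (use K in simp)
  then show ?thesis using that K by blast
qed

lemma adjoint_pair_sym: "adjoint_pair T T' \<Longrightarrow> adjoint_pair T' T"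
proof -
  assume a: "adjoint_pair T T'"
  have "cinner (T' x) y = cinner x (T y)" for x y
    by (metis a adjoint_pairD cinner_commute)
  moreover obtain K where "\<And>x. norm (T' x) \<le> K * norm x" using a adjoint_pair_bound by metis
  ultimately show ?thesis unfolding adjoint_pair_def by blast
qed

lemma adjoint_pair_linear:
  assumes "adjoint_pair T T'"
  shows "T (x + y) = T x + T y" "T (scaleC c x) = scaleC c (T x)"
proof -
  have *: "cinner z (T u) = cinner (T' z) u" for z u
    using assms by (metis adjoint_pairD cinner_commute)
  show "T (x + y) = T x + T y" "T (scaleC c x) = scaleC c (T x)"
    by (rule cinner_eqI; simp add: * cinner_simps)+
qed

lemma adjoint_pair_linear':
  assumes "adjoint_pair T T'"
  shows "T (x - y) = T x - T y" "T (r *\<^sub>R x) = r *\<^sub>R T x" "T 0 = 0" "T (- x) = - T x"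
proof -
  show m: "T (- x) = - T x" for x using adjoint_pair_linear(2)[OF assms, of "-1"] by (simp add: scaleC_minus_one)
  show "T (x - y) = T x - T y" using adjoint_pair_linear(1)[OF assms, of x "- y"] m by simp
  show "T (r *\<^sub>R x) = r *\<^sub>R T x" using adjoint_pair_linear(2)[OF assms, of r] by (simp add: scaleC_of_real)
  show "T 0 = 0" using adjoint_pair_linear(2)[OF assms, of 0] by simp
qed

lemma adjoint_pair_bounded_linear: "adjoint_pair T T' \<Longrightarrow> bounded_linear T"
proof -
  assume a: "adjoint_pair T T'"
  obtain K where "\<And>x. norm (T x) \<le> K * norm x" using a adjoint_pair_bound by metis
  then show ?thesis
    using adjoint_pair_linear(1)[OF a] adjoint_pair_linear'(2)[OF a]
    by (intro bounded_linear_intro[where K = K]) (simp_all add: mult.commute)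
qed

lemma adjoint_pairI:
  assumes "\<And>x y. cinner (T x) y = cinner x (T' y)" "bounded_linear T"
  shows "adjoint_pair T T'"
  unfolding adjoint_pair_def using assms bounded_linear.bounded[OF assms(2)] by (metis mult.commute)

lemma adjoint_pair_add:
  assumes "adjoint_pair T T'" "adjoint_pair U U'"
  shows "adjoint_pair (\<lambda>x. T x + U x) (\<lambda>x. T' x + U' x)"
  by (rule adjoint_pairI)
    (use assms in \<open>simp_all add: adjoint_pairD cinner_simps bounded_linear_add adjoint_pair_bounded_linear\<close>)

lemma adjoint_pair_scaleC: "adjoint_pair (scaleC c) (scaleC (cnj c))"
  by (rule adjoint_pairI) (simp_all add: cinner_simps bounded_linear_scaleC)

lemma adjoint_pair_compose:
  assumes "adjoint_pair T T'" "adjoint_pair U U'"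
  shows "adjoint_pair (\<lambda>x. T (U x)) (\<lambda>x. U' (T' x))"
  by (rule adjoint_pairI)
    (use assms in \<open>simp_all add: adjoint_pairD bounded_linear_compose adjoint_pair_bounded_linear\<close>)

lemma adjoint_pair_diff_scaleC:
  assumes "adjoint_pair T T'"
  shows "adjoint_pair (\<lambda>x. T x - scaleC c x) (\<lambda>x. T' x - scaleC (cnj c) x)"
  using adjoint_pair_add[OF assms adjoint_pair_scaleC[of "- c"]] by (simp add: scaleC_minus_left)

lemma adjoint_pair_proj:
  assumes M: "closed_csubspace M"
  shows "adjoint_pair (proj M) (proj M)"
proof -
  have "cinner (proj M x) y = cinner x (proj M y)" for x y
  proof -
    have "cinner (proj M x) y = cinner (proj M x) (proj M y)"
      using proj_orth[OF M proj_in[OF M], of x y] by (simp add: cinner_diff_right)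
    moreover have "cinner x (proj M y) = cinner (proj M x) (proj M y)"
      using proj_orth[OF M proj_in[OF M], of y x] 
      by (metis cinner_diff_right cinner_commute eq_iff_diff_eq_0)
    ultimately show ?thesis by simp
  qed
  moreover have "norm (proj M x) \<le> 1 * norm x" for x
  proof -
    have "(norm (proj M x + (x - proj M x)))\<^sup>2 = (norm (proj M x))\<^sup>2 + (norm (x - proj M x))\<^sup>2"
      by (rule pythagoras) (rule proj_orth[OF M proj_in[OF M]])
    then have "(norm (proj M x))\<^sup>2 \<le> (norm x)\<^sup>2" by simp
    then show ?thesis by (simp add: power2_le_iff_abs_le)
  qed
  ultimately show ?thesis unfolding adjoint_pair_def by blast
qed

lemma adjoint_pair_diff:
  assumes "adjoint_pair T T'" "adjoint_pair U U'"
  shows "adjoint_pair (\<lambda>x. T x - U x) (\<lambda>x. T' x - U' x)"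
  by (rule adjoint_pairI)
    (use assms in \<open>simp_all add: adjoint_pairD cinner_simps bounded_linear_sub adjoint_pair_bounded_linear\<close>)

lemma adjoint_pair_ident: "adjoint_pair (\<lambda>x. x) (\<lambda>x. x)"
  by (rule adjoint_pairI) simp_all

lemma adjoint_invariant_orth:
  assumes T: "adjoint_pair T T'" and inv: "\<And>x. x \<in> M \<Longrightarrow> T' x \<in> M" and x: "x \<in> orth_in UNIV M"
  shows "T x \<in> orth_in UNIV M"
  using x inv adjoint_pairD[OF adjoint_pair_sym[OF T], symmetric] by (simp add: orth_in_def)

text \<open>Invariance of \<open>L\<close> under \<open>D'\<close> makes \<open>D\<close> preserve
  the complement of \<open>L\<close>, so \<open>D\<close> carries the orthogonal decomposition of
  \<open>z\<close> to that of \<open>D z\<close>.\<close>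

lemma proj_commute:
  assumes L: "closed_csubspace L" and D: "adjoint_pair D D'"
    and inv: "\<And>x. x \<in> L \<Longrightarrow> D x \<in> L" "\<And>x. x \<in> L \<Longrightarrow> D' x \<in> L"
  shows "proj L (D z) = D (proj L z)"
proof -
  have "D (z - proj L z) \<in> orth_in UNIV L"
    by (rule adjoint_invariant_orth[OF D inv(2) diff_proj_in_orth[OF L]])
  from proj_unique[OF L inv(1)[OF proj_in[OF L]] this, of z] show ?thesis
    by (simp flip: adjoint_pair_linear(1)[OF D])
qed

text \<open>The kernel of a nonzero \<open>f\<close> has codimension one, so a vector
  \<open>z\<close> orthogonal to it represents \<open>f\<close> up to a scalar, which the value
  \<open>f z\<close> determines.\<close>

lemma riesz_representation:
  fixes f :: "'a::chilbert \<Rightarrow> complex"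
  assumes add: "\<And>x y. f (x + y) = f x + f y" and scale: "\<And>c x. f (scaleC c x) = c * f x"
    and bound: "\<And>x. cmod (f x) \<le> K * norm x"
  shows "\<exists>v. \<forall>x. f x = cinner v x"
proof (cases "\<forall>x. f x = 0")
  case True
  then show ?thesis by (intro exI[of _ 0]) simp
next
  case False
  then obtain x0 where x0: "f x0 \<noteq> 0" by blast
  have bl: "bounded_linear f"
    by (rule bounded_linear_intro[where K = K])
      (use add scale bound in \<open>simp_all add: mult.commute scaleR_conv_of_real flip: scaleC_of_real\<close>)
  define M where "M = {x. f x = 0}"
  have "closed M" unfolding M_def
    by (intro closed_Collect_eq continuous_intros bounded_linear.continuous_on[OF bl])
  then have M: "closed_csubspace M"
    using bounded_linear.linear[OF bl, THEN linear_0]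
    by (auto simp: closed_csubspace_def csubspace_def add scale M_def)
  define z where "z = x0 - proj M x0"
  have zM: "cinner m z = 0" if "f m = 0" for m
    unfolding z_def by (rule proj_orth[OF M]) (use that M_def in simp)
  have fz: "f z \<noteq> 0"
  proof -
    have "f x0 = f z + f (proj M x0)" unfolding z_def by (simp flip: add)
    moreover have "f (proj M x0) = 0" using proj_in[OF M, of x0] by (simp add: M_def)
    ultimately show ?thesis using x0 by simp
  qed
  then have z0: "cinner z z \<noteq> 0"
    using bounded_linear.linear[OF bl, THEN linear_0] by auto
  have "f x = cinner (scaleC (cnj (f z / cinner z z)) z) x" for x
  proof -
    have "f (x + scaleC (- (f x / f z)) z) = 0" using fz by (simp add: add scale)
    from zM[OF this] have "cinner z (x + scaleC (- (f x / f z)) z) = 0"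
      by (metis cinner_orth_commute)
    then have "cinner z x = f x / f z * cinner z z" by (simp add: cinner_simps)
    then show ?thesis using fz z0 by (simp add: cinner_simps)
  qed
  then show ?thesis by blast
qed

lemma adjoint_exists:
  assumes "bounded_clinear_on UNIV T"
  shows "\<exists>T'. adjoint_pair T T'"
proof -
  from assms obtain K where K: "\<And>x. norm (T x) \<le> K * norm x"
    and lin: "\<And>x y. T (x + y) = T x + T y" "\<And>c x. T (scaleC c x) = scaleC c (T x)"
    unfolding bounded_clinear_on_def by auto
  have "\<exists>v. \<forall>x. cinner y (T x) = cinner v x" for y
  proof (rule riesz_representation[where K = "norm y * K"])
    fix x
    have "cmod (cinner y (T x)) \<le> norm y * norm (T x)" by (rule cinner_cauchy_schwarz)
    also have "\<dots> \<le> norm y * (K * norm x)" by (intro mult_left_mono K) auto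
    finally show "cmod (cinner y (T x)) \<le> norm y * K * norm x" by (simp add: mult_ac)
  qed (simp_all add: lin cinner_simps)
  then obtain T' where "\<And>x y. cinner y (T x) = cinner (T' y) x" by metis
  then have "\<And>x y. cinner (T x) y = cinner x (T' y)" by (metis cinner_commute)
  then show ?thesis unfolding adjoint_pair_def using K by blast
qed

section \<open>Splitting the space by the sign of a self-adjoint operator\<close>

text \<open>The recursion is chosen so that a fixed point \<open>Y\<close> satisfies
  \<open>(1 - Y)^2 = B^2\<close>. Every iterate is a polynomial in \<open>B^2\<close>, hence
  commutes with whatever commutes with \<open>B\<close>.\<close>

primrec sqrt_iter :: "('a::chilbert \<Rightarrow> 'a) \<Rightarrow> nat \<Rightarrow> 'a \<Rightarrow> 'a" where
  "sqrt_iter B 0 = (\<lambda>x. 0)"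
| "sqrt_iter B (Suc n) = (\<lambda>x. (1/2) *\<^sub>R (x - B (B x) + sqrt_iter B n (sqrt_iter B n x)))"

text \<open>The same recursion for scalars, with \<open>1 - B^2\<close> replaced by its norm bound
  1. It is a majorant: its values bound the norms of the iterates and its increments bound their
  differences. Being monotone and bounded, it converges.\<close>

primrec sqrt_iter_bound :: "nat \<Rightarrow> real" where
  "sqrt_iter_bound 0 = 0"
| "sqrt_iter_bound (Suc n) = (1 + (sqrt_iter_bound n)\<^sup>2) / 2"

lemma sqrt_iter_bound_range: "0 \<le> sqrt_iter_bound n" "sqrt_iter_bound n \<le> 1"
proof -
  have "0 \<le> sqrt_iter_bound n \<and> sqrt_iter_bound n \<le> 1"
    by (induction n) (auto simp: power_le_one)
  then show "0 \<le> sqrt_iter_bound n" "sqrt_iter_bound n \<le> 1" by auto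
qed

lemma sqrt_iter_bound_mono: "m \<le> n \<Longrightarrow> sqrt_iter_bound m \<le> sqrt_iter_bound n"
proof (rule lift_Suc_mono_le)
  fix n
  have "0 \<le> (1 - sqrt_iter_bound n)\<^sup>2" by simp
  then show "sqrt_iter_bound n \<le> sqrt_iter_bound (Suc n)" by (simp add: power2_eq_square algebra_simps)
qed

context
  fixes B :: "'a::chilbert \<Rightarrow> 'a"
  assumes B: "adjoint_pair B B" and B1: "\<And>x. norm (B x) \<le> norm x"
begin

lemma norm_one_minus_square: "norm (x - B (B x)) \<le> norm x"
proof -
  have "Re (cinner x (B (B x))) = (norm (B x))\<^sup>2"
    using B by (simp add: norm_sq_cinner adjoint_pairD)
  then have "(norm (x - B (B x)))\<^sup>2 = (norm x)\<^sup>2 - 2 * (norm (B x))\<^sup>2 + (norm (B (B x)))\<^sup>2"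
    unfolding norm_diff_sq by simp
  also have "\<dots> \<le> (norm x)\<^sup>2"
  proof -
    have "(norm (B (B x)))\<^sup>2 \<le> (norm (B x))\<^sup>2" by (rule power_mono[OF B1]) simp
    then show ?thesis using zero_le_power2[of "norm (B x)"] by linarith
  qed
  finally show ?thesis by (simp add: power2_le_iff_abs_le)
qed

lemma adjoint_pair_sqrt_iter: "adjoint_pair (sqrt_iter B n) (sqrt_iter B n)"
proof (induction n)
  case 0
  show ?case by (rule adjoint_pairI) simp_all
next
  case (Suc n)
  note lin = adjoint_pair_bounded_linear[OF B] adjoint_pair_bounded_linear[OF Suc]
  have "bounded_linear (sqrt_iter B (Suc n))"
    unfolding sqrt_iter.simps
    by (intro bounded_linear_const_scaleR bounded_linear_add bounded_linear_sub bounded_linear_ident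
        bounded_linear_compose[OF lin(1)] bounded_linear_compose[OF lin(2)] lin)
  moreover have "cinner (sqrt_iter B (Suc n) x) y = cinner x (sqrt_iter B (Suc n) y)" for x y
    by (simp add: cinner_simps adjoint_pairD[OF B] adjoint_pairD[OF Suc])
  ultimately show ?case by (intro adjoint_pairI)
qed

lemma sqrt_iter_commute:
  assumes X: "bounded_linear X" and XB: "\<And>x. X (B x) = B (X x)"
  shows "X (sqrt_iter B n x) = sqrt_iter B n (X x)"
proof (induction n arbitrary: x)
  case 0
  then show ?case using X by (simp add: linear_0 bounded_linear.linear)
next
  case (Suc n)
  then show ?case
    using X by (simp add: bounded_linear.linear linear_add linear_diff linear_scale XB)
qed

lemma norm_sqrt_iter: "norm (sqrt_iter B n x) \<le> sqrt_iter_bound n * norm x"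
proof (induction n arbitrary: x)
  case (Suc n)
  have "norm (sqrt_iter B n (sqrt_iter B n x)) \<le> sqrt_iter_bound n * (sqrt_iter_bound n * norm x)"
    using Suc[of "sqrt_iter B n x"] Suc[of x] sqrt_iter_bound_range(1)[of n]
    by (meson mult_left_mono order_trans)
  then have "norm (x - B (B x) + sqrt_iter B n (sqrt_iter B n x))
      \<le> norm x + sqrt_iter_bound n * (sqrt_iter_bound n * norm x)"
    using norm_one_minus_square[of x] norm_triangle_mono by blast
  then show ?case by (simp add: power2_eq_square distrib_right mult.assoc)
qed simp

text \<open>For consecutive iterates, \<open>U^2 - V^2 = U (U - V) + (U - V) V\<close>. This is the
  operator form of \<open>a^2 - b^2 = a (a - b) + (a - b) b\<close>, so each increment is dominated
  by that of the scalar majorant.\<close>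

lemma norm_sqrt_iter_step:
  "norm (sqrt_iter B (Suc n) x - sqrt_iter B n x) \<le> (sqrt_iter_bound (Suc n) - sqrt_iter_bound n) * norm x"
proof (induction n arbitrary: x)
  case 0
  then show ?case using norm_one_minus_square[of x] by simp
next
  case (Suc n)
  define U where "U = sqrt_iter B (Suc n)"
  define V where "V = sqrt_iter B n"
  define a where "a = sqrt_iter_bound (Suc n)"
  define b where "b = sqrt_iter_bound n"
  have IH: "norm (U z - V z) \<le> (a - b) * norm z" for z unfolding U_def V_def a_def b_def by (rule Suc)
  have ab: "0 \<le> b" "b \<le> a" unfolding a_def b_def
    by (simp_all only: sqrt_iter_bound_range sqrt_iter_bound_mono le_SucI order_refl)
  have lin: "U (z - w) = U z - U w" for z w
    unfolding U_def by (rule adjoint_pair_linear'[OF adjoint_pair_sqrt_iter])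
  have "sqrt_iter B (Suc (Suc n)) x - sqrt_iter B (Suc n) x
      = (1/2) *\<^sub>R (U (U x - V x) + (U (V x) - V (V x)))"
  proof -
    have U1: "sqrt_iter B (Suc n) x = (1/2) *\<^sub>R (x - B (B x) + V (V x))" unfolding V_def by simp
    have "sqrt_iter B (Suc (Suc n)) x = (1/2) *\<^sub>R (x - B (B x) + U (U x))"
      unfolding U_def by (rule sqrt_iter.simps(2)[THEN fun_cong])
    then show ?thesis unfolding U1 lin by (simp add: scaleR_diff_right scaleR_add_right)
  qed
  also have "norm \<dots> \<le> (1/2) * (norm (U (U x - V x)) + norm (U (V x) - V (V x)))"
    by (simp add: norm_triangle_ineq)
  also have "\<dots> \<le> (1/2) * (a * ((a - b) * norm x) + (a - b) * (b * norm x))"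
  proof (intro mult_left_mono add_mono)
    have "norm (U (U x - V x)) \<le> a * norm (U x - V x)"
      unfolding a_def U_def by (rule norm_sqrt_iter)
    also have "\<dots> \<le> a * ((a - b) * norm x)" using ab by (intro mult_left_mono IH) auto
    finally show "norm (U (U x - V x)) \<le> a * ((a - b) * norm x)" .
    have "norm (U (V x) - V (V x)) \<le> (a - b) * norm (V x)" by (rule IH)
    also have "\<dots> \<le> (a - b) * (b * norm x)"
      using ab by (intro mult_left_mono) (auto simp: V_def b_def norm_sqrt_iter)
    finally show "norm (U (V x) - V (V x)) \<le> (a - b) * (b * norm x)" .
  qed simp
  also have "\<dots> = ((1 + a\<^sup>2) / 2 - (1 + b\<^sup>2) / 2) * norm x"
    by (simp add: power2_eq_square algebra_simps)
  also have "\<dots> = (sqrt_iter_bound (Suc (Suc n)) - sqrt_iter_bound (Suc n)) * norm x"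
    by (simp add: a_def b_def)
  finally show ?case .
qed

lemma norm_sqrt_iter_diff:
  "n \<le> m \<Longrightarrow> norm (sqrt_iter B m x - sqrt_iter B n x) \<le> (sqrt_iter_bound m - sqrt_iter_bound n) * norm x"
proof (induction m rule: dec_induct)
  case (step m)
  have "norm (sqrt_iter B (Suc m) x - sqrt_iter B n x)
     \<le> norm (sqrt_iter B (Suc m) x - sqrt_iter B m x) + norm (sqrt_iter B m x - sqrt_iter B n x)"
    by (rule norm_diff_triangle_le[OF order_refl order_refl])
  also have "\<dots> \<le> (sqrt_iter_bound (Suc m) - sqrt_iter_bound m) * norm x
      + (sqrt_iter_bound m - sqrt_iter_bound n) * norm x"
    by (rule add_mono[OF norm_sqrt_iter_step step.IH])
  finally show ?case by (simp only: algebra_simps)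
qed simp

lemma sqrt_iter_convergent: "convergent (\<lambda>n. sqrt_iter B n x)"
proof -
  have "convergent sqrt_iter_bound"
    by (rule Bseq_monoseq_convergent)
      (auto intro!: BseqI'[where K = 1] monoI1 sqrt_iter_bound_mono simp: sqrt_iter_bound_range)
  then have "Cauchy (\<lambda>n. sqrt_iter_bound n * norm x)"
    by (intro convergent_Cauchy convergent_mult convergent_const)
  have "Cauchy (\<lambda>n. sqrt_iter B n x)"
  proof (rule metric_CauchyI)
    fix e :: real assume "0 < e"
    with \<open>Cauchy (\<lambda>n. sqrt_iter_bound n * norm x)\<close> obtain N where
      N: "\<And>m n. m \<ge> N \<Longrightarrow> n \<ge> N \<Longrightarrow> dist (sqrt_iter_bound m * norm x) (sqrt_iter_bound n * norm x) < e"
      using metric_CauchyD by blast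
    have *: "dist (sqrt_iter B m x) (sqrt_iter B n x) < e" if "m \<ge> N" "n \<ge> N" "n \<le> m" for m n
    proof -
      have "dist (sqrt_iter B m x) (sqrt_iter B n x) \<le> (sqrt_iter_bound m - sqrt_iter_bound n) * norm x"
        using norm_sqrt_iter_diff[OF that(3)] by (simp add: dist_norm)
      also have "\<dots> \<le> dist (sqrt_iter_bound m * norm x) (sqrt_iter_bound n * norm x)"
        by (simp add: dist_real_def left_diff_distrib)
      finally show ?thesis using N[OF that(1,2)] by simp
    qed
    show "\<exists>N. \<forall>m\<ge>N. \<forall>n\<ge>N. dist (sqrt_iter B m x) (sqrt_iter B n x) < e"
    proof (intro exI allI impI)
      fix m n assume "m \<ge> N" "n \<ge> N"
      then show "dist (sqrt_iter B m x) (sqrt_iter B n x) < e"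
        using *[of m n] *[of n m] by (cases "n \<le> m") (auto simp: dist_commute)
    qed
  qed
  then show ?thesis by (rule Cauchy_convergent)
qed

text \<open>The operator $|B|$ is $1 - Y$, where $Y$ is the fixed point of the map
  $Y \mapsto ((1 - B^2) + Y^2) / 2$ reached from $0$.\<close>

lemma absolute_value_exists:
  "\<exists>R. adjoint_pair R R \<and> (\<forall>x. R (R x) = B (B x)) \<and> (\<forall>x. 0 \<le> Re (cinner (R x) x))
    \<and> (\<forall>x. Re (cinner (R x) x) = 0 \<longrightarrow> R x = 0)
    \<and> (\<forall>X. bounded_linear X \<and> (\<forall>x. X (B x) = B (X x)) \<longrightarrow> (\<forall>x. X (R x) = R (X x)))"
proof -
  define Y where "Y x = lim (\<lambda>n. sqrt_iter B n x)" for x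
  have lim: "(\<lambda>n. sqrt_iter B n x) \<longlonglongrightarrow> Y x" for x
    unfolding Y_def by (rule convergent_LIMSEQ_iff[THEN iffD1, OF sqrt_iter_convergent])
  have norm1: "norm (sqrt_iter B n x) \<le> norm x" for n x
  proof -
    have "sqrt_iter_bound n * norm x \<le> 1 * norm x"
      by (intro mult_right_mono sqrt_iter_bound_range) auto
    then show ?thesis using norm_sqrt_iter[of n x] by simp
  qed
  have Ynorm: "norm (Y x) \<le> norm x" for x
    by (rule tendsto_upperbound[OF tendsto_norm[OF lim]]) (use norm1 in auto)
  have Yadj: "cinner (Y x) y = cinner x (Y y)" for x y
  proof (rule LIMSEQ_unique)
    show "(\<lambda>n. cinner (sqrt_iter B n x) y) \<longlonglongrightarrow> cinner (Y x) y"
      by (rule bounded_linear.tendsto[OF bounded_linear_cinner_left lim])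
    show "(\<lambda>n. cinner (sqrt_iter B n x) y) \<longlonglongrightarrow> cinner x (Y y)"
      unfolding adjoint_pairD[OF adjoint_pair_sqrt_iter]
      by (rule bounded_linear.tendsto[OF bounded_linear_cinner_right lim])
  qed
  have Y: "adjoint_pair Y Y"
    unfolding adjoint_pair_def using Yadj Ynorm by (metis mult_1)
  have Ycomm: "X (Y x) = Y (X x)" if "bounded_linear X" "\<And>x. X (B x) = B (X x)" for X x
  proof (rule LIMSEQ_unique)
    show "(\<lambda>n. X (sqrt_iter B n x)) \<longlonglongrightarrow> X (Y x)"
      by (rule bounded_linear.tendsto[OF that(1) lim])
    show "(\<lambda>n. X (sqrt_iter B n x)) \<longlonglongrightarrow> Y (X x)"
      unfolding sqrt_iter_commute[OF that] by (rule lim)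
  qed
  have Yfix: "Y x = (1/2) *\<^sub>R (x - B (B x) + Y (Y x))" for x
  proof (rule LIMSEQ_unique)
    show "(\<lambda>n. sqrt_iter B (Suc n) x) \<longlonglongrightarrow> Y x" by (rule LIMSEQ_Suc[OF lim])
    \<comment> \<open>The iterates are contractions uniformly in \<open>n\<close>, which allows the
      inner and the outer iterate to go to the limit with the same index.\<close>
    have "(\<lambda>n. norm (sqrt_iter B n x - Y x)) \<longlonglongrightarrow> 0"
      using lim[of x] by (simp add: LIM_zero tendsto_norm_zero)
    then have "(\<lambda>n. sqrt_iter B n (sqrt_iter B n x - Y x)) \<longlonglongrightarrow> 0"
      by (rule Lim_null_comparison[rotated]) (use norm1 in auto)
    then have "(\<lambda>n. sqrt_iter B n (sqrt_iter B n x - Y x) + sqrt_iter B n (Y x)) \<longlonglongrightarrow> 0 + Y (Y x)"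
      by (rule tendsto_add[OF _ lim])
    then have "(\<lambda>n. sqrt_iter B n (sqrt_iter B n x)) \<longlonglongrightarrow> Y (Y x)"
      by (simp add: adjoint_pair_linear'[OF adjoint_pair_sqrt_iter])
    then show "(\<lambda>n. sqrt_iter B (Suc n) x) \<longlonglongrightarrow> (1/2) *\<^sub>R (x - B (B x) + Y (Y x))"
      unfolding sqrt_iter.simps by (intro tendsto_intros)
  qed
  define R where "R x = x - Y x" for x
  have R: "adjoint_pair R R"
    unfolding R_def
    by (rule adjoint_pairI) (simp_all add: cinner_simps Yadj bounded_linear_sub bounded_linear_ident
        adjoint_pair_bounded_linear[OF Y])
  have RR: "R (R x) = B (B x)" for x
  proof -
    have "2 *\<^sub>R Y x = x - B (B x) + Y (Y x)" by (subst Yfix) simp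
    then show ?thesis
      by (simp add: R_def adjoint_pair_linear'[OF Y] scaleR_2 algebra_simps)
  qed
  have pos: "Re (cinner (R x) x) = (norm x)\<^sup>2 - Re (cinner (Y x) x)" for x
    by (simp add: R_def cinner_simps norm_sq_cinner)
  have "Re (cinner (Y x) x) \<le> (norm x)\<^sup>2" for x
  proof -
    have "Re (cinner (Y x) x) \<le> norm (Y x) * norm x" by (rule Re_cinner_le)
    also have "\<dots> \<le> norm x * norm x" by (intro mult_right_mono Ynorm) auto
    finally show ?thesis by (simp add: power2_eq_square)
  qed
  then have R0: "0 \<le> Re (cinner (R x) x)" for x by (simp add: pos)
  \<comment> \<open>Equality case of Cauchy-Schwarz: \<open>Re <Y x, x> = |x|^2\<close> together
    with \<open>|Y x| <= |x|\<close> forces \<open>Y x = x\<close>.\<close>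
  have Rdef: "R x = 0" if "Re (cinner (R x) x) = 0" for x
  proof -
    have "(norm (Y x - x))\<^sup>2 = (norm (Y x))\<^sup>2 - 2 * Re (cinner (Y x) x) + (norm x)\<^sup>2" by (rule norm_diff_sq)
    also have "\<dots> = (norm (Y x))\<^sup>2 - (norm x)\<^sup>2" using that pos[of x] by simp
    also have "\<dots> \<le> 0" using power_mono[OF Ynorm[of x], of 2] by simp
    finally show ?thesis by (simp add: R_def)
  qed
  have "X (R x) = R (X x)" if "bounded_linear X" "\<And>x. X (B x) = B (X x)" for X x
    using Ycomm[OF that] that(1) by (simp add: R_def linear_diff bounded_linear.linear)
  then show ?thesis using R RR R0 Rdef by blast
qed

end

text \<open>\<open>M\<close> is the kernel of \<open>R + C\<close>, where \<open>C\<close> is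
  \<open>B\<close> scaled to a contraction and \<open>R\<close> is its absolute value. On
  \<open>M\<close> one has \<open>C = - R\<close>, on the complement \<open>C = R\<close>. A vector
  of the complement on which the form vanishes is killed by both \<open>R\<close> and
  \<open>C\<close>, so it also lies in \<open>M\<close> and is zero. Whatever commutes with
  \<open>B\<close> commutes with \<open>R\<close> and \<open>C\<close> and preserves the
  kernel.\<close>

lemma sign_splitting:
  fixes B :: "'a::chilbert \<Rightarrow> 'a"
  assumes B: "adjoint_pair B B"
  obtains M where "closed_csubspace M"
    "\<And>x. x \<in> M \<Longrightarrow> Re (cinner (B x) x) \<le> 0"
    "\<And>x. x \<in> orth_in UNIV M \<Longrightarrow> 0 \<le> Re (cinner (B x) x)"
    "\<And>x. x \<in> orth_in UNIV M \<Longrightarrow> Re (cinner (B x) x) = 0 \<Longrightarrow> x = 0"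
    "\<And>X X' x. adjoint_pair X X' \<Longrightarrow> (\<And>x. X (B x) = B (X x)) \<Longrightarrow> x \<in> M \<Longrightarrow> X x \<in> M"
proof -
  obtain K where K: "K > 0" "\<And>x. norm (B x) \<le> K * norm x"
    using adjoint_pair_bound[OF B] by metis
  define C where "C x = (1/K) *\<^sub>R B x" for x
  have BC: "B x = K *\<^sub>R C x" for x using K by (simp add: C_def)
  have C: "adjoint_pair C C" unfolding C_def
    by (rule adjoint_pairI)
      (simp_all add: cinner_simps adjoint_pairD[OF B] bounded_linear_const_scaleR adjoint_pair_bounded_linear[OF B])
  have C1: "norm (C x) \<le> norm x" for x using K by (simp add: C_def divide_le_eq mult.commute)
  obtain R where R: "adjoint_pair R R" and RR: "\<And>x. R (R x) = C (C x)"
    and pos: "\<And>x. 0 \<le> Re (cinner (R x) x)" and def: "\<And>x. Re (cinner (R x) x) = 0 \<Longrightarrow> R x = 0"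
    and comm: "\<And>X x. bounded_linear X \<Longrightarrow> (\<And>x. X (C x) = C (X x)) \<Longrightarrow> X (R x) = R (X x)"
  proof -
    from absolute_value_exists[OF C C1] obtain R where
      R: "adjoint_pair R R" "\<forall>x. R (R x) = C (C x)" "\<forall>x. 0 \<le> Re (cinner (R x) x)"
        "\<forall>x. Re (cinner (R x) x) = 0 \<longrightarrow> R x = 0"
        "\<forall>X. bounded_linear X \<and> (\<forall>x. X (C x) = C (X x)) \<longrightarrow> (\<forall>x. X (R x) = R (X x))"
      by (elim exE conjE)
    show ?thesis by (rule that[OF R(1)]) (use R(2-) in blast)+
  qed
  have CR: "C (R x) = R (C x)" for x by (rule comm[OF adjoint_pair_bounded_linear[OF C] refl])
  define M where "M = {x. R x + C x = 0}"
  have lin: "bounded_linear (\<lambda>x. R x + C x)"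
    by (intro bounded_linear_add adjoint_pair_bounded_linear[OF R] adjoint_pair_bounded_linear[OF C])
  have M: "closed_csubspace M"
    unfolding closed_csubspace_def csubspace_def
  proof (intro conjI ballI allI)
    show "closed M" unfolding M_def
      by (intro closed_Collect_eq continuous_intros bounded_linear.continuous_on[OF lin])
    show "x + y \<in> M" if "x \<in> M" "y \<in> M" for x y
      using that linear_add[OF bounded_linear.linear[OF lin], of x y] by (simp add: M_def)
  qed (simp_all add: M_def adjoint_pair_linear(2)[OF R] adjoint_pair_linear(2)[OF C]
      adjoint_pair_linear'(3)[OF R] adjoint_pair_linear'(3)[OF C] flip: scaleC_add_right)
  have perp: "R x = C x" if "x \<in> orth_in UNIV M" for x
  proof -
    have "cinner y (R x - C x) = 0" for y
    proof -
      \<comment> \<open>\<open>(R + C) (R - C) = R^2 - C^2 = 0\<close>, because \<open>R\<close> and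
        \<open>C\<close> commute.\<close>
      have "R y - C y \<in> M"
        by (simp add: M_def adjoint_pair_linear'[OF R] adjoint_pair_linear'[OF C] RR CR)
      then have "cinner (R y - C y) x = 0" using that by (simp add: orth_in_def)
      then show ?thesis by (simp add: cinner_simps adjoint_pairD[OF R] adjoint_pairD[OF C])
    qed
    then show ?thesis by (metis cinner_self_eq_zero eq_iff_diff_eq_0)
  qed
  show ?thesis
  proof (rule that[OF M])
    fix x assume "x \<in> M"
    then have "C x = - R x" by (simp add: M_def add_eq_0_iff)
    then show "Re (cinner (B x) x) \<le> 0" using pos[of x] K by (simp add: BC cinner_simps)
  next
    fix x assume "x \<in> orth_in UNIV M"
    then show "0 \<le> Re (cinner (B x) x)" using pos[of x] K perp[of x] by (simp add: BC cinner_simps)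
  next
    fix x assume x: "x \<in> orth_in UNIV M" and "Re (cinner (B x) x) = 0"
    then have "R x = 0" using K perp[of x] by (intro def) (simp add: BC cinner_simps)
    then have "x \<in> M" using perp[OF x] by (simp add: M_def)
    then have "cinner x x = 0" using x unfolding orth_in_def by blast
    then show "x = 0" by simp
  next
    fix X X' x assume X: "adjoint_pair X X'" and XB: "\<And>x. X (B x) = B (X x)" and x: "x \<in> M"
    have XC: "X (C z) = C (X z)" for z by (simp add: C_def adjoint_pair_linear'[OF X] XB)
    have "X (R x) = R (X x)" by (rule comm[OF adjoint_pair_bounded_linear[OF X] XC])
    then have "R (X x) + C (X x) = X (R x + C x)" by (simp add: XC adjoint_pair_linear[OF X])
    then show "X x \<in> M" using x by (simp add: M_def adjoint_pair_linear'[OF X])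
  qed
qed

section \<open>Spectral subspaces of normal operators\<close>

text \<open>Log-convexity makes successive ratios nondecreasing, so a first ratio above
  \<open>r\<close> would persist and force growth faster than \<open>C * r ^ n\<close>.\<close>

lemma log_convex_first_ratio:
  fixes a :: "nat \<Rightarrow> real"
  assumes nonneg: "\<And>n. 0 \<le> a n" and conv: "\<And>n. (a (Suc n))\<^sup>2 \<le> a n * a (Suc (Suc n))"
    and bound: "\<And>n. a n \<le> C * r ^ n" and r: "0 \<le> r"
  shows "a 1 \<le> r * a 0"
proof (rule ccontr)
  assume "\<not> ?thesis"
  then have gt: "r * a 0 < a 1" by simp
  have a1: "0 < a 1" using gt mult_nonneg_nonneg[OF r nonneg[of 0]] by linarith
  have a0: "0 < a 0"
  proof (rule ccontr)
    assume "\<not> 0 < a 0"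
    then have "a 0 = 0" using nonneg[of 0] by simp
    then show False using conv[of 0] a1 by simp
  qed
  define q where "q = a 1 / a 0"
  have q: "r < q" "0 < q" using gt a0 a1 by (auto simp: q_def field_simps)
  have step: "q * a n \<le> a (Suc n) \<and> 0 < a n" for n
  proof (induction n)
    case 0
    then show ?case using a0 by (simp add: q_def)
  next
    case (Suc n)
    then have pos: "0 < a (Suc n)" using q by (metis mult_pos_pos less_le_trans)
    have "a n * (q * a (Suc n)) = (q * a n) * a (Suc n)" by simp
    also have "\<dots> \<le> a (Suc n) * a (Suc n)" using Suc pos by (intro mult_right_mono) auto
    also have "\<dots> \<le> a n * a (Suc (Suc n))" using conv[of n] by (simp add: power2_eq_square)
    finally have "q * a (Suc n) \<le> a (Suc (Suc n))" using Suc by simp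
    then show ?case using pos by simp
  qed
  have geo: "a 0 * q ^ n \<le> a n" for n
  proof (induction n)
    case (Suc n)
    have "a 0 * q ^ Suc n = q * (a 0 * q ^ n)" by simp
    also have "\<dots> \<le> q * a n" using Suc q by simp
    also have "\<dots> \<le> a (Suc n)" using step by simp
    finally show ?case .
  qed simp
  show False
  proof (cases "r = 0")
    case True
    then show False using bound[of 1] a1 by simp
  next
    case False
    then have r0: "0 < r" using r by simp
    have "1 < q / r" using q r0 by simp
    then obtain n where n: "C / a 0 < (q / r) ^ n" using real_arch_pow by blast
    have "a 0 * q ^ n \<le> C * r ^ n" using geo bound order_trans by blast
    then have "(q / r) ^ n \<le> C / a 0" using a0 r0 by (simp add: field_simps power_divide)
    then show False using n by simp
  qed
qed

lemma normal_norm_eq: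
  assumes "adjoint_pair D D'" "D (D' x) = D' (D x)"
  shows "norm (D' x) = norm (D x)"
proof -
  have "cinner (D' x) (D' x) = cinner (D x) (D x)"
    by (metis assms adjoint_pairD adjoint_pair_sym)
  then have "(norm (D' x))\<^sup>2 = (norm (D x))\<^sup>2" by (simp add: norm_sq_cinner)
  then show ?thesis by simp
qed

lemma funpow_commute_apply: "(\<And>x. X (D x) = D (X x)) \<Longrightarrow> X ((D ^^ n) x) = (D ^^ n) (X x)"
  by (induction n arbitrary: x) auto

lemma normal_norm_funpow_eq:
  assumes "adjoint_pair D D'" "\<And>x. D (D' x) = D' (D x)"
  shows "norm ((D' ^^ n) x) = norm ((D ^^ n) x)"
proof (induction n arbitrary: x)
  case (Suc n)
  have "norm ((D ^^ Suc n) x) = norm (D' ((D ^^ n) x))" using normal_norm_eq[OF assms] by simp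
  also have "D' ((D ^^ n) x) = (D ^^ n) (D' x)"
    by (rule funpow_commute_apply) (simp add: assms(2))
  also have "norm \<dots> = norm ((D' ^^ n) (D' x))" by (rule Suc[symmetric])
  finally show ?case by (simp add: funpow_swap1)
qed simp

text \<open>The spectral subspace of a normal $D$ for the disc of radius $r$ consists of the vectors with
  $|D^n x| = O(r^n)$. Since $|D^n x| = |D^{*n} x|$, it is invariant under $X$ and $X^*$ as soon as
  $X$ commutes with $D$, which replaces Fuglede's theorem.\<close>

lemma disc_splitting:
  fixes D :: "'a::chilbert \<Rightarrow> 'a"
  assumes D: "adjoint_pair D D'" and normal: "\<And>x. D (D' x) = D' (D x)" and s: "0 \<le> s"
  obtains M where "closed_csubspace M"
    "\<And>x. x \<in> M \<Longrightarrow> (norm (D x))\<^sup>2 \<le> s * (norm x)\<^sup>2"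
    "\<And>x. x \<in> orth_in UNIV M \<Longrightarrow> s * (norm x)\<^sup>2 \<le> (norm (D x))\<^sup>2"
    "\<forall>X X'. adjoint_pair X X' \<and> (\<forall>x. X (D x) = D (X x)) \<longrightarrow> (\<forall>x\<in>M. X x \<in> M \<and> X' x \<in> M)"
proof -
  define r where "r = sqrt s"
  have r: "0 \<le> r" "r\<^sup>2 = s" using s by (auto simp: r_def)
  define B where "B x = D' (D x) - scaleC (complex_of_real s) x" for x
  note D' = adjoint_pair_sym[OF D]
  have B: "adjoint_pair B B"
    unfolding B_def using adjoint_pair_diff_scaleC[OF adjoint_pair_compose[OF D' D], of "complex_of_real s"]
    by simp
  have Bform: "Re (cinner (B x) x) = (norm (D x))\<^sup>2 - s * (norm x)\<^sup>2" for x
    by (simp add: B_def cinner_simps adjoint_pairD[OF D'] norm_sq_cinner)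
  obtain M where M: "closed_csubspace M"
    and neg: "\<And>x. x \<in> M \<Longrightarrow> Re (cinner (B x) x) \<le> 0"
    and pos: "\<And>x. x \<in> orth_in UNIV M \<Longrightarrow> 0 \<le> Re (cinner (B x) x)"
    and def: "\<And>x. x \<in> orth_in UNIV M \<Longrightarrow> Re (cinner (B x) x) = 0 \<Longrightarrow> x = 0"
    and inv: "\<And>X X' x. adjoint_pair X X' \<Longrightarrow> (\<And>x. X (B x) = B (X x)) \<Longrightarrow> x \<in> M \<Longrightarrow> X x \<in> M"
    using sign_splitting[OF B] by metis
  have DB: "D (B x) = B (D x)" for x
    by (simp add: B_def adjoint_pair_linear'[OF D] adjoint_pair_linear[OF D] normal)
  have Dn: "(D ^^ n) x \<in> M" if "x \<in> M" for n x
    using that by (induction n) (auto intro: inv[OF D DB])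
  have disc: "norm (D x) \<le> r * norm x" if "x \<in> M" for x
  proof -
    have "(norm (D x))\<^sup>2 \<le> (r * norm x)\<^sup>2"
      using neg[OF that] by (simp add: Bform r power_mult_distrib)
    then show ?thesis using r by (simp add: power2_le_iff_abs_le)
  qed
  define E where "E = {x. \<exists>C. \<forall>n. norm ((D ^^ n) x) \<le> C * r ^ n}"
  have ME: "norm ((D ^^ n) x) \<le> norm x * r ^ n" if "x \<in> M" for x n
  proof (induction n)
    case (Suc n)
    have "norm ((D ^^ Suc n) x) \<le> r * norm ((D ^^ n) x)" using disc[OF Dn[OF that]] by simp
    also have "\<dots> \<le> r * (norm x * r ^ n)" by (intro mult_left_mono Suc r)
    finally show ?case by (simp add: mult_ac)
  qed simp
  have Dlin: "(D ^^ n) (x - y) = (D ^^ n) x - (D ^^ n) y" for n x y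
    by (induction n arbitrary: x y) (auto simp: adjoint_pair_linear'[OF D])
  have "E = M"
  proof
    show "M \<subseteq> E" unfolding E_def using ME by blast
    show "E \<subseteq> M"
    proof
      fix x assume "x \<in> E"
      then obtain C where C: "\<And>n. norm ((D ^^ n) x) \<le> C * r ^ n" unfolding E_def by blast
      \<comment> \<open>The component of \<open>x\<close> off \<open>M\<close> still grows at most
        like \<open>r ^ n\<close>, since the component in \<open>M\<close> does by
        \<open>ME\<close>. Log-convexity of \<open>|D^n y|\<close> turns this into
        \<open>|D y| <= r |y|\<close>, whereas the form of \<open>B\<close> is strictly positive off
        \<open>M\<close>; hence \<open>y = 0\<close>.\<close>
      define y where "y = x - proj M x"
      have yo: "y \<in> orth_in UNIV M" unfolding y_def by (rule diff_proj_in_orth[OF M])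
      have yE: "norm ((D ^^ n) y) \<le> (C + norm (proj M x)) * r ^ n" for n
        using C[of n] ME[OF proj_in[OF M, of x], of n] norm_triangle_ineq4[of "(D ^^ n) x" "(D ^^ n) (proj M x)"]
        unfolding y_def Dlin by (simp add: distrib_right)
      have "norm ((D ^^ 1) y) \<le> r * norm ((D ^^ 0) y)"
      proof (rule log_convex_first_ratio[OF _ _ yE r(1)])
        fix n
        define z where "z = (D ^^ n) y"
        have "(norm (D z))\<^sup>2 = Re (cinner (D' (D z)) z)"
          by (simp add: norm_sq_cinner adjoint_pairD[OF D'])
        also have "\<dots> \<le> norm (D' (D z)) * norm z" by (rule Re_cinner_le)
        also have "norm (D' (D z)) = norm (D (D z))" by (rule normal_norm_eq[OF D normal])
        finally show "(norm ((D ^^ Suc n) y))\<^sup>2 \<le> norm ((D ^^ n) y) * norm ((D ^^ Suc (Suc n)) y)"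
          by (simp add: z_def mult.commute)
      qed simp
      then have "(norm (D y))\<^sup>2 \<le> (r * norm y)\<^sup>2" by (intro power_mono) auto
      then have "Re (cinner (B y) y) \<le> 0" by (simp add: Bform r power_mult_distrib)
      then have "y = 0" using def[OF yo] pos[OF yo] by simp
      then have "x = proj M x" by (simp add: y_def)
      then show "x \<in> M" using proj_in[OF M] by metis
    qed
  qed
  show ?thesis
  proof (rule that[OF M]; (intro allI impI ballI; elim conjE)?)
    fix x assume "x \<in> M"
    then show "(norm (D x))\<^sup>2 \<le> s * (norm x)\<^sup>2" using neg Bform by simp
  next
    fix x assume "x \<in> orth_in UNIV M"
    then show "s * (norm x)\<^sup>2 \<le> (norm (D x))\<^sup>2" using pos Bform by simp
  next
    fix X X' x assume X: "adjoint_pair X X'" and XDa: "\<forall>x. X (D x) = D (X x)" and "x \<in> M"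
    note XD = XDa[rule_format]
    obtain C where C: "\<And>n. norm ((D ^^ n) x) \<le> C * r ^ n" using \<open>x \<in> M\<close> unfolding \<open>E = M\<close>[symmetric] E_def by blast
    obtain K where K: "K > 0" "\<And>x. norm (X x) \<le> K * norm x" "\<And>x. norm (X' x) \<le> K * norm x"
      using adjoint_pair_bound[OF X] by metis
    \<comment> \<open>Taking adjoints of \<open>X D = D X\<close> gives commutation of
      \<open>X'\<close> with \<open>D'\<close>, not with \<open>D\<close>. Since powers of
      \<open>D\<close> and of \<open>D'\<close> have equal norms on every vector, the growth test
      for \<open>X' x\<close> can be carried out with \<open>D'\<close>.\<close>
    have XD': "X' (D' z) = D' (X' z)" for z
      by (rule cinner_eqI) (metis adjoint_pairD[OF X] adjoint_pairD[OF D] XD)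
    have KC: "K * norm ((D ^^ n) x) \<le> (K * C) * r ^ n" for n
      using mult_left_mono[OF C[of n], of K] K(1) by (simp add: mult.assoc)
    have "norm ((D ^^ n) (X x)) \<le> (K * C) * r ^ n" for n
      using K(2)[of "(D ^^ n) x"] KC[of n] funpow_commute_apply[of X D n x, OF XD] by simp
    moreover have "norm ((D ^^ n) (X' x)) \<le> (K * C) * r ^ n" for n
    proof -
      have "norm ((D ^^ n) (X' x)) = norm (X' ((D' ^^ n) x))"
        unfolding normal_norm_funpow_eq[OF D normal, symmetric]
        using funpow_commute_apply[of X' D' n x, OF XD'] by simp
      also have "\<dots> \<le> K * norm ((D ^^ n) x)"
        using K(3)[of "(D' ^^ n) x"] by (simp add: normal_norm_funpow_eq[OF D normal])
      finally show ?thesis using KC[of n] by simp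
    qed
    ultimately show "X x \<in> M \<and> X' x \<in> M" unfolding \<open>E = M\<close>[symmetric] E_def by blast
  qed
qed

text \<open>Polarization: the forms at \<open>x + y\<close> and \<open>x - y\<close> bound
  \<open><U x, y> + <U y, x>\<close>, and \<open>i y\<close> in place of \<open>y\<close> bounds the
  difference of the two terms. The 2 is the usual factor between numerical radius and norm.\<close>

lemma numerical_radius_bound:
  assumes U: "adjoint_pair U U'" and M: "csubspace M" and inv: "\<And>x. x \<in> M \<Longrightarrow> U x \<in> M"
    and form: "\<And>x. x \<in> M \<Longrightarrow> cmod (cinner (U x) x) \<le> e * (norm x)\<^sup>2" and x: "x \<in> M"
  shows "norm (U x) \<le> 2 * e * norm x"
proof (cases "U x = 0")
  case True
  have "0 \<le> e * (norm x)\<^sup>2" using form[OF x] norm_ge_zero order_trans by blast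
  then have "x = 0 \<or> 0 \<le> e" by (auto simp: zero_le_mult_iff)
  then show ?thesis using True by auto
next
  case False
  have sum: "cmod (cinner (U x) y + cinner (U y) x) \<le> e * ((norm x)\<^sup>2 + (norm y)\<^sup>2)" if y: "y \<in> M" for y
  proof -
    have "2 * (cinner (U x) y + cinner (U y) x) = cinner (U (x + y)) (x + y) - cinner (U (x - y)) (x - y)"
      by (simp add: adjoint_pair_linear[OF U] adjoint_pair_linear'[OF U] cinner_simps)
    then have "2 * cmod (cinner (U x) y + cinner (U y) x)
        = cmod (cinner (U (x + y)) (x + y) - cinner (U (x - y)) (x - y))"
      by (metis norm_mult norm_numeral)
    also have "\<dots> \<le> cmod (cinner (U (x + y)) (x + y)) + cmod (cinner (U (x - y)) (x - y))"
      by (rule norm_triangle_ineq4)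
    also have "\<dots> \<le> e * (norm (x + y))\<^sup>2 + e * (norm (x - y))\<^sup>2"
      using x y csubspaceD(2,4)[OF M] by (intro add_mono form) auto
    also have "\<dots> = 2 * (e * ((norm x)\<^sup>2 + (norm y)\<^sup>2))"
      unfolding norm_add_sq norm_diff_sq by (simp add: algebra_simps)
    finally show ?thesis by simp
  qed
  have bil: "cmod (cinner (U x) y) \<le> e * ((norm x)\<^sup>2 + (norm y)\<^sup>2)" if y: "y \<in> M" for y
  proof -
    have "cinner (U x) (scaleC \<i> y) + cinner (U (scaleC \<i> y)) x = \<i> * (cinner (U x) y - cinner (U y) x)"
      by (simp add: adjoint_pair_linear[OF U] cinner_simps algebra_simps)
    then have "cmod (cinner (U x) y - cinner (U y) x) \<le> e * ((norm x)\<^sup>2 + (norm y)\<^sup>2)"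
      using sum[OF csubspaceD(3)[OF M y, of \<i>]] by (simp add: norm_mult)
    moreover have "2 * cinner (U x) y = (cinner (U x) y + cinner (U y) x) + (cinner (U x) y - cinner (U y) x)"
      by simp
    then have "2 * cmod (cinner (U x) y) = cmod ((cinner (U x) y + cinner (U y) x) + (cinner (U x) y - cinner (U y) x))"
      by (metis norm_mult norm_numeral)
    ultimately show ?thesis
      using sum[OF y] norm_triangle_ineq[of "cinner (U x) y + cinner (U y) x" "cinner (U x) y - cinner (U y) x"]
      by linarith
  qed
  have x0: "x \<noteq> 0" using False adjoint_pair_linear'(3)[OF U] by auto
  \<comment> \<open>\<open>y\<close> points along \<open>U x\<close>, so \<open><U x, y>\<close>
    recovers \<open>|U x|\<close>; giving it the length of \<open>x\<close> makes the bound in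
    \<open>bil\<close> a multiple of \<open>|x|^2\<close>.\<close>
  define y where "y = (norm x / norm (U x)) *\<^sub>R U x"
  have y: "y \<in> M" "norm y = norm x" unfolding y_def using False x inv csubspaceD(5)[OF M] by auto
  have "cinner (U x) y = complex_of_real (norm x * norm (U x))"
    unfolding y_def using False by (simp add: cinner_simps cinner_self_norm power2_eq_square)
  then have "norm x * norm (U x) = cmod (cinner (U x) y)" by (simp add: norm_mult)
  also have "\<dots> \<le> norm x * (2 * e * norm x)" using bil[OF y(1)] y(2) by (simp add: power2_eq_square mult_ac)
  finally show ?thesis using x0 by (simp add: mult_le_cancel_left)
qed

text \<open>On an invariant subspace on which $|T|$, $|T - 1|$ and $|T - i|$ are nearly constant, the real and
  the imaginary part of the numerical range of $T$ are nearly constant.\<close>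

lemma near_scalar_of_annuli:
  assumes T: "adjoint_pair T T'" and M: "csubspace M" and inv: "\<And>x. x \<in> M \<Longrightarrow> T x \<in> M"
    and c: "\<And>l x. l \<in> {0, 1, \<i>} \<Longrightarrow> x \<in> M \<Longrightarrow>
      c l * (norm x)\<^sup>2 \<le> (norm (T x - scaleC l x))\<^sup>2 \<and> (norm (T x - scaleC l x))\<^sup>2 \<le> (c l + d) * (norm x)\<^sup>2"
  shows "\<exists>z. \<forall>x\<in>M. norm (T x - scaleC z x) \<le> 2 * d * norm x"
proof -
  \<comment> \<open>Expanding \<open>|T x - x|^2\<close> and \<open>|T x - i x|^2\<close> expresses
    the real and imaginary parts of \<open><T x, x>\<close> through the three squared distances;
    \<open>w\<close> results when these are replaced by the values of \<open>c\<close>. As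
    \<open>cinner\<close> is antilinear in its first argument, the approximate scalar is
    \<open>cnj w\<close>.\<close>
  define w where "w = Complex ((c 0 + 1 - c 1) / 2) ((c \<i> - c 0 - 1) / 2)"
  note U = adjoint_pair_diff_scaleC[OF T, of "cnj w"]
  have "norm (T x - scaleC (cnj w) x) \<le> 2 * d * norm x" if "x \<in> M" for x
  proof (rule numerical_radius_bound[OF U M _ _ that])
    fix x assume x: "x \<in> M"
    show "T x - scaleC (cnj w) x \<in> M" by (intro csubspaceD[OF M] inv x)
    define n where "n = (norm x)\<^sup>2"
    define u where "u = cinner (T x) x"
    define t where "t = (norm (T x))\<^sup>2"
    have 0: "c 0 * n \<le> t" "t \<le> (c 0 + d) * n" using c[OF _ x, of 0] by (auto simp: n_def t_def)
    have "(norm (T x - scaleC 1 x))\<^sup>2 = t - 2 * Re u + n"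
      unfolding norm_diff_sq by (simp add: scaleC_one t_def u_def n_def)
    then have 1: "c 1 * n \<le> t - 2 * Re u + n" "t - 2 * Re u + n \<le> (c 1 + d) * n"
      using c[OF _ x, of 1] by (auto simp: n_def)
    have "(norm (T x - scaleC \<i> x))\<^sup>2 = t + 2 * Im u + n"
      unfolding norm_diff_sq by (simp add: t_def u_def n_def cinner_simps)
    then have 2: "c \<i> * n \<le> t + 2 * Im u + n" "t + 2 * Im u + n \<le> (c \<i> + d) * n"
      using c[OF _ x, of \<i>] by (auto simp: n_def)
    have "cinner (T x - scaleC (cnj w) x) x = u - w * n"
      by (simp add: cinner_simps u_def n_def cinner_self_norm)
    then have "cmod (cinner (T x - scaleC (cnj w) x) x) \<le> \<bar>Re u - Re w * n\<bar> + \<bar>Im u - Im w * n\<bar>"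
      using cmod_le[of "u - w * n"] by simp
    also have "\<dots> \<le> d * n / 2 + d * n / 2"
    proof (rule add_mono)
      have "Re w * n = (c 0 * n + n - c 1 * n) / 2" "Im w * n = (c \<i> * n - c 0 * n - n) / 2"
        by (simp_all add: w_def field_simps)
      note w = this
      have aux: "\<bar>v - m\<bar> \<le> e / 2"
        if "a \<le> s" "s \<le> a + e" "b \<le> s - 2 * v + n" "s - 2 * v + n \<le> b + e" "m = (a + n - b) / 2"
        for a b e s v m :: real using that by argo
      show "\<bar>Re u - Re w * n\<bar> \<le> d * n / 2"
        by (rule aux[OF 0[unfolded distrib_right] 1[unfolded distrib_right] w(1)])
      have "\<bar>- Im u - - (Im w * n)\<bar> \<le> d * n / 2"
        by (rule aux[OF 0[unfolded distrib_right], of "c \<i> * n"])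
          (use 2 w(2) in \<open>simp_all add: distrib_right\<close>)
      then show "\<bar>Im u - Im w * n\<bar> \<le> d * n / 2" by (simp add: abs_minus_commute)
    qed
    finally show "cmod (cinner (T x - scaleC (cnj w) x) x) \<le> d * (norm x)\<^sup>2" by (simp add: n_def)
  qed
  then show ?thesis by blast
qed

section \<open>Cutting along joint spectral subspaces\<close>

definition reducing :: "(('a::chilbert \<Rightarrow> 'a) \<times> ('a \<Rightarrow> 'a)) set \<Rightarrow> 'a set \<Rightarrow> bool" where
  "reducing F M \<longleftrightarrow> closed_csubspace M \<and> (\<forall>(T, T')\<in>F. \<forall>x\<in>M. T x \<in> M \<and> T' x \<in> M)"

text \<open>For a normal \<open>T\<close> and a reducing \<open>M\<close>, this confines the
  spectrum of the restriction to an annulus about \<open>l\<close> with squared radii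
  \<open>c\<close> and \<open>c + d\<close>.\<close>

definition annular :: "real \<Rightarrow> ('a::chilbert \<Rightarrow> 'a) \<Rightarrow> complex \<Rightarrow> 'a set \<Rightarrow> bool" where
  "annular d T l M \<longleftrightarrow> (\<exists>c. \<forall>x\<in>M. c * (norm x)\<^sup>2 \<le> (norm (T x - scaleC l x))\<^sup>2
     \<and> (norm (T x - scaleC l x))\<^sup>2 \<le> (c + d) * (norm x)\<^sup>2)"

text \<open>Commutation is stated between first components; that spectral subspaces also respect the
  adjoints comes from the growth argument in \<open>disc_splitting\<close>.\<close>

definition normal_family :: "(('a::chilbert \<Rightarrow> 'a) \<times> ('a \<Rightarrow> 'a)) set \<Rightarrow> bool" where
  "normal_family F \<longleftrightarrow> (\<forall>(T, T')\<in>F. adjoint_pair T T' \<and> (\<forall>x. T (T' x) = T' (T x)))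
     \<and> (\<forall>(T, T')\<in>F. \<forall>(U, U')\<in>F. \<forall>x. T (U x) = U (T x))"

context
  fixes F :: "(('a::chilbert \<Rightarrow> 'a) \<times> ('a \<Rightarrow> 'a)) set"
  assumes F: "normal_family F"
  fixes Q :: "'a \<Rightarrow> 'a" and q d :: real
  assumes Qadd: "\<And>x y. Q (x + y) = Q x + Q y"
    and Qinv: "\<And>M x. reducing F M \<Longrightarrow> x \<in> M \<Longrightarrow> Q x \<in> M"
    and q: "0 \<le> q" and d: "0 < d"
begin

lemma family_adjoint: "(T, T') \<in> F \<Longrightarrow> adjoint_pair T T'"
  and family_normal: "(T, T') \<in> F \<Longrightarrow> T (T' x) = T' (T x)"
  and family_commute: "(T, T') \<in> F \<Longrightarrow> (U, U') \<in> F \<Longrightarrow> T (U x) = U (T x)"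
  using F unfolding normal_family_def by blast+

text \<open>\<open>Q\<close> abstracts an operator built from the family. Since it preserves every
  reducing subspace, equal bounds on orthogonal reducing pieces add up, by Pythagoras, to the same
  bound on their sum. As \<open>T\<close> is bounded, finitely many annuli about \<open>l\<close>
  exhaust \<open>M\<close>.\<close>

lemma slicing_step:
  assumes T: "(T, T') \<in> F" and M: "reducing F M"
    and slice: "\<And>L. reducing F L \<Longrightarrow> L \<subseteq> M \<Longrightarrow> annular d T l L \<Longrightarrow> \<forall>x\<in>L. norm (Q x) \<le> q * norm x"
  shows "\<forall>x\<in>M. norm (Q x) \<le> q * norm x"
proof -
  define D where "D x = T x - scaleC l x" for x
  define D' where "D' x = T' x - scaleC (cnj l) x" for x
  have D: "adjoint_pair D D'" unfolding D_def D'_def by (rule adjoint_pair_diff_scaleC[OF family_adjoint[OF T]])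
  note lin = adjoint_pair_linear[OF family_adjoint[OF T]] adjoint_pair_linear'[OF family_adjoint[OF T]]
  note lin' = adjoint_pair_linear[OF adjoint_pair_sym[OF family_adjoint[OF T]]] adjoint_pair_linear'[OF adjoint_pair_sym[OF family_adjoint[OF T]]]
  have Dnormal: "D (D' x) = D' (D x)" for x
    by (simp add: D_def D'_def lin lin' family_normal[OF T] scaleC_diff_right scaleC_scaleC mult.commute)
  have Dcomm: "U (D x) = D (U x)" if "(U, U') \<in> F" for U U' x
    using family_commute[OF that T] by (simp add: D_def adjoint_pair_linear[OF family_adjoint[OF that]] adjoint_pair_linear'[OF family_adjoint[OF that]])
  have main: "\<forall>x\<in>L. norm (Q x) \<le> q * norm x"
    if "reducing F L" "L \<subseteq> M" "\<And>x. x \<in> L \<Longrightarrow> (norm (D x))\<^sup>2 \<le> real n * d * (norm x)\<^sup>2" for n L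
    using that
  proof (induction n arbitrary: L)
    case 0
    then have "annular d T l L" unfolding annular_def D_def
      using d by (intro exI[of _ 0]) (auto intro!: order_trans[OF 0(3)[unfolded D_def]])
    then show ?case using slice 0 by blast
  next
    \<comment> \<open>The outermost annulus is split off: on \<open>L \<inter> E\<close> the value
      \<open>n d\<close> bounds \<open>|D|^2\<close> and the induction hypothesis applies, while on
      the rest of \<open>L\<close> the form of \<open>|D|^2\<close> lies between \<open>n d\<close>
      and \<open>(n + 1) d\<close>.\<close>
    case (Suc n)
    have L: "closed_csubspace L" using Suc.prems(1) by (simp add: reducing_def)
    have Lsub: "csubspace L" using L by (simp add: closed_csubspace_def)
    have nd: "0 \<le> real n * d" using d by simp
    obtain E where E: "closed_csubspace E"
      and in_E: "\<And>x. x \<in> E \<Longrightarrow> (norm (D x))\<^sup>2 \<le> (real n * d) * (norm x)\<^sup>2"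
      and out_E: "\<And>x. x \<in> orth_in UNIV E \<Longrightarrow> (real n * d) * (norm x)\<^sup>2 \<le> (norm (D x))\<^sup>2"
      and inv_all: "\<forall>X X'. adjoint_pair X X' \<and> (\<forall>x. X (D x) = D (X x)) \<longrightarrow> (\<forall>x\<in>E. X x \<in> E \<and> X' x \<in> E)"
      by (rule disc_splitting[OF D Dnormal nd, of thesis]) (rule that)
    have inv_E: "X x \<in> E \<and> X' x \<in> E" if "adjoint_pair X X'" "\<And>x. X (D x) = D (X x)" "x \<in> E" for X X' x
      using inv_all that by blast
    have Einv: "U x \<in> E \<and> U' x \<in> E" if "(U, U') \<in> F" "x \<in> E" for U U' x
      by (rule inv_E[OF family_adjoint[OF that(1)] Dcomm[OF that(1)] that(2)])
    have Oinv: "U x \<in> orth_in UNIV E \<and> U' x \<in> orth_in UNIV E" if U: "(U, U') \<in> F" and x: "x \<in> orth_in UNIV E" for U U' x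
      using Einv[OF U] adjoint_invariant_orth[OF family_adjoint[OF U] _ x]
        adjoint_invariant_orth[OF adjoint_pair_sym[OF family_adjoint[OF U]] _ x] by blast
    have red1: "reducing F (L \<inter> E)"
      using Suc.prems(1) Einv closed_csubspace_Int[OF L E] by (fastforce simp: reducing_def)
    have red2: "reducing F (L \<inter> orth_in UNIV E)"
      using Suc.prems(1) Oinv closed_csubspace_Int[OF L closed_csubspace_orth_in[of E]]
      by (fastforce simp: reducing_def)
    have P1: "\<forall>x\<in>L \<inter> E. norm (Q x) \<le> q * norm x"
      by (rule Suc.IH[OF red1]) (use Suc.prems in_E in auto)
    have "annular d T l (L \<inter> orth_in UNIV E)"
      unfolding annular_def
      using out_E Suc.prems(3) by (intro exI[of _ "real n * d"]) (auto simp: D_def algebra_simps)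
    then have P2: "\<forall>x\<in>L \<inter> orth_in UNIV E. norm (Q x) \<le> q * norm x"
      using slice[OF red2] Suc.prems(2) by blast
    show ?case
    proof
      fix x assume x: "x \<in> L"
      define u where "u = proj E x"
      define v where "v = x - u"
      have u: "u \<in> E" and v: "v \<in> orth_in UNIV E"
        using proj_in[OF E] diff_proj_in_orth[OF E] by (auto simp: u_def v_def)
      have PL: "adjoint_pair (proj L) (proj L)" by (rule adjoint_pair_proj[OF L])
      \<comment> \<open>\<open>u\<close> and \<open>v\<close> are formed from \<open>E\<close>
        without regard to \<open>L\<close>. Since \<open>proj L\<close> commutes with
        \<open>D\<close>, it preserves \<open>E\<close> and its complement, and uniqueness of the
        decomposition of \<open>x\<close> along \<open>E\<close> gives
        \<open>u = proj L u\<close>.\<close>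
      have PLD: "proj L (D z) = D (proj L z)" for z
      proof -
        have *: "D y \<in> L \<and> D' y \<in> L" if "y \<in> L" for y
          using Suc.prems(1) T that unfolding D_def D'_def reducing_def
          by (fastforce intro: csubspaceD[OF Lsub])
        then show ?thesis by (intro proj_commute[OF L D]) auto
      qed
      have uL': "proj L u \<in> E" using inv_E[OF PL PLD u] by simp
      have "proj L v \<in> orth_in UNIV E"
        by (rule adjoint_invariant_orth[OF PL _ v]) (use inv_E[OF PL PLD] in blast)
      from proj_unique[OF E uL' this]
      have "proj E (proj L u + proj L v) = proj L u" .
      moreover have "proj L u + proj L v = x"
        using proj_id[OF L x] by (simp add: v_def flip: adjoint_pair_linear(1)[OF PL])
      ultimately have "u = proj L u" by (simp add: u_def)
      then have uL: "u \<in> L" using proj_in[OF L] by metis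
      then have vL: "v \<in> L" unfolding v_def using x csubspaceD(4)[OF Lsub] by blast
      have "norm (Q u) \<le> q * norm u" "norm (Q v) \<le> q * norm v" using P1 P2 u v uL vL by auto
      then have sq: "(norm (Q u))\<^sup>2 \<le> q\<^sup>2 * (norm u)\<^sup>2" "(norm (Q v))\<^sup>2 \<le> q\<^sup>2 * (norm v)\<^sup>2"
        by (metis norm_ge_zero power_mono power_mult_distrib)+
      have "Q u \<in> E" "Q v \<in> orth_in UNIV E" using Qinv[OF red1] Qinv[OF red2] u v uL vL by auto
      then have "(norm (Q u + Q v))\<^sup>2 = (norm (Q u))\<^sup>2 + (norm (Q v))\<^sup>2"
        by (intro pythagoras) (simp add: orth_in_def)
      also have "\<dots> \<le> q\<^sup>2 * ((norm u)\<^sup>2 + (norm v)\<^sup>2)" using sq by (simp add: distrib_left)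
      also have "(norm u)\<^sup>2 + (norm v)\<^sup>2 = (norm (u + v))\<^sup>2"
        using u v by (subst pythagoras) (auto simp: orth_in_def)
      finally have "(norm (Q x))\<^sup>2 \<le> (q * norm x)\<^sup>2"
        by (simp add: v_def power_mult_distrib flip: Qadd)
      then show "norm (Q x) \<le> q * norm x" using q by (simp add: power2_le_iff_abs_le)
    qed
  qed
  obtain K where K: "K > 0" "\<And>x. norm (D x) \<le> K * norm x" using adjoint_pair_bound[OF D] by metis
  obtain n where "K\<^sup>2 / d < real n" using reals_Archimedean2 by blast
  then have n: "K\<^sup>2 \<le> real n * d" using d by (simp add: field_simps)
  show ?thesis
  proof (rule main[OF M order_refl])
    fix x
    have "(norm (D x))\<^sup>2 \<le> (K * norm x)\<^sup>2" by (intro power_mono K) auto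
    also have "\<dots> \<le> real n * d * (norm x)\<^sup>2" unfolding power_mult_distrib by (intro mult_right_mono n) auto
    finally show "(norm (D x))\<^sup>2 \<le> real n * d * (norm x)\<^sup>2" .
  qed
qed

text \<open>The single cut is iterated over a list of operators and centres; conditions obtained
  earlier survive because \<open>annular\<close> passes to subspaces.\<close>

lemma slicing:
  assumes "\<And>T l. (T, l) \<in> set ds \<Longrightarrow> \<exists>T'. (T, T') \<in> F" and "reducing F M"
    and "\<And>L. reducing F L \<Longrightarrow> L \<subseteq> M \<Longrightarrow> (\<And>T l. (T, l) \<in> set ds \<Longrightarrow> annular d T l L) \<Longrightarrow>
      \<forall>x\<in>L. norm (Q x) \<le> q * norm x"
  shows "\<forall>x\<in>M. norm (Q x) \<le> q * norm x"
  using assms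
proof (induction ds arbitrary: M)
  case Nil
  then show ?case by simp
next
  case (Cons p ds)
  obtain T l where p: "p = (T, l)" by (cases p)
  obtain T' where T: "(T, T') \<in> F" using Cons.prems(1)[of T l] p by auto
  show ?case
  proof (rule slicing_step[OF T Cons.prems(2), of l])
    fix L assume L: "reducing F L" "L \<subseteq> M" "annular d T l L"
    show "\<forall>x\<in>L. norm (Q x) \<le> q * norm x"
    proof (rule Cons.IH[OF _ L(1)])
      show "\<exists>T'. (T, T') \<in> F" if "(T, l) \<in> set ds" for T l using Cons.prems(1)[of T l] that by auto
    next
      fix L' assume L': "reducing F L'" "L' \<subseteq> L" "\<And>T l. (T, l) \<in> set ds \<Longrightarrow> annular d T l L'"
      have "annular d T l L'" using L(3) L'(2) unfolding annular_def by blast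
      then show "\<forall>x\<in>L'. norm (Q x) \<le> q * norm x"
        using L L' p by (intro Cons.prems(3)) auto
    qed
  qed
qed

text \<open>On a piece that is annular for all operators and centres, every operator is nearly
  scalar. If no vector of \<open>M\<close> worked, the bound for \<open>Q\<close> would thus hold on
  all such pieces, and slicing would extend it to \<open>x0\<close>.\<close>

lemma approximate_joint_eigenvector:
  assumes fin: "finite F" and M: "reducing F M" and x0: "x0 \<in> M" "q * norm x0 < norm (Q x0)"
  shows "\<exists>x\<in>M. q * norm x < norm (Q x) \<and> (\<forall>(T, T')\<in>F. \<exists>z. norm (T x - scaleC z x) \<le> 2 * d * norm x)"
proof (rule ccontr)
  assume not: "\<not> ?thesis"
  have "finite (fst ` F \<times> {0, 1, \<i>})" using fin by simp
  then obtain ds where ds: "set ds = fst ` F \<times> {0, 1, \<i>}" using finite_list by blast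
  have "\<forall>x\<in>M. norm (Q x) \<le> q * norm x"
  proof (rule slicing[OF _ M, of ds])
    show "\<exists>T'. (T, T') \<in> F" if "(T, l) \<in> set ds" for T l using that unfolding ds by force
  next
    fix L assume L: "reducing F L" "L \<subseteq> M" and ann: "\<And>T l. (T, l) \<in> set ds \<Longrightarrow> annular d T l L"
    have sub: "csubspace L" using L(1) by (simp add: reducing_def closed_csubspace_def)
    have near: "\<exists>z. \<forall>x\<in>L. norm (T x - scaleC z x) \<le> 2 * d * norm x" if T: "(T, T') \<in> F" for T T'
    proof -
      have "T \<in> fst ` F" using T by (rule image_eqI[rotated]) simp
      then have "\<forall>l\<in>{0, 1, \<i>}. annular d T l L" by (intro ballI ann) (simp add: ds)
      then have "\<exists>c. \<forall>l\<in>{0, 1, \<i>}. \<forall>x\<in>L. c l * (norm x)\<^sup>2 \<le> (norm (T x - scaleC l x))\<^sup>2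
         \<and> (norm (T x - scaleC l x))\<^sup>2 \<le> (c l + d) * (norm x)\<^sup>2"
        unfolding annular_def by (rule bchoice)
      then obtain c where c: "\<forall>l\<in>{0, 1, \<i>}. \<forall>x\<in>L. c l * (norm x)\<^sup>2 \<le> (norm (T x - scaleC l x))\<^sup>2
         \<and> (norm (T x - scaleC l x))\<^sup>2 \<le> (c l + d) * (norm x)\<^sup>2" ..
      show ?thesis
        by (rule near_scalar_of_annuli[OF family_adjoint[OF T] sub _ c[rule_format]])
          (use L(1) T in \<open>auto simp: reducing_def\<close>)
    qed
    show "\<forall>x\<in>L. norm (Q x) \<le> q * norm x"
    proof
      fix x assume x: "x \<in> L"
      have "\<forall>(T, T')\<in>F. \<exists>z. norm (T x - scaleC z x) \<le> 2 * d * norm x" using near x by blast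
      then show "norm (Q x) \<le> q * norm x" using not x L(2) by (meson not_le subsetD)
    qed
  qed
  then show False using x0 by force
qed

end

section \<open>The Taylor spectrum\<close>

text \<open>By Baire's theorem one of the closed sets \<open>A k\<close> contains a ball; testing
  \<open>v\<close> on a vector along \<open>v\<close> inside that ball bounds its norm.\<close>

lemma uniform_boundedness:
  fixes V :: "'a::chilbert set"
  assumes pw: "\<And>x. \<exists>K. \<forall>v\<in>V. cmod (cinner v x) \<le> K"
  shows "\<exists>C. \<forall>v\<in>V. norm v \<le> C"
proof -
  define A where "A k = {x. \<forall>v\<in>V. cmod (cinner v x) \<le> real k}" for k :: nat
  have clo: "closed (A k)" for k
  proof -
    have "A k = (\<Inter>v\<in>V. {x. cmod (cinner v x) \<le> real k})" by (auto simp: A_def)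
    moreover have "closed {x. cmod (cinner v x) \<le> real k}" for v
      by (intro closed_Collect_le continuous_intros bounded_linear.continuous_on[OF bounded_linear_cinner_right])
    ultimately show ?thesis by auto
  qed
  have "(\<Union>k. A k) = UNIV"
  proof -
    have "\<exists>k. x \<in> A k" for x
    proof -
      obtain K where K: "\<forall>v\<in>V. cmod (cinner v x) \<le> K" using pw by blast
      obtain k where "K \<le> real k" using real_arch_simple by blast
      then have "x \<in> A k" using K unfolding A_def by force
      then show ?thesis ..
    qed
    then show ?thesis by auto
  qed
  have "\<exists>k. interior (A k) \<noteq> {}"
  proof (rule ccontr)
    assume "\<not> ?thesis"
    then have "euclidean interior_of \<Union>(range A) = {}"
      using clo by (intro Baire_category_alt) (auto simp: completely_metrizable_space_euclidean)
    then show False using \<open>(\<Union>k. A k) = UNIV\<close> by simp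
  qed
  then obtain k x0 where "x0 \<in> interior (A k)" by blast
  then obtain e where e: "e > 0" "ball x0 e \<subseteq> A k" using mem_interior by blast
  have "norm v \<le> 4 * real k / e" if v: "v \<in> V" for v
  proof (cases "v = 0")
    case False
    define y where "y = (e / (2 * norm v)) *\<^sub>R v"
    have "norm y = e / 2" using False e by (simp add: y_def)
    then have "x0 + y \<in> A k" "x0 \<in> A k" using e by (auto simp: dist_norm)
    then have "cmod (cinner v (x0 + y)) \<le> real k" "cmod (cinner v x0) \<le> real k" using v by (auto simp: A_def)
    moreover have "cinner v y = cinner v (x0 + y) - cinner v x0" by (simp add: cinner_simps)
    ultimately have "cmod (cinner v y) \<le> 2 * real k"
      using norm_triangle_ineq4[of "cinner v (x0 + y)" "cinner v x0"] by simp
    moreover have "cinner v y = complex_of_real (e / 2 * norm v)"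
      using False by (simp add: y_def cinner_simps cinner_self_norm power2_eq_square)
    then have "cmod (cinner v y) = \<bar>e / 2 * norm v\<bar>" by (metis norm_of_real)
    ultimately show ?thesis using e by (simp add: field_simps abs_mult)
  qed (use e in simp)
  then show ?thesis by blast
qed

text \<open>Exactness at the end of the Koszul complex says that the row \<open>(T1, T2, T3)\<close>
  is onto \<open>M\<close>, and the adjoint of a surjection is bounded below: the vectors with
  \<open>f v <= 1\<close> are weakly bounded, hence bounded by
  \<open>uniform_boundedness\<close>.\<close>

lemma taylor_regular_bounded_below:
  assumes M: "closed_csubspace M"
    and adj: "adjoint_pair T1 T1'" "adjoint_pair T2 T2'" "adjoint_pair T3 T3'"
    and reg: "taylor_regular M T1 T2 T3"
  shows "\<exists>c>0. \<forall>v\<in>M. c * norm v \<le> norm (T1' v) + norm (T2' v) + norm (T3' v)"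
proof -
  define f where "f v = norm (T1' v) + norm (T2' v) + norm (T3' v)" for v
  define V where "V = {v\<in>M. f v \<le> 1}"
  have "\<exists>K. \<forall>v\<in>V. cmod (cinner v x) \<le> K" for x
  proof -
    obtain y1 y2 y3 where y: "proj M x = T1 y1 + T2 y2 + T3 y3"
      using reg proj_in[OF M, of x] unfolding taylor_regular_def by metis
    have "cmod (cinner v x) \<le> norm y1 + norm y2 + norm y3" if v: "v \<in> V" for v
    proof -
      have vM: "v \<in> M" and fv: "f v \<le> 1" using v by (auto simp: V_def)
      have le1: "norm (T1' v) \<le> 1" "norm (T2' v) \<le> 1" "norm (T3' v) \<le> 1"
        using fv norm_ge_zero[of "T1' v"] norm_ge_zero[of "T2' v"] norm_ge_zero[of "T3' v"]
        unfolding f_def by linarith+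
      have "cinner v x = cinner v (proj M x)" using proj_orth[OF M vM, of x] by (simp add: cinner_simps)
      also have "\<dots> = cinner (T1' v) y1 + cinner (T2' v) y2 + cinner (T3' v) y3"
        unfolding y using adj[THEN adjoint_pair_sym, THEN adjoint_pairD] by (simp add: cinner_simps)
      also have "cmod \<dots> \<le> cmod (cinner (T1' v) y1) + cmod (cinner (T2' v) y2) + cmod (cinner (T3' v) y3)"
        by (rule order_trans[OF norm_triangle_ineq add_right_mono[OF norm_triangle_ineq]])
      also have "\<dots> \<le> norm (T1' v) * norm y1 + norm (T2' v) * norm y2 + norm (T3' v) * norm y3"
        by (intro add_mono cinner_cauchy_schwarz)
      also have "\<dots> \<le> 1 * norm y1 + 1 * norm y2 + 1 * norm y3"
        by (intro add_mono mult_right_mono le1) auto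
      finally show ?thesis by simp
    qed
    then show ?thesis by blast
  qed
  from uniform_boundedness[OF this] obtain C0 where C0: "\<And>v. v \<in> V \<Longrightarrow> norm v \<le> C0" by blast
  define C where "C = max 1 C0"
  have C: "C > 0" "\<And>v. v \<in> V \<Longrightarrow> norm v \<le> C" using C0 by (force simp: C_def)+
  have scale: "f (r *\<^sub>R v) = \<bar>r\<bar> * f v" for r v
    unfolding f_def by (simp add: adj[THEN adjoint_pair_sym, THEN adjoint_pair_linear'(2)] distrib_left)
  have sub: "csubspace M" using M by (simp add: closed_csubspace_def)
  have "norm v \<le> C * f v" if v: "v \<in> M" for v
  proof (cases "f v = 0")
    case True
    have "norm v \<le> 0"
    proof (rule ccontr)
      assume "\<not> norm v \<le> 0"
      then have n: "norm v > 0" by simp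
      \<comment> \<open>If \<open>f v = 0\<close>, all multiples of \<open>v\<close> lie in
        \<open>V\<close>; one of norm \<open>2 C\<close> violates the bound
        \<open>C\<close>.\<close>
      have "(2 * C / norm v) *\<^sub>R v \<in> V"
        unfolding V_def using True csubspaceD(5)[OF sub v] by (simp add: scale)
      from C(2)[OF this] show False using n C(1) by simp
    qed
    then show ?thesis using True by simp
  next
    case False
    have "f v \<ge> 0" by (simp add: f_def)
    then have fv: "f v > 0" using False by simp
    then have "(1 / f v) *\<^sub>R v \<in> V"
      unfolding V_def using csubspaceD(5)[OF sub v] by (simp add: scale)
    from C(2)[OF this] show ?thesis using fv by (simp add: field_simps)
  qed
  then have "\<forall>v\<in>M. (1 / C) * norm v \<le> f v" using C(1) by (simp add: field_simps)
  then show ?thesis unfolding f_def using C(1) by (metis divide_pos_pos zero_less_one)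
qed

text \<open>The \<open>bi\<close> form a contracting homotopy. A triple \<open>x\<close> in the
  kernel of the second map comes from \<open>b1 x1 + b2 x2 + b3 x3\<close>, a triple
  \<open>y\<close> in the kernel of the third comes from the cross product of \<open>y\<close> with
  \<open>b\<close>, and \<open>w\<close> is hit by \<open>(b1 w, b2 w, b3 w)\<close>.\<close>

lemma taylor_regular_of_homotopy:
  fixes M :: "'a::chilbert set"
  assumes comm: "commuting_on M T1 T2 T3"
    and sub: "csubspace M"
    and inv: "\<And>T x. T \<in> {T1, T2, T3, b1, b2, b3} \<Longrightarrow> x \<in> M \<Longrightarrow> T x \<in> M"
    and add: "\<And>T x y. T \<in> {T1, T2, T3, b1, b2, b3} \<Longrightarrow> x \<in> M \<Longrightarrow> y \<in> M \<Longrightarrow> T (x + y) = T x + T y"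
    and bT: "\<And>b T x. b \<in> {b1, b2, b3} \<Longrightarrow> T \<in> {T1, T2, T3} \<Longrightarrow> x \<in> M \<Longrightarrow> b (T x) = T (b x)"
    and id: "\<And>x. x \<in> M \<Longrightarrow> b1 (T1 x) + b2 (T2 x) + b3 (T3 x) = x"
  shows "taylor_regular M T1 T2 T3"
proof -
  have zero: "T 0 = 0" if "T \<in> {T1, T2, T3, b1, b2, b3}" for T
    using add[OF that csubspaceD(1)[OF sub] csubspaceD(1)[OF sub]] by simp
  have diff: "T (x - y) = T x - T y" if "T \<in> {T1, T2, T3, b1, b2, b3}" "x \<in> M" "y \<in> M" for T x y
    using add[OF that(1) csubspaceD(4)[OF sub that(2,3)] that(3)] by simp
  have c12: "T1 (T2 x) = T2 (T1 x)" and c13: "T1 (T3 x) = T3 (T1 x)" and c23: "T2 (T3 x) = T3 (T2 x)"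
    if "x \<in> M" for x using comm that by (auto simp: commuting_on_def)
  have id': "T1 (b1 x) + T2 (b2 x) + T3 (b3 x) = x" if "x \<in> M" for x
    using id[OF that] bT that by simp
  show ?thesis
    unfolding taylor_regular_def
  proof (intro conjI ballI impI; (elim conjE)?)
    fix x assume "x \<in> M" "T1 x = 0" "T2 x = 0" "T3 x = 0"
    then show "x = 0" using id[of x] zero[of b1] zero[of b2] zero[of b3] by simp
  next
    fix x1 x2 x3 assume x: "x1 \<in> M" "x2 \<in> M" "x3 \<in> M"
      and eqs: "T2 x3 - T3 x2 = 0" "T3 x1 - T1 x3 = 0" "T1 x2 - T2 x1 = 0"
    have bx: "b1 x1 \<in> M" "b2 x2 \<in> M" "b3 x3 \<in> M" using x inv by auto
    define x where "x = b1 x1 + b2 x2 + b3 x3"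
    have T: "T x = b1 (T x1) + b2 (T x2) + b3 (T x3)" if "T \<in> {T1, T2, T3}" for T
    proof -
      have T: "T \<in> {T1, T2, T3, b1, b2, b3}" using that by auto
      have "T x = T (b1 x1) + T (b2 x2) + T (b3 x3)"
        unfolding x_def by (simp add: add[OF T] bx csubspaceD(2)[OF sub])
      then show ?thesis using bT[OF _ that] x by simp
    qed
    have "x1 = T1 x" using T[of T1] id[OF x(1)] eqs by simp
    moreover have "x2 = T2 x" using T[of T2] id[OF x(2)] eqs by simp
    moreover have "x3 = T3 x" using T[of T3] id[OF x(3)] eqs by simp
    moreover have "x \<in> M" unfolding x_def using bx csubspaceD(2)[OF sub] by simp
    ultimately show "\<exists>x\<in>M. x1 = T1 x \<and> x2 = T2 x \<and> x3 = T3 x" by blast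
  next
    fix y1 y2 y3 assume y: "y1 \<in> M" "y2 \<in> M" "y3 \<in> M" and sum: "T1 y1 + T2 y2 + T3 y3 = 0"
    have bM: "b y1 \<in> M" "b y2 \<in> M" "b y3 \<in> M" if "b \<in> {b1, b2, b3}" for b
      using y inv[of b] that by auto
    have Ty: "T1 y1 \<in> M" "T2 y2 \<in> M" "T3 y3 \<in> M" using y inv by auto
    define x1 where "x1 = b3 y2 - b2 y3"
    define x2 where "x2 = b1 y3 - b3 y1"
    define x3 where "x3 = b2 y1 - b1 y2"
    have bsum: "b (T1 y1) + b (T2 y2) + b (T3 y3) = 0" if "b \<in> {b1, b2, b3}" for b
    proof -
      have b: "b \<in> {T1, T2, T3, b1, b2, b3}" using that by auto
      have "b (T1 y1) + b (T2 y2) + b (T3 y3) = b (T1 y1 + T2 y2 + T3 y3)"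
        by (simp add: add[OF b] Ty csubspaceD(2)[OF sub])
      then show ?thesis using sum zero[OF b] by simp
    qed
    have D: "T (b u - c v) = b (T u) - c (T v)"
      if "T \<in> {T1, T2, T3}" "b \<in> {b1, b2, b3}" "c \<in> {b1, b2, b3}" "u \<in> M" "v \<in> M" for T b c u v
    proof -
      have T: "T \<in> {T1, T2, T3, b1, b2, b3}" using that by auto
      have "b u \<in> M" "c v \<in> M" using inv that by auto
      then have "T (b u - c v) = T (b u) - T (c v)" by (rule diff[OF T])
      then show ?thesis using bT that by simp
    qed
    have cancel: "q + r - (s + t) = y" if "p + q + r = y" "p + s + t = 0" for p q r s t y :: 'a
    proof -
      have "q + r - (s + t) = (p + q + r) - (p + s + t)" by simp
      then show ?thesis using that by simp
    qed
    have "T2 x3 - T3 x2 = b2 (T2 y1) + b3 (T3 y1) - (b1 (T2 y2) + b1 (T3 y3))"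
      unfolding x2_def x3_def using y by (simp add: D)
    also have "\<dots> = y1" by (rule cancel[of "b1 (T1 y1)"]) (use id[OF y(1)] bsum[of b1] in \<open>simp_all add: add_ac\<close>)
    finally have e1: "y1 = T2 x3 - T3 x2" ..
    have "T3 x1 - T1 x3 = b3 (T3 y2) + b1 (T1 y2) - (b2 (T3 y3) + b2 (T1 y1))"
      unfolding x1_def x3_def using y by (simp add: D)
    also have "\<dots> = y2" by (rule cancel[of "b2 (T2 y2)"]) (use id[OF y(2)] bsum[of b2] in \<open>simp_all add: add_ac\<close>)
    finally have e2: "y2 = T3 x1 - T1 x3" ..
    have "T1 x2 - T2 x1 = b1 (T1 y3) + b2 (T2 y3) - (b3 (T1 y1) + b3 (T2 y2))"
      unfolding x1_def x2_def using y by (simp add: D)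
    also have "\<dots> = y3" by (rule cancel[of "b3 (T3 y3)"]) (use id[OF y(3)] bsum[of b3] in \<open>simp_all add: add_ac\<close>)
    finally have e3: "y3 = T1 x2 - T2 x1" ..
    have "x1 \<in> M" "x2 \<in> M" "x3 \<in> M"
      unfolding x1_def x2_def x3_def
      using csubspaceD(4)[OF sub] bM[of b1] bM[of b2] bM[of b3] by simp_all
    then show "\<exists>x1\<in>M. \<exists>x2\<in>M. \<exists>x3\<in>M. y1 = T2 x3 - T3 x2 \<and> y2 = T3 x1 - T1 x3 \<and> y3 = T1 x2 - T2 x1"
      using e1 e2 e3 by blast
  next
    fix w assume w: "w \<in> M"
    then have "b1 w \<in> M" "b2 w \<in> M" "b3 w \<in> M" using inv by auto
    then show "\<exists>y1\<in>M. \<exists>y2\<in>M. \<exists>y3\<in>M. w = T1 y1 + T2 y2 + T3 y3" using id'[OF w] by metis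
  qed
qed

text \<open>By coercivity \<open>x - t (D x - y)\<close> is a contraction in \<open>x\<close> for
  small \<open>t\<close>, and its fixed point solves the equation. The choice
  \<open>t = c / K^2\<close> minimizes \<open>1 - 2 t c + t^2 K^2\<close>, with minimum
  \<open>1 - c^2 / K^2\<close>.\<close>

lemma lax_milgram:
  fixes M :: "'a::chilbert set"
  assumes M: "closed_csubspace M" and D: "bounded_linear D" and inv: "\<And>x. x \<in> M \<Longrightarrow> D x \<in> M"
    and c: "c > 0" "\<And>x. x \<in> M \<Longrightarrow> c * (norm x)\<^sup>2 \<le> Re (cinner (D x) x)" and y: "y \<in> M"
  shows "\<exists>!x. x \<in> M \<and> D x = y"
proof -
  have sub: "csubspace M" and "closed M" using M by (auto simp: closed_csubspace_def)
  obtain K0 where K0: "\<And>x. norm (D x) \<le> norm x * K0" using bounded_linear.bounded[OF D] by blast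
  \<comment> \<open>Taking \<open>K\<close> above \<open>c\<close> keeps the argument of the square
    root in \<open>k\<close> positive.\<close>
  define K where "K = max (c + 1) K0"
  have K: "c < K" "norm (D x) \<le> K * norm x" for x
  proof -
    show "norm (D x) \<le> K * norm x"
      by (rule order_trans[OF K0]) (simp add: K_def mult_left_mono mult.commute[of _ "norm x"])
  qed (simp add: K_def)
  define t where "t = c / K\<^sup>2"
  have Kpos: "K > 0" using K c by linarith
  have t: "t > 0" using c Kpos by (simp add: t_def)
  define k where "k = sqrt (1 - c\<^sup>2 / K\<^sup>2)"
  have "c\<^sup>2 / K\<^sup>2 \<le> 1" using c K Kpos by (simp add: power_mono)
  then have k: "0 \<le> k" "k < 1" "k\<^sup>2 = 1 - c\<^sup>2 / K\<^sup>2" using c Kpos by (auto simp: k_def)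
  have contr: "norm (x - t *\<^sub>R D x) \<le> k * norm x" if "x \<in> M" for x
  proof -
    have "(norm (x - t *\<^sub>R D x))\<^sup>2 = (norm x)\<^sup>2 - 2 * t * Re (cinner (D x) x) + t\<^sup>2 * (norm (D x))\<^sup>2"
      unfolding norm_diff_sq using cinner_commute[of x "D x"] by (simp add: cinner_simps power_mult_distrib)
    also have "\<dots> \<le> (norm x)\<^sup>2 - 2 * t * (c * (norm x)\<^sup>2) + t\<^sup>2 * (K * norm x)\<^sup>2"
      using t c(2)[OF that] K(2) by (intro add_mono diff_mono mult_left_mono power_mono) auto
    also have "\<dots> = (k * norm x)\<^sup>2"
      unfolding power_mult_distrib k t_def using Kpos by (simp add: field_simps power2_eq_square)
    finally show ?thesis using k by (simp add: power2_le_iff_abs_le)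
  qed
  have lin: "D (u - v) = D u - D v" for u v by (rule linear_diff[OF bounded_linear.linear[OF D]])
  have "\<exists>!x\<in>M. x - t *\<^sub>R (D x - y) = x"
  proof (rule Banach_fix[OF _ _ k(1,2)])
    show "complete M" using \<open>closed M\<close> by (simp add: complete_eq_closed)
    show "M \<noteq> {}" using csubspaceD(1)[OF sub] by blast
    show "(\<lambda>x. x - t *\<^sub>R (D x - y)) ` M \<subseteq> M"
      using inv y csubspaceD(4,5)[OF sub] by (simp add: image_subset_iff)
    fix u v assume "u \<in> M" "v \<in> M"
    then have "u - v \<in> M" using csubspaceD(4)[OF sub] by blast
    from contr[OF this] show "dist (u - t *\<^sub>R (D u - y)) (v - t *\<^sub>R (D v - y)) \<le> k * dist u v"
      by (simp add: dist_norm lin algebra_simps)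
  qed
  moreover have "x - t *\<^sub>R (D x - y) = x \<longleftrightarrow> D x = y" for x using t by auto
  ultimately show ?thesis by auto
qed

text \<open>The lower bound makes \<open>D\<close> coercive, hence invertible on \<open>M\<close>
  with inverse \<open>G\<close>. Double commutation lets \<open>G\<close> commute with each
  \<open>Ti\<close>, so the maps \<open>G Ti'\<close> satisfy the hypotheses of the homotopy lemma,
  their sum against the \<open>Ti\<close> being \<open>G D\<close>.\<close>

lemma taylor_regular_of_bounded_below:
  fixes M :: "'a::chilbert set"
  assumes M: "closed_csubspace M"
    and adj: "adjoint_pair T1 T1'" "adjoint_pair T2 T2'" "adjoint_pair T3 T3'"
    and inv_all: "\<forall>T\<in>{T1, T2, T3, T1', T2', T3'}. \<forall>x\<in>M. T x \<in> M"
    and comm: "commuting_on M T1 T2 T3"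
    and dcomm_all: "\<forall>T\<in>{T1, T2, T3}. \<forall>T'\<in>{T1', T2', T3'}. \<forall>x\<in>M. T' (T x) = T (T' x)"
    and c: "c > 0" "\<And>x. x \<in> M \<Longrightarrow> c * (norm x)\<^sup>2 \<le> (norm (T1 x))\<^sup>2 + (norm (T2 x))\<^sup>2 + (norm (T3 x))\<^sup>2"
  shows "taylor_regular M T1 T2 T3"
proof -
  note inv = inv_all[rule_format] and dcomm = dcomm_all[rule_format]
  define D where "D x = T1' (T1 x) + T2' (T2 x) + T3' (T3 x)" for x
  note adj' = adj[THEN adjoint_pair_sym]
  have D: "adjoint_pair D D" unfolding D_def
    by (rule adjoint_pair_add[OF adjoint_pair_add[OF adjoint_pair_compose[OF adj'(1) adj(1)]
            adjoint_pair_compose[OF adj'(2) adj(2)]] adjoint_pair_compose[OF adj'(3) adj(3)]])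
  have sub: "csubspace M" using M by (simp add: closed_csubspace_def)
  have Dinv: "D x \<in> M" if "x \<in> M" for x unfolding D_def using that by (simp add: csubspaceD(2)[OF sub] inv)
  have Dform: "c * (norm x)\<^sup>2 \<le> Re (cinner (D x) x)" if "x \<in> M" for x
    using c(2)[OF that] by (simp add: D_def cinner_simps adj'[THEN adjoint_pairD] norm_sq_cinner)
  note ex1 = lax_milgram[OF M adjoint_pair_bounded_linear[OF D] Dinv c(1) Dform]
  define G where "G y = (THE x. x \<in> M \<and> D x = y)" for y
  have G: "G y \<in> M \<and> D (G y) = y" if "y \<in> M" for y
    unfolding G_def by (rule theI'[OF ex1[OF _ _ that]])
  have Guniq: "G (D x) = x" if "x \<in> M" for x
    unfolding G_def using ex1[OF _ _ Dinv[OF that]] that by (intro the1_equality) auto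
  have Gadd: "G (x + y) = G x + G y" if "x \<in> M" "y \<in> M" for x y
  proof -
    have "D (G x + G y) = x + y" using G that by (simp add: adjoint_pair_linear[OF D])
    then show ?thesis using Guniq[of "G x + G y"] G that csubspaceD(2)[OF sub] by simp
  qed
  have DT: "D (T x) = T (D x)" if "T \<in> {T1, T2, T3}" "x \<in> M" for T x
  proof -
    have TT: "U (T x) = T (U x)" if "U \<in> {T1, T2, T3}" for U
      using comm \<open>T \<in> {T1, T2, T3}\<close> \<open>x \<in> M\<close> that by (auto simp: commuting_on_def)
    have "T1 x \<in> M" "T2 x \<in> M" "T3 x \<in> M" using that inv by auto
    then have "D (T x) = T (T1' (T1 x)) + T (T2' (T2 x)) + T (T3' (T3 x))"
      unfolding D_def using TT dcomm[OF that(1)] by simp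
    then show ?thesis unfolding D_def using that(1) adj[THEN adjoint_pair_linear(1)] by auto
  qed
  have GT: "G (T x) = T (G x)" if "T \<in> {T1, T2, T3}" "x \<in> M" for T x
  proof -
    have "D (T (G x)) = T x" using DT[OF that(1)] G[OF that(2)] by simp
    moreover have "T (G x) \<in> M" using inv that G by auto
    ultimately show ?thesis using Guniq by metis
  qed
  show ?thesis
  proof (rule taylor_regular_of_homotopy[OF comm sub, of "\<lambda>x. G (T1' x)" "\<lambda>x. G (T2' x)" "\<lambda>x. G (T3' x)"])
    fix T x assume "T \<in> {T1, T2, T3, \<lambda>x. G (T1' x), \<lambda>x. G (T2' x), \<lambda>x. G (T3' x)}" "x \<in> M"
    then show "T x \<in> M" using G inv by auto
  next
    fix T x y assume "T \<in> {T1, T2, T3, \<lambda>x. G (T1' x), \<lambda>x. G (T2' x), \<lambda>x. G (T3' x)}" "x \<in> M" "y \<in> M"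
    then show "T (x + y) = T x + T y"
      using Gadd inv by (auto simp: adj[THEN adjoint_pair_linear(1)] adj'[THEN adjoint_pair_linear(1)])
  next
    fix b T x assume b: "b \<in> {\<lambda>x. G (T1' x), \<lambda>x. G (T2' x), \<lambda>x. G (T3' x)}" and T: "T \<in> {T1, T2, T3}" and x: "x \<in> M"
    from b obtain T' where T': "T' \<in> {T1', T2', T3'}" "b = (\<lambda>x. G (T' x))" by blast
    then have "T' x \<in> M" using inv x by auto
    then show "b (T x) = T (b x)" using dcomm[OF T T'(1) x] GT[OF T] by (simp add: T'(2))
  next
    fix x assume x: "x \<in> M"
    have "T1' (T1 x) \<in> M" "T2' (T2 x) \<in> M" "T3' (T3 x) \<in> M" using inv x by auto
    then have "G (T1' (T1 x)) + G (T2' (T2 x)) + G (T3' (T3 x)) = G (D x)"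
      unfolding D_def by (simp add: Gadd csubspaceD(2)[OF sub])
    then show "G (T1' (T1 x)) + G (T2' (T2 x)) + G (T3' (T3 x)) = x" using Guniq[OF x] by simp
  qed
qed

text \<open>This permits replacing operators by ones that are cut off outside
  \<open>M\<close>.\<close>

lemma taylor_spectrum_cong:
  assumes "\<And>x. x \<in> M \<Longrightarrow> T1 x = U1 x" "\<And>x. x \<in> M \<Longrightarrow> T2 x = U2 x" "\<And>x. x \<in> M \<Longrightarrow> T3 x = U3 x"
  shows "taylor_spectrum M T1 T2 T3 = taylor_spectrum M U1 U2 U3"
proof -
  have "taylor_regular M (\<lambda>x. T1 x - scaleC a x) (\<lambda>x. T2 x - scaleC b x) (\<lambda>x. T3 x - scaleC c x)
     = taylor_regular M (\<lambda>x. U1 x - scaleC a x) (\<lambda>x. U2 x - scaleC b x) (\<lambda>x. U3 x - scaleC c x)" for a b c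
    unfolding taylor_regular_def using assms by (simp cong: ball_cong bex_cong)
  then show ?thesis unfolding taylor_spectrum_def by simp
qed

section \<open>Approximate joint eigenvectors\<close>

lemma unit_scalar_limit:
  fixes X :: "nat \<Rightarrow> 'a::chilbert"
  assumes "\<And>n. norm (X n) = 1" "(\<lambda>n. scaleC c (X n)) \<longlonglongrightarrow> 0"
  shows "c = 0"
  using tendsto_norm_zero[OF assms(2)] assms(1) LIMSEQ_const_iff[of "cmod c" 0] by simp

lemma approx_eigen_compose:
  fixes X :: "nat \<Rightarrow> 'a::chilbert"
  assumes U: "adjoint_pair U U'"
    and T: "(\<lambda>n. T (X n) - scaleC z (X n)) \<longlonglongrightarrow> 0" and w: "(\<lambda>n. U (X n) - scaleC w (X n)) \<longlonglongrightarrow> 0"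
  shows "(\<lambda>n. U (T (X n)) - scaleC (z * w) (X n)) \<longlonglongrightarrow> 0"
proof -
  have "(\<lambda>n. U (T (X n) - scaleC z (X n))) \<longlonglongrightarrow> U 0"
    by (rule bounded_linear.tendsto[OF adjoint_pair_bounded_linear[OF U] T])
  moreover have "(\<lambda>n. scaleC z (U (X n) - scaleC w (X n))) \<longlonglongrightarrow> scaleC z 0"
    by (rule bounded_linear.tendsto[OF bounded_linear_scaleC w])
  ultimately have "(\<lambda>n. U (T (X n) - scaleC z (X n)) + scaleC z (U (X n) - scaleC w (X n))) \<longlonglongrightarrow> U 0 + scaleC z 0"
    by (rule tendsto_add)
  then show ?thesis
    by (simp add: adjoint_pair_linear[OF U] adjoint_pair_linear'[OF U] scaleC_diff_right scaleC_scaleC)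
qed

text \<open>For normal \<open>T\<close>, the operator \<open>T - z\<close> and its adjoint have
  equal norms on each vector. Normality is stated along the sequence because in the application it
  holds on a subspace.\<close>

lemma approx_eigen_adjoint:
  fixes X :: "nat \<Rightarrow> 'a::chilbert"
  assumes T: "adjoint_pair T T'" and normal: "\<And>n. T (T' (X n)) = T' (T (X n))"
    and lim: "(\<lambda>n. T (X n) - scaleC z (X n)) \<longlonglongrightarrow> 0"
  shows "(\<lambda>n. T' (X n) - scaleC (cnj z) (X n)) \<longlonglongrightarrow> 0"
proof -
  note lin = adjoint_pair_linear[OF T] adjoint_pair_linear'[OF T]
  note lin' = adjoint_pair_linear[OF adjoint_pair_sym[OF T]] adjoint_pair_linear'[OF adjoint_pair_sym[OF T]]
  define U where "U x = T x - scaleC z x" for x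
  define U' where "U' x = T' x - scaleC (cnj z) x" for x
  have U: "adjoint_pair U U'" unfolding U_def U'_def by (rule adjoint_pair_diff_scaleC[OF T])
  have "U (U' (X n)) = U' (U (X n))" for n
    unfolding U_def U'_def lin lin' scaleC_diff_right scaleC_scaleC normal
    by (simp add: mult.commute)
  then have "norm (U' (X n)) = norm (U (X n))" for n by (rule normal_norm_eq[OF U])
  then have "norm (T' (X n) - scaleC (cnj z) (X n)) = norm (T (X n) - scaleC z (X n))" for n
    by (simp add: U_def U'_def)
  then show ?thesis using tendsto_norm_zero[OF lim] by (subst tendsto_norm_zero_iff[symmetric]) simp
qed

text \<open>The bridge from a nonzero \<open>Q\<close> to a spectral point at which \<open>Q\<close>
  is felt. The approximate eigenvalues found at finer and finer scales are bounded, so a subsequence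
  converges; at the limit the shifted adjoints are not bounded below, which excludes Taylor
  regularity.\<close>

lemma joint_spectrum_vector:
  fixes N :: "'a::chilbert set"
  assumes F: "F = {(T1, T1'), (T2, T2'), (T3, T3')}" and nf: "normal_family F"
    and N: "reducing F N"
    and Q: "bounded_linear Q" and Qinv: "\<And>M x. reducing F M \<Longrightarrow> x \<in> M \<Longrightarrow> Q x \<in> M"
    and x0: "x0 \<in> N" "Q x0 \<noteq> 0"
  shows "\<exists>z1 z2 z3 X e. (z1, z2, z3) \<in> taylor_spectrum N T1 T2 T3 \<and> 0 < e
    \<and> (\<forall>n::nat. X n \<in> N \<and> norm (X n) = 1 \<and> e \<le> norm (Q (X n)))
    \<and> (\<lambda>n. T1 (X n) - scaleC z1 (X n)) \<longlonglongrightarrow> 0 \<and> (\<lambda>n. T2 (X n) - scaleC z2 (X n)) \<longlonglongrightarrow> 0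
    \<and> (\<lambda>n. T3 (X n) - scaleC z3 (X n)) \<longlonglongrightarrow> 0"
proof -
  have adj: "adjoint_pair T1 T1'" "adjoint_pair T2 T2'" "adjoint_pair T3 T3'"
    and normal: "\<And>x. T1 (T1' x) = T1' (T1 x)" "\<And>x. T2 (T2' x) = T2' (T2 x)" "\<And>x. T3 (T3' x) = T3' (T3 x)"
    using nf by (auto simp: normal_family_def F)
  have Nc: "closed_csubspace N" and sub: "csubspace N" using N by (auto simp: reducing_def closed_csubspace_def)
  have Qlin: "Q (x + y) = Q x + Q y" "Q (r *\<^sub>R x) = r *\<^sub>R Q x" "Q 0 = 0" for x y r
    using bounded_linear.linear[OF Q] by (simp_all add: linear_add linear_scale linear_0)
  have x00: "x0 \<noteq> 0" using x0 Qlin by auto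
  \<comment> \<open>Half the ratio at \<open>x0\<close>, for a strict inequality. It is independent
    of the scale \<open>d\<close> and therefore survives the limit.\<close>
  define e where "e = norm (Q x0) / (2 * norm x0)"
  have e: "0 < e" "e * norm x0 < norm (Q x0)" using x0 x00 by (auto simp: e_def)
  have adjF: "adjoint_pair T T'" if "(T, T') \<in> F" for T T' using that adj unfolding F by auto
  have ex: "\<exists>x z. x \<in> N \<and> norm x = 1 \<and> e \<le> norm (Q x) \<and> norm (T1 x - scaleC (fst z) x) \<le> d
     \<and> norm (T2 x - scaleC (fst (snd z)) x) \<le> d \<and> norm (T3 x - scaleC (snd (snd z)) x) \<le> d" if d: "0 < d" for d
  proof -
    \<comment> \<open>Cutting at scale \<open>d / 2\<close> offsets the factor 2 of
      \<open>numerical_radius_bound\<close>.\<close>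
    have "\<exists>x\<in>N. e * norm x < norm (Q x) \<and> (\<forall>(T, T')\<in>F. \<exists>z. norm (T x - scaleC z x) \<le> 2 * (d / 2) * norm x)"
    proof (rule approximate_joint_eigenvector[where F = F and Q = Q and q = e and d = "d / 2"])
      show "finite F" by (simp add: F)
    qed (use nf Qlin(1) Qinv e d N x0(1) in auto)
    then obtain x z1 z2 z3 where x: "x \<in> N" "e * norm x < norm (Q x)"
      and z: "norm (T1 x - scaleC z1 x) \<le> d * norm x" "norm (T2 x - scaleC z2 x) \<le> d * norm x"
        "norm (T3 x - scaleC z3 x) \<le> d * norm x"
      unfolding F by auto
    have nx: "norm x > 0" using x Qlin by auto
    define y where "y = (1 / norm x) *\<^sub>R x"
    have y: "y \<in> N" "norm y = 1" using x nx csubspaceD(5)[OF sub] by (auto simp: y_def)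
    have "e \<le> norm (Q y)" unfolding y_def Qlin using x nx by (simp add: field_simps)
    moreover have "norm (T y - scaleC z y) \<le> d" if "(T, T') \<in> F" "norm (T x - scaleC z x) \<le> d * norm x" for T T' z
    proof -
      have eq: "T y - scaleC z y = (1 / norm x) *\<^sub>R (T x - scaleC z x)"
        unfolding y_def adjoint_pair_linear'[OF adjF[OF that(1)]] scaleC_scaleR by (rule scaleR_diff_right[symmetric])
      show ?thesis unfolding eq norm_scaleR using that(2) nx by (simp add: field_simps)
    qed
    ultimately show ?thesis using y z
      by (intro exI[of _ y] exI[of _ "(z1, z2, z3)"]) (auto simp: F)
  qed
  have "\<forall>n. \<exists>x z. x \<in> N \<and> norm x = 1 \<and> e \<le> norm (Q x) \<and> norm (T1 x - scaleC (fst z) x) \<le> 1 / real (Suc n)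
     \<and> norm (T2 x - scaleC (fst (snd z)) x) \<le> 1 / real (Suc n) \<and> norm (T3 x - scaleC (snd (snd z)) x) \<le> 1 / real (Suc n)"
    by (intro allI ex) simp
  from choice[OF this] obtain X where "\<forall>n. \<exists>z. X n \<in> N \<and> norm (X n) = 1 \<and> e \<le> norm (Q (X n))
     \<and> norm (T1 (X n) - scaleC (fst z) (X n)) \<le> 1 / real (Suc n)
     \<and> norm (T2 (X n) - scaleC (fst (snd z)) (X n)) \<le> 1 / real (Suc n)
     \<and> norm (T3 (X n) - scaleC (snd (snd z)) (X n)) \<le> 1 / real (Suc n)" ..
  from choice[OF this] obtain Z where XZ: "\<forall>n. X n \<in> N \<and> norm (X n) = 1 \<and> e \<le> norm (Q (X n))
     \<and> norm (T1 (X n) - scaleC (fst (Z n)) (X n)) \<le> 1 / real (Suc n)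
     \<and> norm (T2 (X n) - scaleC (fst (snd (Z n))) (X n)) \<le> 1 / real (Suc n)
     \<and> norm (T3 (X n) - scaleC (snd (snd (Z n))) (X n)) \<le> 1 / real (Suc n)" ..
  have Z_bound: "cmod w \<le> K + 1" if "\<And>x. norm (T x) \<le> K * norm x" "norm (T (X n) - scaleC w (X n)) \<le> 1 / real (Suc n)" for T K w n
  proof -
    have "cmod w = norm (scaleC w (X n))" using XZ by simp
    also have "\<dots> \<le> norm (T (X n)) + norm (T (X n) - scaleC w (X n))"
      using norm_triangle_ineq4[of "T (X n)" "T (X n) - scaleC w (X n)"] by simp
    also have "\<dots> \<le> K * norm (X n) + 1 / real (Suc n)" by (intro add_mono that)
    also have "\<dots> \<le> K + 1" using XZ by simp
    finally show ?thesis .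
  qed
  obtain K1 where K1: "\<And>x. norm (T1 x) \<le> K1 * norm x" using adjoint_pair_bound[OF adj(1)] by metis
  obtain K2 where K2: "\<And>x. norm (T2 x) \<le> K2 * norm x" using adjoint_pair_bound[OF adj(2)] by metis
  obtain K3 where K3: "\<And>x. norm (T3 x) \<le> K3 * norm x" using adjoint_pair_bound[OF adj(3)] by metis
  have "range Z \<subseteq> cball 0 (K1 + 1) \<times> cball 0 (K2 + 1) \<times> cball 0 (K3 + 1)"
  proof
    fix w assume "w \<in> range Z"
    then obtain n where n: "w = Z n" by blast
    show "w \<in> cball 0 (K1 + 1) \<times> cball 0 (K2 + 1) \<times> cball 0 (K3 + 1)"
      unfolding n mem_Times_iff mem_cball_0
      using Z_bound[OF K1] Z_bound[OF K2] Z_bound[OF K3] XZ by blast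
  qed
  then have "bounded (range Z)" by (rule bounded_subset[rotated]) (intro bounded_Times bounded_cball)
  from bounded_imp_convergent_subsequence[OF this] obtain l r where r: "strict_mono (r::nat \<Rightarrow> nat)"
    and lim: "(Z \<circ> r) \<longlonglongrightarrow> l" by blast
  obtain z1 z2 z3 where l: "l = (z1, z2, z3)" by (cases l)
  have Zlim: "(\<lambda>n. fst (Z (r n))) \<longlonglongrightarrow> z1" "(\<lambda>n. fst (snd (Z (r n)))) \<longlonglongrightarrow> z2" "(\<lambda>n. snd (snd (Z (r n)))) \<longlonglongrightarrow> z3"
    using tendsto_fst[OF lim] tendsto_fst[OF tendsto_snd[OF lim]] tendsto_snd[OF tendsto_snd[OF lim]]
    by (simp_all add: l o_def)
  define Y where "Y n = X (r n)" for n
  have Y: "Y n \<in> N" "norm (Y n) = 1" "e \<le> norm (Q (Y n))" for n using XZ by (auto simp: Y_def)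
  have approx: "(\<lambda>n. T (Y n) - scaleC z (Y n)) \<longlonglongrightarrow> 0"
    if w: "(\<lambda>n. w (r n)) \<longlonglongrightarrow> z" and T: "\<And>n. norm (T (X n) - scaleC (w n) (X n)) \<le> 1 / real (Suc n)" for T w z
  proof (rule Lim_null_comparison)
    show "\<forall>\<^sub>F n in sequentially. norm (T (Y n) - scaleC z (Y n)) \<le> 1 / real (Suc n) + cmod (w (r n) - z)"
    proof (rule always_eventually, rule allI)
      fix n
      have "T (Y n) - scaleC z (Y n) = (T (Y n) - scaleC (w (r n)) (Y n)) + scaleC (w (r n) - z) (Y n)"
        by (simp add: scaleC_diff_left)
      also have "norm \<dots> \<le> norm (T (Y n) - scaleC (w (r n)) (Y n)) + norm (scaleC (w (r n) - z) (Y n))"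
        by (rule norm_triangle_ineq)
      also have "\<dots> \<le> 1 / real (Suc (r n)) + cmod (w (r n) - z)" using T[of "r n"] Y(2) by (simp add: Y_def)
      also have "1 / real (Suc (r n)) \<le> 1 / real (Suc n)"
        using strict_mono_imp_increasing[OF r, of n] by (simp add: frac_le)
      finally show "norm (T (Y n) - scaleC z (Y n)) \<le> 1 / real (Suc n) + cmod (w (r n) - z)" by simp
    qed
    have "(\<lambda>n. 1 / real (Suc n) + cmod (w (r n) - z)) \<longlonglongrightarrow> 0 + 0"
      by (intro tendsto_add LIMSEQ_Suc[OF lim_1_over_n] tendsto_norm_zero LIM_zero w)
    then show "(\<lambda>n. 1 / real (Suc n) + cmod (w (r n) - z)) \<longlonglongrightarrow> 0" by simp
  qed
  have L: "(\<lambda>n. T1 (Y n) - scaleC z1 (Y n)) \<longlonglongrightarrow> 0" "(\<lambda>n. T2 (Y n) - scaleC z2 (Y n)) \<longlonglongrightarrow> 0"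
    "(\<lambda>n. T3 (Y n) - scaleC z3 (Y n)) \<longlonglongrightarrow> 0"
    using approx[of "\<lambda>n. fst (Z n)", OF Zlim(1)] approx[of "\<lambda>n. fst (snd (Z n))", OF Zlim(2)]
      approx[of "\<lambda>n. snd (snd (Z n))", OF Zlim(3)] XZ by auto
  \<comment> \<open>\<open>taylor_regular_bounded_below\<close> bounds the adjoints, so the limits
    are transferred to them through normality.\<close>
  have L': "(\<lambda>n. T1' (Y n) - scaleC (cnj z1) (Y n)) \<longlonglongrightarrow> 0" "(\<lambda>n. T2' (Y n) - scaleC (cnj z2) (Y n)) \<longlonglongrightarrow> 0"
    "(\<lambda>n. T3' (Y n) - scaleC (cnj z3) (Y n)) \<longlonglongrightarrow> 0"
    using approx_eigen_adjoint[OF adj(1) _ L(1)] approx_eigen_adjoint[OF adj(2) _ L(2)]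
      approx_eigen_adjoint[OF adj(3) _ L(3)] normal
    by simp_all
  have "(z1, z2, z3) \<in> taylor_spectrum N T1 T2 T3"
  proof (rule ccontr)
    assume "\<not> ?thesis"
    then have "taylor_regular N (\<lambda>x. T1 x - scaleC z1 x) (\<lambda>x. T2 x - scaleC z2 x) (\<lambda>x. T3 x - scaleC z3 x)"
      by (simp add: taylor_spectrum_def)
    from taylor_regular_bounded_below[OF Nc adj[THEN adjoint_pair_diff_scaleC] this]
    obtain c where c: "c > 0" "\<And>v. v \<in> N \<Longrightarrow> c * norm v \<le> norm (T1' v - scaleC (cnj z1) v)
        + norm (T2' v - scaleC (cnj z2) v) + norm (T3' v - scaleC (cnj z3) v)" by blast
    have "(\<lambda>n. norm (T1' (Y n) - scaleC (cnj z1) (Y n)) + norm (T2' (Y n) - scaleC (cnj z2) (Y n))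
        + norm (T3' (Y n) - scaleC (cnj z3) (Y n))) \<longlonglongrightarrow> 0 + 0 + 0"
      by (intro tendsto_add tendsto_norm_zero L')
    then have "c \<le> 0 + 0 + 0"
      by (rule tendsto_lowerbound) (use c(2)[OF Y(1)] Y(2) in auto)
    then show False using c(1) by simp
  qed
  then show ?thesis using e(1) Y L by blast
qed

text \<open>Contrapositive of \<open>taylor_regular_of_bounded_below\<close> for the shifted triple:
  when every lower bound \<open>d\<close> fails, there are unit vectors on which all three shifts
  have norm at most \<open>d\<close>.\<close>

lemma approx_eigenvector_of_taylor_spectrum:
  fixes M :: "'a::chilbert set"
  assumes M: "closed_csubspace M"
    and adj: "adjoint_pair T1 T1'" "adjoint_pair T2 T2'" "adjoint_pair T3 T3'"
    and inv_all: "\<forall>T\<in>{T1, T2, T3, T1', T2', T3'}. \<forall>x\<in>M. T x \<in> M"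
    and comm: "commuting_on M T1 T2 T3"
    and dcomm_all: "\<forall>T\<in>{T1, T2, T3}. \<forall>T'\<in>{T1', T2', T3'}. \<forall>x\<in>M. T' (T x) = T (T' x)"
    and z: "(z1, z2, z3) \<in> taylor_spectrum M T1 T2 T3"
  shows "\<exists>X. (\<forall>n::nat. X n \<in> M \<and> norm (X n) = 1) \<and> (\<lambda>n. T1 (X n) - scaleC z1 (X n)) \<longlonglongrightarrow> 0
    \<and> (\<lambda>n. T2 (X n) - scaleC z2 (X n)) \<longlonglongrightarrow> 0 \<and> (\<lambda>n. T3 (X n) - scaleC z3 (X n)) \<longlonglongrightarrow> 0"
proof -
  note inv = inv_all[rule_format] and dcomm = dcomm_all[rule_format]
  define U1 U2 U3 U1' U2' U3' where U_def:
    "U1 = (\<lambda>x. T1 x - scaleC z1 x)" "U2 = (\<lambda>x. T2 x - scaleC z2 x)" "U3 = (\<lambda>x. T3 x - scaleC z3 x)"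
    "U1' = (\<lambda>x. T1' x - scaleC (cnj z1) x)" "U2' = (\<lambda>x. T2' x - scaleC (cnj z2) x)"
    "U3' = (\<lambda>x. T3' x - scaleC (cnj z3) x)"
  have Uadj: "adjoint_pair U1 U1'" "adjoint_pair U2 U2'" "adjoint_pair U3 U3'"
    unfolding U_def by (rule adj[THEN adjoint_pair_diff_scaleC])+
  have sub: "csubspace M" using M by (simp add: closed_csubspace_def)
  note lin = adj[THEN adjoint_pair_linear(2)] adj[THEN adjoint_pair_linear'(1)]
    adj[THEN adjoint_pair_sym, THEN adjoint_pair_linear(2)] adj[THEN adjoint_pair_sym, THEN adjoint_pair_linear'(1)]
  have Uinv: "U x \<in> M" if "U \<in> {U1, U2, U3, U1', U2', U3'}" "x \<in> M" for U x
    using that inv csubspaceD(3,4)[OF sub] unfolding U_def by auto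
  have Ucomm: "commuting_on M U1 U2 U3"
    using comm unfolding commuting_on_def U_def
    by (simp add: lin scaleC_diff_right scaleC_scaleC mult.commute)
  have Udcomm: "U' (U x) = U (U' x)"
    if U: "U \<in> {U1, U2, U3}" and U': "U' \<in> {U1', U2', U3'}" and x: "x \<in> M" for U U' x
  proof -
    obtain T V z where T: "T \<in> {T1, T2, T3}" "adjoint_pair T V" "U = (\<lambda>x. T x - scaleC z x)"
    proof -
      from U consider "U = U1" | "U = U2" | "U = U3" by blast
      then show thesis
        by cases (rule that[OF _ adj(1)] that[OF _ adj(2)] that[OF _ adj(3)], simp, simp add: U_def)+
    qed
    obtain T' V' w where T': "T' \<in> {T1', T2', T3'}" "adjoint_pair T' V'" "U' = (\<lambda>x. T' x - scaleC w x)"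
    proof -
      from U' consider "U' = U1'" | "U' = U2'" | "U' = U3'" by blast
      then show thesis
        by cases (rule that[OF _ adj(1)[THEN adjoint_pair_sym]] that[OF _ adj(2)[THEN adjoint_pair_sym]]
            that[OF _ adj(3)[THEN adjoint_pair_sym]], simp, simp add: U_def)+
    qed
    show ?thesis
      unfolding T(3) T'(3) adjoint_pair_linear'(1)[OF T(2)] adjoint_pair_linear'(1)[OF T'(2)]
        adjoint_pair_linear(2)[OF T(2)] adjoint_pair_linear(2)[OF T'(2)] dcomm[OF T(1) T'(1) x]
      by (simp add: scaleC_diff_right scaleC_scaleC mult.commute)
  qed
  have notreg: "\<not> taylor_regular M U1 U2 U3" using z by (simp add: taylor_spectrum_def U_def)
  have "\<exists>x\<in>M. norm x = 1 \<and> norm (U1 x) \<le> d \<and> norm (U2 x) \<le> d \<and> norm (U3 x) \<le> d" if d: "0 < d" for d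
  proof -
    have "\<not> (\<forall>x\<in>M. d\<^sup>2 * (norm x)\<^sup>2 \<le> (norm (U1 x))\<^sup>2 + (norm (U2 x))\<^sup>2 + (norm (U3 x))\<^sup>2)"
    proof
      assume below: "\<forall>x\<in>M. d\<^sup>2 * (norm x)\<^sup>2 \<le> (norm (U1 x))\<^sup>2 + (norm (U2 x))\<^sup>2 + (norm (U3 x))\<^sup>2"
      have inv: "\<forall>U\<in>{U1, U2, U3, U1', U2', U3'}. \<forall>x\<in>M. U x \<in> M" using Uinv by simp
      have dcomm: "\<forall>U\<in>{U1, U2, U3}. \<forall>U'\<in>{U1', U2', U3'}. \<forall>x\<in>M. U' (U x) = U (U' x)"
      proof (intro ballI)
        fix U U' x assume "U \<in> {U1, U2, U3}" "U' \<in> {U1', U2', U3'}" "x \<in> M"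
        then show "U' (U x) = U (U' x)" by (rule Udcomm)
      qed
      from taylor_regular_of_bounded_below[OF M Uadj inv Ucomm dcomm, of "d\<^sup>2"]
      show False using below notreg d by simp
    qed
    then obtain x where x: "x \<in> M" "(norm (U1 x))\<^sup>2 + (norm (U2 x))\<^sup>2 + (norm (U3 x))\<^sup>2 < (d * norm x)\<^sup>2"
      by (auto simp: power_mult_distrib not_le)
    have nx: "norm x > 0"
    proof (rule ccontr)
      assume "\<not> norm x > 0"
      then show False using x(2) by (simp add: Uadj[THEN adjoint_pair_linear'(3)])
    qed
    have le: "norm (U1 x) \<le> d * norm x" "norm (U2 x) \<le> d * norm x" "norm (U3 x) \<le> d * norm x"
    proof -
      have dn: "0 \<le> d * norm x" using d by simp
      have "(norm (U1 x))\<^sup>2 \<le> (d * norm x)\<^sup>2" "(norm (U2 x))\<^sup>2 \<le> (d * norm x)\<^sup>2" "(norm (U3 x))\<^sup>2 \<le> (d * norm x)\<^sup>2"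
        using x(2) zero_le_power2[of "norm (U1 x)"] zero_le_power2[of "norm (U2 x)"]
          zero_le_power2[of "norm (U3 x)"] by linarith+
      then show "norm (U1 x) \<le> d * norm x" "norm (U2 x) \<le> d * norm x" "norm (U3 x) \<le> d * norm x"
        using power2_le_imp_le[OF _ dn] by blast+
    qed
    define y where "y = (1 / norm x) *\<^sub>R x"
    have "y \<in> M" "norm y = 1" using x nx csubspaceD(5)[OF sub] by (auto simp: y_def)
    moreover have "norm (U1 y) \<le> d" "norm (U2 y) \<le> d" "norm (U3 y) \<le> d"
      unfolding y_def Uadj[THEN adjoint_pair_linear'(2)] using le nx by (simp_all add: field_simps)
    ultimately show ?thesis by blast
  qed
  then have "\<forall>n. \<exists>x. x \<in> M \<and> norm x = 1 \<and> norm (U1 x) \<le> 1 / real (Suc n)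
      \<and> norm (U2 x) \<le> 1 / real (Suc n) \<and> norm (U3 x) \<le> 1 / real (Suc n)"
    by (metis of_nat_0_less_iff zero_less_Suc zero_less_divide_1_iff)
  from choice[OF this] obtain X where X: "\<forall>n. X n \<in> M \<and> norm (X n) = 1 \<and> norm (U1 (X n)) \<le> 1 / real (Suc n)
      \<and> norm (U2 (X n)) \<le> 1 / real (Suc n) \<and> norm (U3 (X n)) \<le> 1 / real (Suc n)" ..
  have lim: "(\<lambda>n. V n) \<longlonglongrightarrow> 0" if "\<And>n. norm (V n) \<le> 1 / real (Suc n)" for V :: "nat \<Rightarrow> 'a"
    by (rule Lim_null_comparison[OF _ LIMSEQ_Suc[OF lim_1_over_n]]) (use that in auto)
  have "(\<lambda>n. U1 (X n)) \<longlonglongrightarrow> 0" "(\<lambda>n. U2 (X n)) \<longlonglongrightarrow> 0" "(\<lambda>n. U3 (X n)) \<longlonglongrightarrow> 0"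
    by (rule lim, use X in blast)+
  then show ?thesis using X unfolding U_def by blast
qed

section \<open>The distinguished boundary of the pentablock\<close>

text \<open>With \<open>w\<close> a square root of \<open>p\<close>, the condition
  \<open>s = p * cnj s\<close> says that \<open>s * cnj w\<close> is a real number \<open>r\<close>,
  and \<open>|r| <= 2\<close>. The required \<open>z1\<close> and \<open>z2\<close> are
  \<open>w\<close> times the two unit numbers with real part \<open>r / 2\<close>.\<close>

lemma bGammaI:
  assumes p: "cmod p = 1" and s: "s = p * cnj s" and s2: "cmod s \<le> 2"
  shows "(s, p) \<in> bGamma"
proof -
  define w where "w = csqrt p"
  have ww: "w * w = p" unfolding w_def by (metis power2_csqrt power2_eq_square)
  have w1: "cmod w = 1" unfolding w_def by (simp add: p)
  have wcnj: "w * cnj w = 1" using complex_norm_square[of w] w1 by simp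
  define r where "r = Re (s * cnj w)"
  have "cnj (s * cnj w) = s * cnj w"
  proof -
    have "s * cnj w = p * cnj s * cnj w" using s by simp
    also have "\<dots> = w * cnj s * (w * cnj w)" by (simp add: ww[symmetric] mult_ac)
    finally show ?thesis by (simp add: wcnj mult.commute)
  qed
  then have r: "s * cnj w = complex_of_real r"
    unfolding r_def by (metis Reals_cnj_iff of_real_Re)
  have sr: "s = w * complex_of_real r"
  proof -
    have "w * complex_of_real r = s * (w * cnj w)" unfolding r[symmetric] by (simp add: mult_ac)
    then show ?thesis by (simp add: wcnj)
  qed
  have "\<bar>r\<bar> \<le> 2" using s2 unfolding sr by (simp add: norm_mult w1)
  then have r4: "r\<^sup>2 \<le> 4" using abs_le_square_iff[of r 2] by simp
  define t where "t = sqrt (1 - r\<^sup>2 / 4)"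
  have t: "t\<^sup>2 = 1 - r\<^sup>2 / 4" unfolding t_def using r4 by simp
  define z1 where "z1 = w * Complex (r / 2) t"
  define z2 where "z2 = w * Complex (r / 2) (- t)"
  have "cmod (Complex (r / 2) t) = 1" "cmod (Complex (r / 2) (- t)) = 1"
    using t by (simp_all add: cmod_def power_divide)
  then have "cmod z1 = 1" "cmod z2 = 1" by (simp_all add: z1_def z2_def norm_mult w1)
  moreover have "s = z1 + z2"
    unfolding z1_def z2_def sr distrib_left[symmetric] by (simp add: complex_eq_iff)
  moreover have "Complex (r / 2) t * Complex (r / 2) (- t) = 1"
    using t by (simp add: complex_eq_iff power2_eq_square)
  then have "p = z1 * z2" unfolding z1_def z2_def ww[symmetric] by (metis mult.assoc mult.commute mult.right_neutral)
  ultimately show ?thesis unfolding bGamma_def by blast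
qed

text \<open>The existential \<open>z1\<close>, \<open>z2\<close> give way to polynomial equations in
  the coordinates and their conjugates, which make sense for operators. The bound on
  \<open>s\<close> that \<open>bGammaI\<close> asks for is contained in the third equation.\<close>

lemma bPenta_iff:
  "(a, s, p) \<in> bPenta \<longleftrightarrow> p * cnj p = 1 \<and> s = p * cnj s \<and> a * cnj a + s * cnj s / 4 = 1"
proof
  assume "(a, s, p) \<in> bPenta"
  then obtain z1 z2 where z: "s = z1 + z2" "p = z1 * z2" "cmod z1 = 1" "cmod z2 = 1"
    and a: "(cmod a)\<^sup>2 + (cmod s)\<^sup>2 / 4 = 1" unfolding bPenta_def bGamma_def by auto
  have u: "z1 * cnj z1 = 1" "z2 * cnj z2 = 1"
    using complex_norm_square[of z1] complex_norm_square[of z2] z by simp_all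
  have "p * cnj p = (z1 * cnj z1) * (z2 * cnj z2)" unfolding z by (simp add: mult_ac)
  moreover have "p * cnj s = (z1 * cnj z1) * z2 + (z2 * cnj z2) * z1" unfolding z by (simp add: algebra_simps)
  moreover have "a * cnj a + s * cnj s / 4 = 1"
  proof -
    have "a * cnj a + s * cnj s / 4 = complex_of_real ((cmod a)\<^sup>2 + (cmod s)\<^sup>2 / 4)"
      using complex_norm_square[of a] complex_norm_square[of s] by simp
    then show ?thesis unfolding a by simp
  qed
  ultimately show "p * cnj p = 1 \<and> s = p * cnj s \<and> a * cnj a + s * cnj s / 4 = 1"
    unfolding u by (simp add: z(1) add.commute)
next
  assume *: "p * cnj p = 1 \<and> s = p * cnj s \<and> a * cnj a + s * cnj s / 4 = 1"
  have "complex_of_real ((cmod p)\<^sup>2) = 1" using * complex_norm_square[of p] by simp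
  then have "(cmod p)\<^sup>2 = 1" by (metis of_real_eq_1_iff)
  then have p: "cmod p = 1" using norm_ge_zero[of p] by (simp add: power2_eq_1_iff)
  have "complex_of_real ((cmod a)\<^sup>2 + (cmod s)\<^sup>2 / 4) = 1"
    using * complex_norm_square[of a] complex_norm_square[of s] by simp
  then have as: "(cmod a)\<^sup>2 + (cmod s)\<^sup>2 / 4 = 1" by (metis of_real_eq_1_iff)
  then have "(cmod s)\<^sup>2 \<le> 2\<^sup>2"
    using zero_le_power2[of "cmod a"] unfolding power2_eq_square[of "2::real"] by linarith
  then have "cmod s \<le> 2" by (rule power2_le_imp_le) simp
  then show "(a, s, p) \<in> bPenta" using bGammaI[OF p] * as by (simp add: bPenta_def)
qed

text \<open>For commuting operators, these identities are the equations of \<open>bPenta_iff\<close> together with the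
  normality that they do not imply.\<close>

definition penta_identities ::
  "('a::chilbert \<Rightarrow> 'a) \<Rightarrow> ('a \<Rightarrow> 'a) \<Rightarrow> ('a \<Rightarrow> 'a) \<Rightarrow> ('a \<Rightarrow> 'a) \<Rightarrow> ('a \<Rightarrow> 'a) \<Rightarrow> ('a \<Rightarrow> 'a) \<Rightarrow> ('a \<Rightarrow> 'a) set" where
  "penta_identities A A' S S' P P' =
     {\<lambda>x. P' (P x) - x, \<lambda>x. P (P' x) - x, \<lambda>x. S x - S' (P x), \<lambda>x. A (A' x) - A' (A x),
      \<lambda>x. A' (A x) + scaleC (1/4) (S' (S x)) - x}"

context
  fixes A A' S S' P P' :: "'a::chilbert \<Rightarrow> 'a"
  assumes A: "adjoint_pair A A'" and S: "adjoint_pair S S'" and P: "adjoint_pair P P'"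
begin

lemma penta_identities_adjoint: "E \<in> penta_identities A A' S S' P P' \<Longrightarrow> \<exists>E'. adjoint_pair E E'"
proof -
  note A' = adjoint_pair_sym[OF A] and S' = adjoint_pair_sym[OF S] and P' = adjoint_pair_sym[OF P]
  note comp = adjoint_pair_compose and diff = adjoint_pair_diff and ident = adjoint_pair_ident
  assume "E \<in> penta_identities A A' S S' P P'"
  then show ?thesis
    unfolding penta_identities_def
    using diff[OF comp[OF P' P] ident] diff[OF comp[OF P P'] ident] diff[OF S comp[OF S' P]]
      diff[OF comp[OF A A'] comp[OF A' A]]
      diff[OF adjoint_pair_add[OF comp[OF A' A] comp[OF adjoint_pair_scaleC[of "1/4"] comp[OF S' S]]] ident]
    by blast
qed

text \<open>On approximate joint eigenvectors, products of the operators and their adjoints act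
  nearly as the products of the scalars; the three limits do this for the defects of the three
  boundary equations.\<close>

lemma penta_identity_limits:
  fixes X :: "nat \<Rightarrow> 'a"
  assumes L: "(\<lambda>n. A (X n) - scaleC a (X n)) \<longlonglongrightarrow> 0" "(\<lambda>n. S (X n) - scaleC s (X n)) \<longlonglongrightarrow> 0"
      "(\<lambda>n. P (X n) - scaleC p (X n)) \<longlonglongrightarrow> 0"
    and L': "(\<lambda>n. A' (X n) - scaleC (cnj a) (X n)) \<longlonglongrightarrow> 0" "(\<lambda>n. S' (X n) - scaleC (cnj s) (X n)) \<longlonglongrightarrow> 0"
      "(\<lambda>n. P' (X n) - scaleC (cnj p) (X n)) \<longlonglongrightarrow> 0"
  shows "(\<lambda>n. (P' (P (X n)) - X n) - scaleC (p * cnj p - 1) (X n)) \<longlonglongrightarrow> 0"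
    and "(\<lambda>n. (S (X n) - S' (P (X n))) - scaleC (s - p * cnj s) (X n)) \<longlonglongrightarrow> 0"
    and "(\<lambda>n. (A' (A (X n)) + scaleC (1/4) (S' (S (X n))) - X n)
      - scaleC (a * cnj a + s * cnj s / 4 - 1) (X n)) \<longlonglongrightarrow> 0"
proof -
  note A' = adjoint_pair_sym[OF A] and S' = adjoint_pair_sym[OF S] and P' = adjoint_pair_sym[OF P]
  note PP = approx_eigen_compose[OF P' L(3) L'(3)] and SP = approx_eigen_compose[OF S' L(3) L'(2)]
  note AA = approx_eigen_compose[OF A' L(1) L'(1)] and SS = approx_eigen_compose[OF S' L(2) L'(2)]
  show "(\<lambda>n. (P' (P (X n)) - X n) - scaleC (p * cnj p - 1) (X n)) \<longlonglongrightarrow> 0"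
    using PP by (simp add: scaleC_diff_left scaleC_one)
  have "(\<lambda>n. (S (X n) - scaleC s (X n)) - (S' (P (X n)) - scaleC (p * cnj s) (X n))) \<longlonglongrightarrow> 0 - 0"
    by (rule tendsto_diff[OF L(2) SP])
  then show "(\<lambda>n. (S (X n) - S' (P (X n))) - scaleC (s - p * cnj s) (X n)) \<longlonglongrightarrow> 0"
    by (simp add: scaleC_diff_left algebra_simps)
  have "(\<lambda>n. scaleC (1/4) (S' (S (X n)) - scaleC (s * cnj s) (X n))) \<longlonglongrightarrow> scaleC (1/4) 0"
    by (rule bounded_linear.tendsto[OF bounded_linear_scaleC SS])
  from tendsto_add[OF AA this]
  show "(\<lambda>n. (A' (A (X n)) + scaleC (1/4) (S' (S (X n))) - X n)
      - scaleC (a * cnj a + s * cnj s / 4 - 1) (X n)) \<longlonglongrightarrow> 0"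
    by (simp add: scaleC_diff_left scaleC_add_left scaleC_diff_right scaleC_scaleC scaleC_one algebra_simps)
qed

end

section \<open>Operator identities versus joint spectrum in the boundary\<close>

context
  fixes A A' S S' P P' :: "'a::chilbert \<Rightarrow> 'a"
  assumes A: "adjoint_pair A A'" and S: "adjoint_pair S S'" and P: "adjoint_pair P P'"
begin

text \<open>On \<open>M\<close>, \<open>P'\<close> is the inverse of \<open>P\<close> and so
  commutes with \<open>A\<close> and \<open>S\<close>; \<open>S'\<close> inherits this through
  \<open>S' = S P'\<close>. The relations of \<open>A'\<close> with \<open>P\<close> and
  \<open>S\<close> follow by taking adjoints. That is the double commutation which
  \<open>approx_eigenvector_of_taylor_spectrum\<close> asks for.\<close>

lemma penta_unitary_of_identities:
  assumes M: "closed_csubspace M"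
    and inv: "\<forall>T\<in>{A, S, P, A', S', P'}. \<forall>x\<in>M. T x \<in> M"
    and comm: "commuting_on M A S P"
    and ids: "\<forall>E\<in>penta_identities A A' S S' P P'. \<forall>x\<in>M. E x = 0"
  shows "penta_unitary_on M A S P"
proof -
  have sub: "csubspace M" using M by (simp add: closed_csubspace_def)
  have i: "A x \<in> M" "S x \<in> M" "P x \<in> M" "A' x \<in> M" "S' x \<in> M" "P' x \<in> M" if "x \<in> M" for x
    using inv that by auto
  have PP: "P' (P x) = x" and PP': "P (P' x) = x" and SP: "S' (P x) = S x" and AA: "A (A' x) = A' (A x)"
    and AS: "A' (A x) + scaleC (1/4) (S' (S x)) - x = 0" if "x \<in> M" for x
    using ids that by (auto simp: penta_identities_def)
  have cAS: "A (S x) = S (A x)" and cAP: "A (P x) = P (A x)" and cSP: "S (P x) = P (S x)" if "x \<in> M" for x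
    using comm that by (auto simp: commuting_on_def)
  have P'A: "P' (A x) = A (P' x)" if "x \<in> M" for x by (metis PP PP' cAP i(1,6) that)
  have P'S: "P' (S x) = S (P' x)" if "x \<in> M" for x by (metis PP PP' cSP i(2,6) that)
  have S'_eq: "S' x = S (P' x)" if "x \<in> M" for x by (metis PP' SP i(6) that)
  have S'A: "S' (A x) = A (S' x)" if "x \<in> M" for x by (simp add: S'_eq i that P'A cAS)
  have S'S: "S' (S x) = S (S' x)" if "x \<in> M" for x by (simp add: S'_eq i that P'S)
  have S'P: "S' (P x) = P (S' x)" if "x \<in> M" for x by (metis S'_eq SP PP' cSP i(6) that)
  \<comment> \<open>This is the adjoint of the relation \<open>U' T = T U'\<close>. As the relation
    is known on \<open>M\<close>, it is tested on the difference \<open>?d\<close>, which lies in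
    \<open>M\<close>.\<close>
  have transpose: "T' (U x) = U (T' x)"
    if T: "adjoint_pair T T'" and U: "adjoint_pair U U'" and TU: "\<And>y. y \<in> M \<Longrightarrow> U' (T y) = T (U' y)"
      and mem: "T' (U x) \<in> M" "U (T' x) \<in> M" for T T' U U' x
  proof -
    let ?d = "T' (U x) - U (T' x)"
    have d: "?d \<in> M" by (rule csubspaceD(4)[OF sub mem])
    have "cinner ?d ?d = cinner (T' (U x)) ?d - cinner (U (T' x)) ?d" by (rule cinner_diff_left)
    also have "cinner (T' (U x)) ?d = cinner x (U' (T ?d))"
      by (simp only: adjoint_pairD[OF adjoint_pair_sym[OF T]] adjoint_pairD[OF U])
    also have "cinner (U (T' x)) ?d = cinner x (T (U' ?d))"
      by (simp only: adjoint_pairD[OF adjoint_pair_sym[OF T]] adjoint_pairD[OF U])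
    finally have "cinner ?d ?d = 0" using TU[OF d] by simp
    then show ?thesis by simp
  qed
  have A'P: "A' (P x) = P (A' x)" if "x \<in> M" for x
    by (rule transpose[OF A P P'A]) (simp_all add: i that)
  have A'S: "A' (S x) = S (A' x)" if "x \<in> M" for x
    by (rule transpose[OF A S S'A]) (simp_all add: i that)
  have P'P: "P' (P x) = P (P' x)" if "x \<in> M" for x by (simp add: PP PP' that)
  have dcomm: "\<forall>T\<in>{A, S, P}. \<forall>T'\<in>{A', S', P'}. \<forall>x\<in>M. T' (T x) = T (T' x)"
    by (simp add: AA P'A P'S S'A S'S S'P A'P A'S P'P)
  have normal: "normal_on M T" if T: "adjoint_pair T T'" and Ti: "\<And>x. x \<in> M \<Longrightarrow> T x \<in> M"
      "\<And>x. x \<in> M \<Longrightarrow> T' x \<in> M" and TT: "\<And>x. x \<in> M \<Longrightarrow> T (T' x) = T' (T x)" for T T'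
  proof -
    obtain K where "\<And>x. norm (T x) \<le> K * norm x" using adjoint_pair_bound[OF T] by metis
    then have "bounded_clinear_on M T"
      unfolding bounded_clinear_on_def using Ti(1) adjoint_pair_linear[OF T] by blast
    then show ?thesis unfolding normal_on_def using Ti(2) TT adjoint_pairD[OF T] by blast
  qed
  have "z \<in> bPenta" if z: "z \<in> taylor_spectrum M A S P" for z
  proof -
    obtain a s p where zz: "z = (a, s, p)" by (cases z)
    obtain X where X: "\<And>n::nat. X n \<in> M" "\<And>n. norm (X n) = 1" and
      L: "(\<lambda>n. A (X n) - scaleC a (X n)) \<longlonglongrightarrow> 0" "(\<lambda>n. S (X n) - scaleC s (X n)) \<longlonglongrightarrow> 0"
      "(\<lambda>n. P (X n) - scaleC p (X n)) \<longlonglongrightarrow> 0"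
      using approx_eigenvector_of_taylor_spectrum[OF M A S P inv comm dcomm z[unfolded zz]] by blast
    have L': "(\<lambda>n. A' (X n) - scaleC (cnj a) (X n)) \<longlonglongrightarrow> 0" "(\<lambda>n. S' (X n) - scaleC (cnj s) (X n)) \<longlonglongrightarrow> 0"
      "(\<lambda>n. P' (X n) - scaleC (cnj p) (X n)) \<longlonglongrightarrow> 0"
      using approx_eigen_adjoint[OF A _ L(1)] approx_eigen_adjoint[OF S _ L(2)] approx_eigen_adjoint[OF P _ L(3)]
      by (simp_all add: AA S'S P'P X)
    have null: "c = 0" if "(\<lambda>n. Y n - scaleC c (X n)) \<longlonglongrightarrow> 0" "\<And>n. Y n = 0" for Y c
    proof (rule unit_scalar_limit[OF X(2)])
      show "(\<lambda>n. scaleC c (X n)) \<longlonglongrightarrow> 0" using tendsto_minus[OF that(1)] that(2) by simp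
    qed
    note lims = penta_identity_limits[OF A S P L L']
    have "p * cnj p - 1 = 0" by (rule null[OF lims(1)]) (simp add: PP X)
    moreover have "s - p * cnj s = 0" by (rule null[OF lims(2)]) (simp add: SP X)
    moreover have "a * cnj a + s * cnj s / 4 - 1 = 0" by (rule null[OF lims(3)]) (rule AS[OF X(1)])
    ultimately show ?thesis unfolding zz bPenta_iff by simp
  qed
  then show ?thesis
    unfolding penta_unitary_on_def using comm normal[OF A] normal[OF S] normal[OF P] i AA S'S P'P by auto
qed

text \<open>Three identities are the vanishing on \<open>N\<close> of an operator \<open>Q\<close>.
  A nonzero \<open>Q\<close> would stay away from zero on approximate eigenvectors for some spectral
  point; but that point lies in the boundary, so the scalar defect vanishes and \<open>Q\<close>
  tends to zero on them. The other two identities come from normality.\<close>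

lemma identities_of_penta_unitary:
  assumes N: "closed_csubspace N"
    and inv: "\<forall>T\<in>{A, S, P, A', S', P'}. \<forall>x\<in>N. T x \<in> N"
    and comm: "commuting_on N A S P"
    and normal: "\<And>x. x \<in> N \<Longrightarrow> A (A' x) = A' (A x)" "\<And>x. x \<in> N \<Longrightarrow> S (S' x) = S' (S x)"
      "\<And>x. x \<in> N \<Longrightarrow> P (P' x) = P' (P x)"
    and spec: "taylor_spectrum N A S P \<subseteq> bPenta"
  shows "\<forall>E\<in>penta_identities A A' S S' P P'. \<forall>x\<in>N. E x = 0"
proof -
  have sub: "csubspace N" using N by (simp add: closed_csubspace_def)
  have i: "A x \<in> N" "S x \<in> N" "P x \<in> N" "A' x \<in> N" "S' x \<in> N" "P' x \<in> N" if "x \<in> N" for x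
    using inv that by auto
  \<comment> \<open>Normality and commutation are known on \<open>N\<close>, while
    \<open>normal_family\<close> concerns the whole space. For the operators at hand,
    \<open>c T\<close> agrees with \<open>T\<close> on \<open>N\<close> and is zero on the
    complement, so it has these properties everywhere.\<close>
  define c where "c T x = T (proj N x)" for T :: "'a \<Rightarrow> 'a" and x
  note pN = proj_in[OF N] proj_id[OF N]
  have c_id: "c T x = T x" if "x \<in> N" for T x using that by (simp add: c_def pN)
  have c_adj: "adjoint_pair (c T) (c T')" if T: "adjoint_pair T T'"
    and "\<And>x. x \<in> N \<Longrightarrow> T x \<in> N" "\<And>x. x \<in> N \<Longrightarrow> T' x \<in> N" for T T'
  proof -
    have "proj N (T' x) = T' (proj N x)" for x
      by (rule proj_commute[OF N adjoint_pair_sym[OF T]]) (use that in auto)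
    then show ?thesis
      using adjoint_pair_compose[OF T adjoint_pair_proj[OF N]] by (simp add: c_def[abs_def])
  qed
  note adj = c_adj[OF A i(1,4)] c_adj[OF S i(2,5)] c_adj[OF P i(3,6)]
  define F where "F = {(c A, c A'), (c S, c S'), (c P, c P')}"
  have nf: "normal_family F"
    using comm normal adj unfolding F_def normal_family_def commuting_on_def
    by (simp add: c_def pN i)
  have red: "reducing F N" using N i by (simp add: reducing_def F_def c_id)
  have spec': "taylor_spectrum N (c A) (c S) (c P) \<subseteq> bPenta"
    using spec taylor_spectrum_cong[of N "c A" A "c S" S "c P" P] by (simp add: c_id)
  have vanish: "Q x = 0"
    if Q: "bounded_linear Q" and Qinv: "\<And>M x. reducing F M \<Longrightarrow> x \<in> M \<Longrightarrow> Q x \<in> M" and x: "x \<in> N"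
      and lim: "\<And>X a s p. (a, s, p) \<in> bPenta \<Longrightarrow>
        (\<lambda>n. c A (X n) - scaleC a (X n)) \<longlonglongrightarrow> 0 \<Longrightarrow> (\<lambda>n. c S (X n) - scaleC s (X n)) \<longlonglongrightarrow> 0 \<Longrightarrow>
        (\<lambda>n. c P (X n) - scaleC p (X n)) \<longlonglongrightarrow> 0 \<Longrightarrow> (\<lambda>n. c A' (X n) - scaleC (cnj a) (X n)) \<longlonglongrightarrow> 0 \<Longrightarrow>
        (\<lambda>n. c S' (X n) - scaleC (cnj s) (X n)) \<longlonglongrightarrow> 0 \<Longrightarrow> (\<lambda>n. c P' (X n) - scaleC (cnj p) (X n)) \<longlonglongrightarrow> 0 \<Longrightarrow>
        (\<lambda>n::nat. Q (X n)) \<longlonglongrightarrow> 0" for Q x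
  proof (rule ccontr)
    assume "Q x \<noteq> 0"
    from joint_spectrum_vector[OF F_def nf red Q Qinv x this]
    obtain a s p X e where z: "(a, s, p) \<in> taylor_spectrum N (c A) (c S) (c P)" and e: "0 < e"
      and X: "\<And>n::nat. X n \<in> N" "\<And>n. e \<le> norm (Q (X n))"
      and L: "(\<lambda>n. c A (X n) - scaleC a (X n)) \<longlonglongrightarrow> 0" "(\<lambda>n. c S (X n) - scaleC s (X n)) \<longlonglongrightarrow> 0"
        "(\<lambda>n. c P (X n) - scaleC p (X n)) \<longlonglongrightarrow> 0" by blast
    have "c A (c A' x) = c A' (c A x)" "c S (c S' x) = c S' (c S x)" "c P (c P' x) = c P' (c P x)" for x
      by (simp_all add: c_def pN i normal)
    then have "(\<lambda>n. Q (X n)) \<longlonglongrightarrow> 0"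
      using spec' z by (intro lim[OF _ L] approx_eigen_adjoint[OF adj(1) _ L(1)]
          approx_eigen_adjoint[OF adj(2) _ L(2)] approx_eigen_adjoint[OF adj(3) _ L(3)]) auto
    from tendsto_norm_zero[OF this] have "e \<le> 0" by (rule tendsto_lowerbound) (use X(2) in auto)
    then show False using e by simp
  qed
  have bl: "bounded_linear E" if "E \<in> penta_identities (c A) (c A') (c S) (c S') (c P) (c P')" for E
    using penta_identities_adjoint[OF adj that] adjoint_pair_bounded_linear by blast
  have M: "csubspace M" "\<And>T x. T \<in> {c A, c A', c S, c S', c P, c P'} \<Longrightarrow> x \<in> M \<Longrightarrow> T x \<in> M"
    if "reducing F M" for M using that by (auto simp: reducing_def F_def closed_csubspace_def)
  have "c P' (c P x) - x = 0" if "x \<in> N" for x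
  proof (rule vanish[OF _ _ that])
    show "bounded_linear (\<lambda>x. c P' (c P x) - x)" by (rule bl) (simp add: penta_identities_def)
    show "c P' (c P x) - x \<in> M" if "reducing F M" "x \<in> M" for M x
      using M[OF that(1)] that(2) csubspaceD(4)[OF M(1)[OF that(1)]] by simp
  next
    fix X a s p assume "(a, s, p) \<in> bPenta" and L: "(\<lambda>n. c A (X n) - scaleC a (X n)) \<longlonglongrightarrow> 0"
      "(\<lambda>n. c S (X n) - scaleC s (X n)) \<longlonglongrightarrow> 0" "(\<lambda>n. c P (X n) - scaleC p (X n)) \<longlonglongrightarrow> 0"
      "(\<lambda>n. c A' (X n) - scaleC (cnj a) (X n)) \<longlonglongrightarrow> 0" "(\<lambda>n. c S' (X n) - scaleC (cnj s) (X n)) \<longlonglongrightarrow> 0"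
      "(\<lambda>n. c P' (X n) - scaleC (cnj p) (X n)) \<longlonglongrightarrow> 0"
    then have "p * cnj p - 1 = 0" by (simp add: bPenta_iff)
    with penta_identity_limits(1)[OF adj L] show "(\<lambda>n. c P' (c P (X n)) - X n) \<longlonglongrightarrow> 0" by simp
  qed
  then have PP: "P' (P x) = x" if "x \<in> N" for x using that i by (simp add: c_id)
  have "c S x - c S' (c P x) = 0" if "x \<in> N" for x
  proof (rule vanish[OF _ _ that])
    show "bounded_linear (\<lambda>x. c S x - c S' (c P x))" by (rule bl) (simp add: penta_identities_def)
    show "c S x - c S' (c P x) \<in> M" if "reducing F M" "x \<in> M" for M x
      using M[OF that(1)] that(2) csubspaceD(4)[OF M(1)[OF that(1)]] by simp
  next
    fix X a s p assume "(a, s, p) \<in> bPenta" and L: "(\<lambda>n. c A (X n) - scaleC a (X n)) \<longlonglongrightarrow> 0"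
      "(\<lambda>n. c S (X n) - scaleC s (X n)) \<longlonglongrightarrow> 0" "(\<lambda>n. c P (X n) - scaleC p (X n)) \<longlonglongrightarrow> 0"
      "(\<lambda>n. c A' (X n) - scaleC (cnj a) (X n)) \<longlonglongrightarrow> 0" "(\<lambda>n. c S' (X n) - scaleC (cnj s) (X n)) \<longlonglongrightarrow> 0"
      "(\<lambda>n. c P' (X n) - scaleC (cnj p) (X n)) \<longlonglongrightarrow> 0"
    then have "s - p * cnj s = 0" unfolding bPenta_iff by simp
    with penta_identity_limits(2)[OF adj L] show "(\<lambda>n. c S (X n) - c S' (c P (X n))) \<longlonglongrightarrow> 0"
      by (simp only: scaleC_zero_left diff_zero)
  qed
  then have SP: "S x - S' (P x) = 0" if "x \<in> N" for x using that i by (simp add: c_id)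
  have "c A' (c A x) + scaleC (1/4) (c S' (c S x)) - x = 0" if "x \<in> N" for x
  proof (rule vanish[OF _ _ that])
    show "bounded_linear (\<lambda>x. c A' (c A x) + scaleC (1/4) (c S' (c S x)) - x)"
      by (rule bl) (simp add: penta_identities_def)
    show "c A' (c A x) + scaleC (1/4) (c S' (c S x)) - x \<in> M" if "reducing F M" "x \<in> M" for M x
      using M[OF that(1)] that(2) csubspaceD(2-4)[OF M(1)[OF that(1)]] by simp
  next
    fix X a s p assume "(a, s, p) \<in> bPenta" and L: "(\<lambda>n. c A (X n) - scaleC a (X n)) \<longlonglongrightarrow> 0"
      "(\<lambda>n. c S (X n) - scaleC s (X n)) \<longlonglongrightarrow> 0" "(\<lambda>n. c P (X n) - scaleC p (X n)) \<longlonglongrightarrow> 0"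
      "(\<lambda>n. c A' (X n) - scaleC (cnj a) (X n)) \<longlonglongrightarrow> 0" "(\<lambda>n. c S' (X n) - scaleC (cnj s) (X n)) \<longlonglongrightarrow> 0"
      "(\<lambda>n. c P' (X n) - scaleC (cnj p) (X n)) \<longlonglongrightarrow> 0"
    then have "a * cnj a + s * cnj s / 4 - 1 = 0" unfolding bPenta_iff by simp
    with penta_identity_limits(3)[OF adj L]
    show "(\<lambda>n. c A' (c A (X n)) + scaleC (1/4) (c S' (c S (X n))) - X n) \<longlonglongrightarrow> 0"
      by (simp only: scaleC_zero_left diff_zero)
  qed
  then have "A' (A x) + scaleC (1/4) (S' (S x)) - x = 0" if "x \<in> N" for x using that i by (simp only: c_id)
  then show ?thesis using PP SP normal by (simp add: penta_identities_def)
qed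

end

section \<open>Reducing subspaces and restriction\<close>

text \<open>The sum of two admissible subspaces is admissible, so the union of all of them is again
  a subspace and admissible. Its closure is admissible by continuity and hence contained in the
  union, which is therefore closed.\<close>

lemma largest_invariant_subspace:
  fixes Ts Es :: "('a::chilbert \<Rightarrow> 'a) set"
  assumes adj: "\<forall>T\<in>Ts \<union> Es. \<exists>T'. adjoint_pair T T'"
  obtains H where "closed_csubspace H" "\<forall>T\<in>Ts. \<forall>x\<in>H. T x \<in> H" "\<forall>E\<in>Es. \<forall>x\<in>H. E x = 0"
    "\<forall>M. csubspace M \<and> (\<forall>T\<in>Ts. \<forall>x\<in>M. T x \<in> M) \<and> (\<forall>E\<in>Es. \<forall>x\<in>M. E x = 0) \<longrightarrow> M \<subseteq> H"
proof -
  define good where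
    "good M \<longleftrightarrow> csubspace M \<and> (\<forall>T\<in>Ts. \<forall>x\<in>M. T x \<in> M) \<and> (\<forall>E\<in>Es. \<forall>x\<in>M. E x = 0)" for M
  define H where "H = \<Union>{M. good M}"
  have add: "T (x + y) = T x + T y" if "T \<in> Ts \<union> Es" for T x y
    using adj that adjoint_pair_linear(1) by blast
  have bl: "bounded_linear T" if "T \<in> Ts \<union> Es" for T
    using adj that adjoint_pair_bounded_linear by blast
  have zero: "E 0 = 0" if "E \<in> Ts \<union> Es" for E using bl[OF that] by (simp add: linear_0 bounded_linear.linear)
  have good_sum: "good {u + v | u v. u \<in> M1 \<and> v \<in> M2}" if M1: "good M1" and M2: "good M2" for M1 M2
  proof -
    have s: "csubspace M1" "csubspace M2" using M1 M2 by (auto simp: good_def)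
    have "csubspace {u + v | u v. u \<in> M1 \<and> v \<in> M2}"
      unfolding csubspace_def
    proof (intro conjI ballI allI)
      show "0 \<in> {u + v | u v. u \<in> M1 \<and> v \<in> M2}" using s csubspaceD(1) by force
    next
      fix x y assume "x \<in> {u + v | u v. u \<in> M1 \<and> v \<in> M2}" "y \<in> {u + v | u v. u \<in> M1 \<and> v \<in> M2}"
      then obtain a b c d where "x = a + b" "y = c + d" "a \<in> M1" "c \<in> M1" "b \<in> M2" "d \<in> M2" by blast
      then have "x + y = (a + c) + (b + d)" "a + c \<in> M1" "b + d \<in> M2"
        using s csubspaceD(2) by (auto simp: add_ac)
      then show "x + y \<in> {u + v | u v. u \<in> M1 \<and> v \<in> M2}" by blast
    next
      fix c x assume "x \<in> {u + v | u v. u \<in> M1 \<and> v \<in> M2}"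
      then obtain a b where "x = a + b" "a \<in> M1" "b \<in> M2" by blast
      then have "scaleC c x = scaleC c a + scaleC c b" "scaleC c a \<in> M1" "scaleC c b \<in> M2"
        using s csubspaceD(3) by (auto simp: scaleC_add_right)
      then show "scaleC c x \<in> {u + v | u v. u \<in> M1 \<and> v \<in> M2}" by blast
    qed
    moreover have "T x \<in> {u + v | u v. u \<in> M1 \<and> v \<in> M2}"
      if T: "T \<in> Ts" and x: "x \<in> {u + v | u v. u \<in> M1 \<and> v \<in> M2}" for T x
    proof -
      obtain a b where ab: "x = a + b" "a \<in> M1" "b \<in> M2" using x by blast
      then have "T x = T a + T b" "T a \<in> M1" "T b \<in> M2" using M1 M2 T add by (auto simp: good_def)
      then show ?thesis by blast
    qed
    moreover have "E x = 0" if E: "E \<in> Es" and x: "x \<in> {u + v | u v. u \<in> M1 \<and> v \<in> M2}" for E x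
    proof -
      obtain a b where ab: "x = a + b" "a \<in> M1" "b \<in> M2" using x by blast
      then have "E x = E a + E b" "E a = 0" "E b = 0" using M1 M2 E add by (auto simp: good_def)
      then show ?thesis by simp
    qed
    ultimately show ?thesis unfolding good_def by blast
  qed
  have "good {0}" by (auto simp: good_def csubspace_def zero)
  have goodH: "good H"
  proof -
    have "csubspace H" unfolding csubspace_def
    proof (intro conjI ballI allI)
      show "0 \<in> H" using \<open>good {0}\<close> unfolding H_def by blast
    next
      fix x y assume "x \<in> H" "y \<in> H"
      then obtain M1 M2 where "good M1" "good M2" "x \<in> M1" "y \<in> M2" unfolding H_def by blast
      then show "x + y \<in> H" using good_sum[of M1 M2] unfolding H_def by blast
    next
      fix c x assume "x \<in> H"
      then obtain M where "good M" "x \<in> M" unfolding H_def by blast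
      moreover have "scaleC c x \<in> M" using calculation csubspaceD(3) unfolding good_def by blast
      ultimately show "scaleC c x \<in> H" unfolding H_def by blast
    qed
    moreover have "T x \<in> H" if T: "T \<in> Ts" and x: "x \<in> H" for T x
    proof -
      obtain M where "good M" "x \<in> M" using x unfolding H_def by blast
      moreover from this have "T x \<in> M" using T unfolding good_def by blast
      ultimately show ?thesis unfolding H_def by blast
    qed
    moreover have "E x = 0" if E: "E \<in> Es" and x: "x \<in> H" for E x
    proof -
      obtain M where "good M" "x \<in> M" using x unfolding H_def by blast
      then show ?thesis using E unfolding good_def by blast
    qed
    ultimately show ?thesis unfolding good_def by blast
  qed
  have "good (closure H)"
  proof -
    have H: "csubspace H" and HT: "\<And>T x. T \<in> Ts \<Longrightarrow> x \<in> H \<Longrightarrow> T x \<in> H"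
      and HE: "\<And>E x. E \<in> Es \<Longrightarrow> x \<in> H \<Longrightarrow> E x = 0" using goodH by (auto simp: good_def)
    have map: "f x \<in> closure H" if "bounded_linear f" "\<And>x. x \<in> H \<Longrightarrow> f x \<in> H" "x \<in> closure H" for f x
    proof -
      have "f ` closure H \<subseteq> closure (f ` H)" by (rule closure_bounded_linear_image_subset[OF that(1)])
      also have "\<dots> \<subseteq> closure H" using that(2) by (intro closure_mono) auto
      finally show ?thesis using that(3) by blast
    qed
    have "csubspace (closure H)" unfolding csubspace_def
    proof (intro conjI ballI allI)
      show "0 \<in> closure H" using csubspaceD(1)[OF H] closure_subset by blast
    next
      fix x y assume "x \<in> closure H" "y \<in> closure H"
      then obtain u v where uv: "\<forall>n. u n \<in> H" "u \<longlonglongrightarrow> x" "\<forall>n. v n \<in> H" "v \<longlonglongrightarrow> y"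
        unfolding closure_sequential by blast
      have "(\<lambda>n. u n + v n) \<longlonglongrightarrow> x + y" by (rule tendsto_add[OF uv(2,4)])
      moreover have "\<forall>n. u n + v n \<in> H" using uv csubspaceD(2)[OF H] by blast
      ultimately show "x + y \<in> closure H"
        unfolding closure_sequential by (intro exI[of _ "\<lambda>n. u n + v n"] conjI)
    next
      fix c x assume "x \<in> closure H"
      then show "scaleC c x \<in> closure H"
        using map[OF bounded_linear_scaleC, of c x] csubspaceD(3)[OF H] by simp
    qed
    moreover have "T x \<in> closure H" if "T \<in> Ts" "x \<in> closure H" for T x
      by (rule map[OF bl HT]) (use that in auto)
    moreover have "E x = 0" if E: "E \<in> Es" and x: "x \<in> closure H" for E x
    proof -
      obtain u where u: "\<forall>n. u n \<in> H" "u \<longlonglongrightarrow> x" using x unfolding closure_sequential by blast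
      have "(\<lambda>n. E (u n)) \<longlonglongrightarrow> E x" using bounded_linear.tendsto[OF bl u(2)] E by simp
      then show ?thesis using HE[OF E] u(1) by (simp add: LIMSEQ_const_iff)
    qed
    ultimately show ?thesis unfolding good_def by blast
  qed
  then have "closure H \<subseteq> H" unfolding H_def by blast
  then have "closed H" using closure_subset_eq by blast
  show ?thesis
  proof (rule that)
    show "closed_csubspace H" using \<open>closed H\<close> goodH by (simp add: closed_csubspace_def good_def)
  qed (use goodH in \<open>auto simp: good_def H_def\<close>)
qed

text \<open>Since \<open>proj M\<close> commutes with the triple, it sends a solution of a Koszul
  exactness condition with data in \<open>M\<close> to a solution inside \<open>M\<close>.\<close>

lemma taylor_regular_restrict:
  assumes M: "closed_csubspace M"
    and comm: "\<And>T x. T \<in> {T1, T2, T3} \<Longrightarrow> proj M (T x) = T (proj M x)"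
    and reg: "taylor_regular UNIV T1 T2 T3"
  shows "taylor_regular M T1 T2 T3"
proof -
  have p: "proj M (T1 x) = T1 (proj M x)" "proj M (T2 x) = T2 (proj M x)" "proj M (T3 x) = T3 (proj M x)" for x
    using comm by auto
  note plin = adjoint_pair_linear(1)[OF adjoint_pair_proj[OF M]] adjoint_pair_linear'(1)[OF adjoint_pair_proj[OF M]]
  note pM = proj_in[OF M] and pid = proj_id[OF M]
  show ?thesis
    unfolding taylor_regular_def
  proof (intro conjI ballI impI)
    fix x assume x: "T1 x = 0 \<and> T2 x = 0 \<and> T3 x = 0"
    have "\<forall>x\<in>UNIV. T1 x = 0 \<and> T2 x = 0 \<and> T3 x = 0 \<longrightarrow> x = 0"
      using reg unfolding taylor_regular_def by (rule conjunct1)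
    then show "x = 0" using x by blast
  next
    fix x1 x2 x3 assume x: "x1 \<in> M" "x2 \<in> M" "x3 \<in> M"
      and "T2 x3 - T3 x2 = 0 \<and> T3 x1 - T1 x3 = 0 \<and> T1 x2 - T2 x1 = 0"
    then obtain x where "x1 = T1 x" "x2 = T2 x" "x3 = T3 x"
      using reg unfolding taylor_regular_def by blast
    then have "x1 = T1 (proj M x) \<and> x2 = T2 (proj M x) \<and> x3 = T3 (proj M x)"
      using x pid p by metis
    then show "\<exists>x\<in>M. x1 = T1 x \<and> x2 = T2 x \<and> x3 = T3 x" using pM by blast
  next
    fix y1 y2 y3 assume y: "y1 \<in> M" "y2 \<in> M" "y3 \<in> M" and "T1 y1 + T2 y2 + T3 y3 = 0"
    then obtain x1 x2 x3 where "y1 = T2 x3 - T3 x2" "y2 = T3 x1 - T1 x3" "y3 = T1 x2 - T2 x1"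
      using reg unfolding taylor_regular_def by blast
    then have "y1 = T2 (proj M x3) - T3 (proj M x2) \<and> y2 = T3 (proj M x1) - T1 (proj M x3)
        \<and> y3 = T1 (proj M x2) - T2 (proj M x1)"
      using y pid plin(2) p by metis
    then show "\<exists>x1\<in>M. \<exists>x2\<in>M. \<exists>x3\<in>M. y1 = T2 x3 - T3 x2 \<and> y2 = T3 x1 - T1 x3 \<and> y3 = T1 x2 - T2 x1"
      using pM by blast
  next
    fix w assume w: "w \<in> M"
    have "\<forall>w\<in>UNIV. \<exists>y1\<in>UNIV. \<exists>y2\<in>UNIV. \<exists>y3\<in>UNIV. w = T1 y1 + T2 y2 + T3 y3"
      using reg unfolding taylor_regular_def by (elim conjE)
    then obtain y1 y2 y3 where "w = T1 y1 + T2 y2 + T3 y3" by blast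
    then have "w = T1 (proj M y1) + T2 (proj M y2) + T3 (proj M y3)"
      using pid[OF w] plin(1) p by metis
    then show "\<exists>y1\<in>M. \<exists>y2\<in>M. \<exists>y3\<in>M. w = T1 y1 + T2 y2 + T3 y3" using pM by blast
  qed
qed

text \<open>\<open>proj M\<close> commutes with every polynomial in the triple. Hence the preimage
  under \<open>q\<close> of a vector in \<open>M\<close> lies in \<open>M\<close>, the inverse on
  \<open>M\<close> restricts the global one, and the von Neumann bound is inherited with the same
  supremum.\<close>

lemma penta_contraction_restrict:
  fixes M :: "'a::chilbert set"
  assumes con: "penta_contraction_on UNIV A S P" and M: "closed_csubspace M"
    and inv: "\<And>T x. T \<in> {A, S, P} \<Longrightarrow> x \<in> M \<Longrightarrow> T x \<in> M"
    and comm: "\<And>T x. T \<in> {A, S, P} \<Longrightarrow> proj M (T x) = T (proj M x)"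
  shows "penta_contraction_on M A S P"
proof -
  have sub: "csubspace M" using M by (simp add: closed_csubspace_def)
  have bcl: "bounded_clinear_on UNIV T" if "T \<in> {A, S, P}" for T
    using con that by (auto simp: penta_contraction_on_def)
  have bclM: "bounded_clinear_on M T" if "T \<in> {A, S, P}" for T
    using bcl[OF that] inv[OF that] by (auto simp: bounded_clinear_on_def)
  note proj = adjoint_pair_proj[OF M]
  note plin = adjoint_pair_linear[OF proj] adjoint_pair_linear'[OF proj]
  note pM = proj_in[OF M] and pid = proj_id[OF M]
  have Tlin: "T (x - y) = T x - T y" "T (scaleC c x) = scaleC c (T x)" if "T \<in> {A, S, P}" for T x y c
    using adjoint_exists[OF bcl[OF that]] adjoint_pair_linear'(1) adjoint_pair_linear(2) by blast+
  have spec: "taylor_spectrum M A S P \<subseteq> taylor_spectrum UNIV A S P"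
  proof -
    have "taylor_regular M (\<lambda>x. A x - scaleC a x) (\<lambda>x. S x - scaleC s x) (\<lambda>x. P x - scaleC p x)"
      if "taylor_regular UNIV (\<lambda>x. A x - scaleC a x) (\<lambda>x. S x - scaleC s x) (\<lambda>x. P x - scaleC p x)" for a s p
      by (rule taylor_regular_restrict[OF M _ that])
        (auto simp: plin comm Tlin scaleC_diff_right algebra_simps)
    then show ?thesis unfolding taylor_spectrum_def by blast
  qed
  have pow: "proj M ((T ^^ n) x) = (T ^^ n) (proj M x)" if "T \<in> {A, S, P}" for T n x
    by (rule funpow_commute_apply) (rule comm[OF that])
  have poly: "proj M (poly3_op c A S P x) = poly3_op c A S P (proj M x)" for c x
    unfolding poly3_op_def
    by (subst linear_sum[OF bounded_linear.linear[OF adjoint_pair_bounded_linear[OF proj]]])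
      (auto intro!: sum.cong simp: plin pow)
  have polyM: "poly3_op c A S P x \<in> M" if "x \<in> M" for c x
    using poly[of c x] pid[OF that] pM by metis
  have "bij_betw (poly3_op q A S P) M M \<and>
      (\<forall>y\<in>M. norm (poly3_op p A S P (the_inv_into M (poly3_op q A S P) y))
             \<le> (SUP z\<in>closure pentablock. cmod (poly3_eval p z / poly3_eval q z)) * norm y)"
    if "poly3 p" "poly3 q" "\<forall>z\<in>closure pentablock. poly3_eval q z \<noteq> 0" for p q
  proof -
    let ?q = "poly3_op q A S P"
    have bij: "bij_betw ?q UNIV UNIV"
      and bd: "\<And>y. norm (poly3_op p A S P (the_inv_into UNIV ?q y))
             \<le> (SUP z\<in>closure pentablock. cmod (poly3_eval p z / poly3_eval q z)) * norm y"
      using con that unfolding penta_contraction_on_def by blast+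
    have inj: "inj ?q" using bij by (simp add: bij_betw_def)
    then have injM: "inj_on ?q M" by (rule inj_on_subset) simp
    have surj: "\<exists>x\<in>M. ?q x = y" if y: "y \<in> M" for y
    proof -
      obtain x where "?q x = y" using bij by (metis UNIV_I bij_betw_def imageE)
      then have "?q (proj M x) = y" using poly[of q x] pid[OF y] by simp
      then show ?thesis using pM by blast
    qed
    have "?q ` M = M" using polyM surj by blast
    then have "bij_betw ?q M M" using injM by (simp add: bij_betw_def)
    moreover have "the_inv_into M ?q y = the_inv_into UNIV ?q y" if y: "y \<in> M" for y
    proof -
      obtain x where x: "x \<in> M" "?q x = y" using surj[OF y] by blast
      then show ?thesis using the_inv_into_f_f[OF injM x(1)] the_inv_into_f_f[OF inj UNIV_I, of x] by simp
    qed
    ultimately show ?thesis using bd by simp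
  qed
  moreover have "commuting_on M A S P" "taylor_spectrum UNIV A S P \<subseteq> closure pentablock"
    using con by (auto simp: penta_contraction_on_def commuting_on_def)
  ultimately show ?thesis
    unfolding penta_contraction_on_def using bclM spec by blast
qed

text \<open>The hypothesis is relative to the complement of \<open>H\<close>, whereas the adjoint
  lives on the whole space. A vector orthogonal to \<open>N\<close> splits into a part in
  \<open>H\<close> and a part in the complement of \<open>H\<close> that is still orthogonal to
  \<open>N\<close>. \<open>T\<close> keeps both parts orthogonal to \<open>N\<close>, so
  \<open>T' y\<close> lies in the double complement of \<open>N\<close>.\<close>

lemma reduces_in_adjoint_invariant:
  assumes T: "adjoint_pair T T'" and H: "closed_csubspace H" and TH: "\<And>x. x \<in> H \<Longrightarrow> T x \<in> H"
    and N: "closed_csubspace N" and red: "reduces_in (orth_in UNIV H) N T" and y: "y \<in> N"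
  shows "T' y \<in> N"
proof -
  have NH: "N \<subseteq> orth_in UNIV H" using red by (simp add: reduces_in_def)
  have "cinner v (T' y) = 0" if v: "v \<in> orth_in UNIV N" for v
  proof -
    define u where "u = proj H v"
    define w where "w = v - u"
    have u: "u \<in> H" and w: "w \<in> orth_in UNIV H"
      using proj_in[OF H] diff_proj_in_orth[OF H] by (auto simp: u_def w_def)
    have "cinner n w = 0" if "n \<in> N" for n
    proof -
      have "cinner n v = 0" using v that by (simp add: orth_in_def)
      moreover have "cinner n u = 0" using NH u that cinner_orth_commute by (force simp: orth_in_def)
      ultimately show ?thesis by (simp add: w_def cinner_diff_right)
    qed
    then have "w \<in> orth_in (orth_in UNIV H) N" using w by (simp add: orth_in_def)
    then have "T w \<in> orth_in (orth_in UNIV H) N" using red by (auto simp: reduces_in_def)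
    then have "cinner (T w) y = 0" using y cinner_orth_commute by (force simp: orth_in_def)
    moreover have "cinner (T u) y = 0" using NH y TH[OF u] by (auto simp: orth_in_def)
    moreover have "T v = T u + T w" by (simp add: w_def adjoint_pair_linear'[OF T])
    ultimately have "cinner (T v) y = 0" by (simp add: cinner_add_left)
    then show ?thesis by (simp add: adjoint_pairD[OF T])
  qed
  then have "T' y \<in> orth_in UNIV (orth_in UNIV N)" by (simp add: orth_in_def)
  then show ?thesis using orth_orth[OF N] by simp
qed

text \<open>\<open>normal_on\<close> supplies some adjoint on \<open>N\<close>; by uniqueness it
  agrees there with the restriction of the global \<open>T'\<close>.\<close>

lemma normal_on_adjoint:
  assumes T: "adjoint_pair T T'" and N: "csubspace N" and T'N: "\<And>x. x \<in> N \<Longrightarrow> T' x \<in> N"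
    and normal: "normal_on N T" and x: "x \<in> N"
  shows "T (T' x) = T' (T x)"
proof -
  obtain T'' where T'': "T'' ` N \<subseteq> N" "\<forall>x\<in>N. \<forall>y\<in>N. cinner (T x) y = cinner x (T'' y)"
    "\<forall>x\<in>N. T (T'' x) = T'' (T x)" and TN: "T ` N \<subseteq> N"
    using normal by (auto simp: normal_on_def bounded_clinear_on_def)
  have eq: "T'' y = T' y" if y: "y \<in> N" for y
  proof -
    let ?d = "T'' y - T' y"
    have "?d \<in> N" using csubspaceD(4)[OF N] T''(1) T'N y by blast
    then have "cinner ?d (T'' y) = cinner ?d (T' y)" using T''(2) y adjoint_pairD[OF T] by metis
    then have "cinner ?d ?d = 0" by (simp add: cinner_diff_right)
    then show ?thesis by simp
  qed
  show ?thesis using T''(3) x eq TN by (metis image_subset_iff)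
qed

section \<open>The unitary part and its completely non-unitary complement\<close>

theorem mainTheorem4:
  fixes A S P :: "'a::chilbert \<Rightarrow> 'a"
  assumes "penta_contraction_on UNIV A S P"
  shows "\<exists>Hu Hc. closed_csubspace Hu \<and> closed_csubspace Hc
    \<and> (\<forall>u\<in>Hu. \<forall>c\<in>Hc. cinner u c = 0)
    \<and> (\<forall>h. \<exists>u\<in>Hu. \<exists>c\<in>Hc. h = u + c)
    \<and> reduces_in UNIV Hu A \<and> reduces_in UNIV Hu S \<and> reduces_in UNIV Hu P
    \<and> reduces_in UNIV Hc A \<and> reduces_in UNIV Hc S \<and> reduces_in UNIV Hc P
    \<and> penta_unitary_on Hu A S P
    \<and> penta_contraction_on Hc A S P \<and> penta_cnu_on Hc A S P"
proof -
  have bcl: "bounded_clinear_on UNIV A" "bounded_clinear_on UNIV S" "bounded_clinear_on UNIV P"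
    and comm: "commuting_on UNIV A S P"
    using assms by (auto simp: penta_contraction_on_def)
  obtain A' S' P' where adj: "adjoint_pair A A'" "adjoint_pair S S'" "adjoint_pair P P'"
    using bcl[THEN adjoint_exists] by blast
  define Ts where "Ts = {A, S, P, A', S', P'}"
  define Es where "Es = penta_identities A A' S S' P P'"
  have "\<exists>T'. adjoint_pair T T'" if "T \<in> Ts \<union> Es" for T
    using that adj adj[THEN adjoint_pair_sym] penta_identities_adjoint[OF adj] unfolding Ts_def Es_def by blast
  then have "\<forall>T\<in>Ts \<union> Es. \<exists>T'. adjoint_pair T T'" by blast
  then obtain Hu where Hu: "closed_csubspace Hu" and inv: "\<forall>T\<in>Ts. \<forall>x\<in>Hu. T x \<in> Hu"
    and ids: "\<forall>E\<in>Es. \<forall>x\<in>Hu. E x = 0"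
    and max: "\<forall>M. csubspace M \<and> (\<forall>T\<in>Ts. \<forall>x\<in>M. T x \<in> M) \<and> (\<forall>E\<in>Es. \<forall>x\<in>M. E x = 0) \<longrightarrow> M \<subseteq> Hu"
    by (rule largest_invariant_subspace)
  define Hc where "Hc = orth_in UNIV Hu"
  have Hc: "closed_csubspace Hc" unfolding Hc_def by (rule closed_csubspace_orth_in)
  have pair: "\<exists>T'. adjoint_pair T T' \<and> T \<in> Ts \<and> T' \<in> Ts" if "T \<in> {A, S, P}" for T
    using that adj unfolding Ts_def by blast
  have Hu_inv: "T x \<in> Hu" if "T \<in> {A, S, P}" "x \<in> Hu" for T x using inv that by (auto simp: Ts_def)
  \<comment> \<open>\<open>Ts\<close> is closed under adjoints, so the invariance of
    \<open>Hu\<close> passes to its complement.\<close>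
  have Hc_inv: "T x \<in> Hc" if "T \<in> Ts" "x \<in> Hc" for T x
  proof -
    have "\<exists>T'. adjoint_pair T T' \<and> T' \<in> Ts"
      using that(1) adj adj[THEN adjoint_pair_sym] unfolding Ts_def by blast
    then obtain T' where "adjoint_pair T T'" "T' \<in> Ts" by blast
    then show ?thesis using adjoint_invariant_orth inv that(2) unfolding Hc_def by blast
  qed
  have Hcu: "orth_in UNIV Hc = Hu" unfolding Hc_def by (rule orth_orth[OF Hu])
  have red_u: "reduces_in UNIV Hu T" if "T \<in> {A, S, P}" for T
    using that Hu_inv Hc_inv unfolding reduces_in_def Hc_def[symmetric] by (auto simp: Ts_def)
  have red_c: "reduces_in UNIV Hc T" if "T \<in> {A, S, P}" for T
    using that Hu_inv Hc_inv unfolding reduces_in_def Hcu by (auto simp: Ts_def)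
  have orth: "cinner u c = 0" if "u \<in> Hu" "c \<in> Hc" for u c using that by (simp add: Hc_def orth_in_def)
  have dec: "\<exists>u\<in>Hu. \<exists>c\<in>Hc. h = u + c" for h
  proof (intro bexI)
    show "h = proj Hu h + (h - proj Hu h)" by simp
    show "h - proj Hu h \<in> Hc" unfolding Hc_def by (rule diff_proj_in_orth[OF Hu])
  qed (rule proj_in[OF Hu])
  have "commuting_on Hu A S P" using comm by (simp add: commuting_on_def)
  then have unitary: "penta_unitary_on Hu A S P"
    using penta_unitary_of_identities[OF adj Hu] inv ids unfolding Ts_def Es_def by blast
  have contr: "penta_contraction_on Hc A S P"
  proof (rule penta_contraction_restrict[OF assms Hc])
    show "T x \<in> Hc" if "T \<in> {A, S, P}" "x \<in> Hc" for T x using Hc_inv that by (auto simp: Ts_def)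
    show "proj Hc (T x) = T (proj Hc x)" if T: "T \<in> {A, S, P}" for T x
    proof -
      obtain T' where "adjoint_pair T T'" "T \<in> Ts" "T' \<in> Ts" using pair[OF T] by blast
      then show ?thesis using proj_commute[OF Hc] Hc_inv by blast
    qed
  qed
  have "N = {0}" if N: "closed_csubspace N" and red: "reduces_in Hc N A" "reduces_in Hc N S" "reduces_in Hc N P"
    and uni: "penta_unitary_on N A S P" for N
  proof -
    have sub: "csubspace N" using N by (simp add: closed_csubspace_def)
    have N': "A' x \<in> N" "S' x \<in> N" "P' x \<in> N" if "x \<in> N" for x
      using reduces_in_adjoint_invariant[OF adj(1) Hu _ N red(1)[unfolded Hc_def] that]
        reduces_in_adjoint_invariant[OF adj(2) Hu _ N red(2)[unfolded Hc_def] that]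
        reduces_in_adjoint_invariant[OF adj(3) Hu _ N red(3)[unfolded Hc_def] that] Hu_inv by auto
    have Ninv: "\<forall>T\<in>{A, S, P, A', S', P'}. \<forall>x\<in>N. T x \<in> N"
      using N' red by (auto simp: reduces_in_def)
    have nrm: "normal_on N A" "normal_on N S" "normal_on N P" and cN: "commuting_on N A S P"
      and spec: "taylor_spectrum N A S P \<subseteq> bPenta" using uni by (auto simp: penta_unitary_on_def)
    \<comment> \<open>With the identities, \<open>N\<close> is one of the subspaces over which
      \<open>Hu\<close> is maximal. So \<open>N\<close> lies in \<open>Hu\<close> as well as in its
      complement and must be zero.\<close>
    have "\<forall>E\<in>Es. \<forall>x\<in>N. E x = 0"
      unfolding Es_def
      by (rule identities_of_penta_unitary[OF adj N Ninv cN normal_on_adjoint[OF adj(1) sub N'(1) nrm(1)]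
            normal_on_adjoint[OF adj(2) sub N'(2) nrm(2)] normal_on_adjoint[OF adj(3) sub N'(3) nrm(3)] spec])
    then have "N \<subseteq> Hu" using max sub Ninv unfolding Ts_def by blast
    moreover have "N \<subseteq> Hc" using red by (simp add: reduces_in_def)
    ultimately have "x = 0" if "x \<in> N" for x using orth[of x x] that by auto
    then show ?thesis using csubspaceD(1)[OF sub] by blast
  qed
  then have cnu: "penta_cnu_on Hc A S P" unfolding penta_cnu_on_def using contr by blast
  show ?thesis
    by (rule exI[of _ Hu], rule exI[of _ Hc])
      (use Hu Hc orth dec red_u red_c unitary contr cnu in blast)
qed

end
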